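(* Let $n\ge2$, $k\ge1$ an integer and $0<\alpha<1$. Let $f$ be a function of class $C^{k+\alpha}(\mathbb{R})$ with $f(0)=f'(0)=0$. Then for any given $R>0$ the equation $$\Delta u=f(u)$$ has infinitely many (real-valued) solutions of class $C^{k+2+\alpha}(\{x\in\mathbb{R}^n:|x|\le R\})$ which are of vanishing order $2$ at the origin and are neither radially symmetric nor positive.
   Context: A solution $u$ is of vanishing order two at the origin if $u(0)=0$, $\nabla u(0)=0$ and $\nabla^2u(0)\ne0$. A function $u$ on the ball is radially symmetric if $u(x)$ depends only on $|x|$. $C^{k+\alpha}$ denotes functions whose $k$-th order partial derivatives exist and are Hölder continuous with exponent $\alpha$. *)

theory Defs
  imports "HOL-Analysis.Analysis"
begin

text \<open>
  Partial derivatives are taken relative to the domain S, as values of the Frechet derivative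
  at x within S on the standard basis vectors.  At interior points this is the
  ordinary partial derivative.  On a convex set with nonempty interior, such as a closed ball, the
  derivative is unique also at boundary points (lemma \<open>partial_on_eqI\<close>), so that the derivatives
  up to the boundary are well defined; they are the continuous extensions of the interior ones
  whenever they are continuous.
\<close>

definition partial_on :: "'a::euclidean_space set \<Rightarrow> 'a \<Rightarrow> ('a \<Rightarrow> real) \<Rightarrow> 'a \<Rightarrow> real" where
  "partial_on S b u x = frechet_derivative u (at x within S) b"

primrec partials_on :: "'a::euclidean_space set \<Rightarrow> 'a list \<Rightarrow> ('a \<Rightarrow> real) \<Rightarrow> 'a \<Rightarrow> real" where
  "partials_on S [] u = u"
| "partials_on S (b # bs) u = partial_on S b (partials_on S bs u)"

text \<open>
  Hoelder continuity is required uniformly on compact subsets: for compact S this is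
  Hoelder continuity on S, for S = UNIV it is the usual local Hoelder continuity.
\<close>

definition hoelder_on :: "real \<Rightarrow> 'a::metric_space set \<Rightarrow> ('a \<Rightarrow> real) \<Rightarrow> bool" where
  "hoelder_on \<alpha> S u \<longleftrightarrow>
     (\<forall>K\<subseteq>S. compact K \<longrightarrow> (\<exists>C. \<forall>x\<in>K. \<forall>y\<in>K. \<bar>u x - u y\<bar> \<le> C * dist x y powr \<alpha>))"

definition C_hoelder :: "nat \<Rightarrow> real \<Rightarrow> 'a::euclidean_space set \<Rightarrow> ('a \<Rightarrow> real) \<Rightarrow> bool" where
  "C_hoelder k \<alpha> S u \<longleftrightarrow>
     (\<forall>bs\<in>lists Basis.
        (length bs < k \<longrightarrow> partials_on S bs u differentiable_on S) \<and>
        (length bs = k \<longrightarrow> hoelder_on \<alpha> S (partials_on S bs u)))"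

definition laplacian_on :: "'a::euclidean_space set \<Rightarrow> ('a \<Rightarrow> real) \<Rightarrow> 'a \<Rightarrow> real" where
  "laplacian_on S u x = (\<Sum>b\<in>Basis. partials_on S [b, b] u x)"

definition vanishing_order_two :: "'a::euclidean_space set \<Rightarrow> ('a \<Rightarrow> real) \<Rightarrow> bool" where
  "vanishing_order_two S u \<longleftrightarrow>
     u 0 = 0 \<and> (\<forall>b\<in>Basis. partial_on S b u 0 = 0) \<and>
     (\<exists>b\<in>Basis. \<exists>c\<in>Basis. partials_on S [b, c] u 0 \<noteq> 0)"

definition radially_symmetric_on :: "'a::real_normed_vector set \<Rightarrow> ('a \<Rightarrow> real) \<Rightarrow> bool" where
  "radially_symmetric_on S u \<longleftrightarrow> (\<forall>x\<in>S. \<forall>y\<in>S. norm x = norm y \<longrightarrow> u x = u y)"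

text \<open>
  Positivity of u is understood in the weak sense, since strict positivity on all of S is
  excluded trivially by u 0 = 0.  Failing to be positive in this sense implies failing to be
  positive in the strict sense, also if the origin is exempted.
\<close>

definition positive_on :: "'a set \<Rightarrow> ('a \<Rightarrow> real) \<Rightarrow> bool" where
  "positive_on S u \<longleftrightarrow> (\<forall>x\<in>S. 0 \<le> u x)"

lemma partial_on_interior:
  "x \<in> interior S \<Longrightarrow> partial_on S b u x = frechet_derivative u (at x) b"
  by (simp only: partial_on_def at_within_interior[of x S])

lemma partial_on_eqI:
  fixes S :: "'a::euclidean_space set"
  assumes S: "convex S" "interior S \<noteq> {}" "x \<in> S"
    and D: "(u has_derivative D) (at x within S)"
  shows "partial_on S b u x = D b"
proof -
  define E where "E = frechet_derivative u (at x within S)"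
  have E: "(u has_derivative E) (at x within S)"
    unfolding E_def using D differentiableI frechet_derivative_works by blast
  have line: "((\<lambda>t. u (x + t *\<^sub>R (y - x))) has_vector_derivative F (y - x)) (at 0 within {0..1})"
    if F: "(u has_derivative F) (at x within S)" and y: "y \<in> S" for F y
  proof -
    let ?p = "\<lambda>t::real. x + t *\<^sub>R (y - x)"
    have "?p t \<in> S" if "t \<in> {0..1}" for t
      using convexD_alt[OF S(1) S(3) y, of t] that by (simp add: algebra_simps)
    then have "?p ` {0..1} \<subseteq> S"
      by blast
    from has_derivative_subset[OF F this]
    have "(u has_derivative F) (at (?p 0) within ?p ` {0..1})"
      by simp
    moreover have "(?p has_derivative (\<lambda>t. 0 + t *\<^sub>R (y - x))) (at 0 within {0..1})"
      by (intro has_derivative_add has_derivative_const has_derivative_scaleR_left has_derivative_ident)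
    ultimately have "((\<lambda>t. u (?p t)) has_derivative (\<lambda>t. F (0 + t *\<^sub>R (y - x)))) (at 0 within {0..1})"
      by (rule has_derivative_in_compose[of ?p _ 0 "{0..1}" u F, rotated])
    then show ?thesis
      using linear_cmul[OF has_derivative_linear[OF F]] by (simp add: has_vector_derivative_def)
  qed
  have eq: "D (y - x) = E (y - x)" if "y \<in> S" for y
    by (rule vector_derivative_unique_within_closed_interval[of 0 1 0])
      (use line[OF D that] line[OF E that] in simp_all)
  obtain z e where z: "0 < e" "cball z e \<subseteq> S"
    using S(2) mem_interior_cball by blast
  have lin: "linear D" "linear E"
    using D E by (auto dest: has_derivative_linear)
  have "D b = E b"
  proof (cases "b = 0")
    case False
    define r where "r = e / norm b"
    have r: "r \<noteq> 0" "z \<in> S" "z + r *\<^sub>R b \<in> S"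
      using z False by (simp_all add: r_def dist_norm subset_iff)
    have "r *\<^sub>R D b = D ((z + r *\<^sub>R b) - x) - D (z - x)"
      by (simp add: linear_diff[OF lin(1)] linear_add[OF lin(1)] linear_cmul[OF lin(1)])
    also have "\<dots> = E ((z + r *\<^sub>R b) - x) - E (z - x)"
      by (simp only: eq[OF r(2)] eq[OF r(3)])
    also have "\<dots> = r *\<^sub>R E b"
      by (simp add: linear_diff[OF lin(2)] linear_add[OF lin(2)] linear_cmul[OF lin(2)])
    finally show ?thesis using r by simp
  qed (simp add: linear_0[OF lin(1)] linear_0[OF lin(2)])
  then show ?thesis by (simp add: partial_on_def E_def)
qed

end

theory Submission
  imports Defs
begin

text \<open>
  The solutions are perturbations of \<open>\<epsilon> (x\<^sub>i\<^sup>2 - x\<^sub>j\<^sup>2)\<close> that depend on two coordinates only, so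
  everything happens in the plane, identified with the complex numbers. With a cutoff \<open>\<zeta>\<close> of the ball
  one solves \<open>g = \<zeta> f(\<epsilon> q + W g)\<close> by Banach's fixed point theorem in the sup norm, where
  \<open>q z = Re (z\<^sup>2)\<close> and \<open>W g\<close> is the logarithmic potential of \<open>g\<close> minus its 1-jet at the origin.
  As \<open>f(0) = f'(0) = 0\<close>, the Lipschitz constant of \<open>f\<close> near 0 is as small as desired; hence the map
  is a contraction and \<open>W g\<close>, together with its second derivatives at the origin, is small compared
  with \<open>\<epsilon>\<close>. Different values of \<open>\<epsilon>\<close> give different solutions.

  The Schauder estimate for the potential avoids singular integrals: the logarithmic kernel
  is regularised to be polynomial in the unit disc, and its dyadic rescalings telescope,
  so that the potential is a convolution with a \<open>C\<^sup>2\<close> kernel plus a series of convolutions with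
  rescalings of one compactly supported kernel, whose second derivatives have mean zero.
\<close>

section \<open>Hoelder classes on the whole space\<close>

text \<open>The fixed point space carries only the sup norm. This is enough because the gradient of
  the potential is bounded by the sup norm of the density; all regularity is recovered afterwards by
  bootstrapping. The price is that the sup norm of \<open>g\<close> does not control the Hessian of
  \<open>W g\<close>. But only the Hessian at the origin has to be small, and there \<open>g\<close>
  vanishes linearly, since the argument of \<open>f\<close> does and \<open>f 0 = 0\<close>; this
  makes the dyadic series for that Hessian converge without any cancellation. The Lipschitz constant
  of \<open>f\<close> is fixed before \<epsilon>, in terms of the constants of the linear theory, so
  that one threshold serves all smaller \<epsilon>. At the real point R the solution lies between
  \<epsilon> R^2 / 2 and 3 \<epsilon> R^2 / 2, which separates the solutions belonging to \<epsilon>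
  and \<epsilon> / 4. Everything is defined on the whole plane, so that regularity up to the
  boundary of the ball comes from restriction.\<close>

abbreviation (input) pd :: "'a::euclidean_space \<Rightarrow> ('a \<Rightarrow> real) \<Rightarrow> 'a \<Rightarrow> real" where
  "pd \<equiv> partial_on UNIV"

abbreviation (input) C_loc :: "nat \<Rightarrow> real \<Rightarrow> ('a::euclidean_space \<Rightarrow> real) \<Rightarrow> bool" where
  "C_loc k \<alpha> \<equiv> C_hoelder k \<alpha> UNIV"

lemma pd_eqI: "(u has_derivative D) (at x) \<Longrightarrow> pd b u x = D b"
  by (metis partial_on_def frechet_derivative_at)

lemma has_derivative_pd:
  fixes u :: "'a::euclidean_space \<Rightarrow> real"
  assumes "u differentiable (at x)"
  shows "(u has_derivative (\<lambda>h. \<Sum>b\<in>Basis. pd b u x * (h \<bullet> b))) (at x)"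
proof -
  have D: "(u has_derivative frechet_derivative u (at x)) (at x)"
    using assms frechet_derivative_works by blast
  have "frechet_derivative u (at x) h = (\<Sum>b\<in>Basis. pd b u x * (h \<bullet> b))" for h
    using Linear_Algebra.linear_componentwise[OF has_derivative_linear[OF D], of h 1]
    by (simp add: partial_on_def mult.commute)
  then have "frechet_derivative u (at x) = (\<lambda>h. \<Sum>b\<in>Basis. pd b u x * (h \<bullet> b))"
    by blast
  then show ?thesis
    using D by simp
qed

lemma pd_eq_sumI:
  fixes u :: "'a::euclidean_space \<Rightarrow> real"
  assumes "(u has_derivative (\<lambda>h. \<Sum>b\<in>Basis. D b * (h \<bullet> b))) (at x)" "b \<in> Basis"
  shows "pd b u x = D b"
proof -
  have "(\<Sum>c\<in>Basis. D c * (b \<bullet> c)) = (\<Sum>c\<in>Basis. if c = b then D b else 0)"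
    using assms(2) by (intro sum.cong) (auto simp: inner_Basis)
  then show ?thesis
    using pd_eqI[OF assms(1), of b] assms(2) by simp
qed

lemma compact_subset_cball0:
  assumes "compact (K :: 'a::real_normed_vector set)"
  obtains r where "K \<subseteq> cball 0 r"
proof -
  obtain r where "\<forall>x\<in>K. norm x \<le> r"
    using compact_imp_bounded[OF assms] unfolding bounded_iff by blast
  then have "K \<subseteq> cball 0 r"
    by auto
  then show ?thesis
    by (rule that)
qed

lemma hoelder_on_UNIV:
  fixes u :: "'a::euclidean_space \<Rightarrow> real"
  shows "hoelder_on \<alpha> UNIV u \<longleftrightarrow>
    (\<forall>r. \<exists>C\<ge>0. \<forall>x\<in>cball 0 r. \<forall>y\<in>cball 0 r. \<bar>u x - u y\<bar> \<le> C * dist x y powr \<alpha>)"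
    (is "?L \<longleftrightarrow> ?R")
proof
  assume L: ?L
  show ?R
  proof
    fix r
    obtain C where C: "\<forall>x\<in>cball 0 r. \<forall>y\<in>cball 0 r. \<bar>u x - u y\<bar> \<le> C * dist x y powr \<alpha>"
      using L[unfolded hoelder_on_def, rule_format, OF subset_UNIV compact_cball] by blast
    have "\<bar>u x - u y\<bar> \<le> \<bar>C\<bar> * dist x y powr \<alpha>" if "x \<in> cball 0 r" "y \<in> cball 0 r" for x y
      using C that by (meson abs_ge_self mult_right_mono order_trans powr_ge_zero)
    then show "\<exists>C\<ge>0. \<forall>x\<in>cball 0 r. \<forall>y\<in>cball 0 r. \<bar>u x - u y\<bar> \<le> C * dist x y powr \<alpha>"
      by (intro exI[of _ "\<bar>C\<bar>"]) auto
  qed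
next
  assume R: ?R
  show ?L
    unfolding hoelder_on_def
  proof (intro allI impI)
    fix K :: "'a set"
    assume "compact K"
    then obtain r where r: "K \<subseteq> cball 0 r"
      using compact_subset_cball0 by blast
    obtain C where "\<forall>x\<in>cball 0 r. \<forall>y\<in>cball 0 r. \<bar>u x - u y\<bar> \<le> C * dist x y powr \<alpha>"
      using R[rule_format, of r] by blast
    then show "\<exists>C. \<forall>x\<in>K. \<forall>y\<in>K. \<bar>u x - u y\<bar> \<le> C * dist x y powr \<alpha>"
      using r by blast
  qed
qed

lemma hoelder_obtain:
  fixes u :: "'a::euclidean_space \<Rightarrow> real"
  assumes "hoelder_on \<alpha> UNIV u"
  obtains C where "C \<ge> 0"
    "\<And>x y. norm x \<le> r \<Longrightarrow> norm y \<le> r \<Longrightarrow> \<bar>u x - u y\<bar> \<le> C * dist x y powr \<alpha>"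
proof -
  obtain C where "C \<ge> 0" "\<forall>x\<in>cball 0 r. \<forall>y\<in>cball 0 r. \<bar>u x - u y\<bar> \<le> C * dist x y powr \<alpha>"
    using assms[unfolded hoelder_on_UNIV, rule_format, of r] by blast
  then show ?thesis
    using that[of C] by simp
qed

lemma hoelder_onI:
  fixes u :: "'a::euclidean_space \<Rightarrow> real"
  assumes "\<And>r. \<exists>C. \<forall>x y. norm x \<le> r \<longrightarrow> norm y \<le> r \<longrightarrow> \<bar>u x - u y\<bar> \<le> C * dist x y powr \<alpha>"
  shows "hoelder_on \<alpha> UNIV u"
  unfolding hoelder_on_def
proof (intro allI impI)
  fix K :: "'a set"
  assume "compact K"
  then obtain r where r: "K \<subseteq> cball 0 r"
    using compact_subset_cball0 by blast
  obtain C where "\<forall>x y. norm x \<le> r \<longrightarrow> norm y \<le> r \<longrightarrow> \<bar>u x - u y\<bar> \<le> C * dist x y powr \<alpha>"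
    using assms[of r] by blast
  then have "\<forall>x\<in>K. \<forall>y\<in>K. \<bar>u x - u y\<bar> \<le> C * dist x y powr \<alpha>"
    using r by (auto simp: subset_iff)
  then show "\<exists>C. \<forall>x\<in>K. \<forall>y\<in>K. \<bar>u x - u y\<bar> \<le> C * dist x y powr \<alpha>"
    by blast
qed

lemma hoelder_imp_continuous:
  fixes u :: "'a::euclidean_space \<Rightarrow> real"
  assumes "hoelder_on \<alpha> UNIV u" "0 < \<alpha>"
  shows "continuous_on S u"
proof -
  have "isCont u x" for x
  proof -
    obtain C where C: "C \<ge> 0"
      "\<And>y z. norm y \<le> norm x + 1 \<Longrightarrow> norm z \<le> norm x + 1 \<Longrightarrow> \<bar>u y - u z\<bar> \<le> C * dist y z powr \<alpha>"
      using hoelder_obtain[OF assms(1)] by blast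
    have "((\<lambda>y. C * dist y x powr \<alpha>) \<longlongrightarrow> C * dist x x powr \<alpha>) (at x)"
      using assms(2) by (intro tendsto_intros tendsto_powr') auto
    then have lim: "((\<lambda>y. C * dist y x powr \<alpha>) \<longlongrightarrow> 0) (at x)"
      by simp
    have "norm y \<le> norm x + 1" if "dist y x < 1" for y
      using that norm_triangle_ineq2[of y x] by (simp add: dist_norm)
    then have "\<forall>\<^sub>F y in at x. norm (u y - u x) \<le> C * dist y x powr \<alpha>"
      using C(2)[of _ x] unfolding eventually_at by (intro exI[of _ 1]) auto
    from Lim_null_comparison[OF this lim] show ?thesis
      unfolding isCont_def using Lim_null by blast
  qed
  then show ?thesis
    by (simp add: continuous_at_imp_continuous_on)
qed

lemma continuous_bounded_cball:
  fixes u :: "'a::euclidean_space \<Rightarrow> real"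
  assumes "continuous_on UNIV u"
  obtains B where "B \<ge> 0" "\<And>x. norm x \<le> r \<Longrightarrow> \<bar>u x\<bar> \<le> B"
proof -
  have "bounded (u ` cball 0 r)"
    by (intro compact_imp_bounded compact_continuous_image continuous_on_subset[OF assms]) auto
  then obtain B where "B > 0" "\<forall>x\<in>cball 0 r. \<bar>u x\<bar> \<le> B"
    unfolding bounded_pos by auto
  then show ?thesis using that[of B] by auto
qed

section \<open>Closure properties of Hoelder continuity\<close>

lemma hoelder_const: "hoelder_on \<alpha> S (\<lambda>x. c)"
  unfolding hoelder_on_def by (auto intro!: exI[of _ 0])

lemma hoelder_add:
  assumes "hoelder_on \<alpha> S u" "hoelder_on \<alpha> S v"
  shows "hoelder_on \<alpha> S (\<lambda>x. u x + v x)"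
  unfolding hoelder_on_def
proof (intro allI impI)
  fix K assume K: "K \<subseteq> S" "compact K"
  obtain C D where C: "\<forall>x\<in>K. \<forall>y\<in>K. \<bar>u x - u y\<bar> \<le> C * dist x y powr \<alpha>"
    and D: "\<forall>x\<in>K. \<forall>y\<in>K. \<bar>v x - v y\<bar> \<le> D * dist x y powr \<alpha>"
    using assms K unfolding hoelder_on_def by meson
  have "\<bar>(u x + v x) - (u y + v y)\<bar> \<le> (C + D) * dist x y powr \<alpha>" if "x \<in> K" "y \<in> K" for x y
  proof -
    have "\<bar>u x - u y\<bar> \<le> C * dist x y powr \<alpha>" "\<bar>v x - v y\<bar> \<le> D * dist x y powr \<alpha>"
      using C D that by blast+
    then show ?thesis by (simp add: algebra_simps)
  qed
  then show "\<exists>C. \<forall>x\<in>K. \<forall>y\<in>K. \<bar>u x + v x - (u y + v y)\<bar> \<le> C * dist x y powr \<alpha>"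
    by blast
qed

lemma hoelder_mult:
  fixes u v :: "'a::euclidean_space \<Rightarrow> real"
  assumes u: "hoelder_on \<alpha> UNIV u" and v: "hoelder_on \<alpha> UNIV v" and "0 < \<alpha>"
  shows "hoelder_on \<alpha> UNIV (\<lambda>x. u x * v x)"
proof (rule hoelder_onI)
  fix r
  obtain C where C: "C \<ge> 0"
    "\<And>x y. norm x \<le> r \<Longrightarrow> norm y \<le> r \<Longrightarrow> \<bar>u x - u y\<bar> \<le> C * dist x y powr \<alpha>"
    using hoelder_obtain[OF u] by blast
  obtain D where D: "D \<ge> 0"
    "\<And>x y. norm x \<le> r \<Longrightarrow> norm y \<le> r \<Longrightarrow> \<bar>v x - v y\<bar> \<le> D * dist x y powr \<alpha>"
    using hoelder_obtain[OF v] by blast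
  obtain A where A: "A \<ge> 0" "\<And>x. norm x \<le> r \<Longrightarrow> \<bar>u x\<bar> \<le> A"
    using continuous_bounded_cball[OF hoelder_imp_continuous[OF u \<open>0 < \<alpha>\<close>]] by blast
  obtain B where B: "B \<ge> 0" "\<And>x. norm x \<le> r \<Longrightarrow> \<bar>v x\<bar> \<le> B"
    using continuous_bounded_cball[OF hoelder_imp_continuous[OF v \<open>0 < \<alpha>\<close>]] by blast
  have "\<bar>u x * v x - u y * v y\<bar> \<le> (A * D + C * B) * dist x y powr \<alpha>"
    if "norm x \<le> r" "norm y \<le> r" for x y
  proof -
    have "u x * v x - u y * v y = u x * (v x - v y) + (u x - u y) * v y"
      by (simp add: algebra_simps)
    also have "\<bar>\<dots>\<bar> \<le> \<bar>u x\<bar> * \<bar>v x - v y\<bar> + \<bar>u x - u y\<bar> * \<bar>v y\<bar>"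
      by (metis abs_mult abs_triangle_ineq)
    also have "\<dots> \<le> A * (D * dist x y powr \<alpha>) + (C * dist x y powr \<alpha>) * B"
      using that A B C D by (intro add_mono mult_mono) auto
    finally show ?thesis by (simp add: algebra_simps)
  qed
  then show "\<exists>C. \<forall>x y. norm x \<le> r \<longrightarrow> norm y \<le> r \<longrightarrow> \<bar>u x * v x - u y * v y\<bar> \<le> C * dist x y powr \<alpha>"
    by blast
qed

text \<open>Composing two functions of exponent \<alpha> would only give the exponent \<alpha>^2; a
  Lipschitz inner function preserves \<alpha>.\<close>

lemma hoelder_compose_lipschitz:
  fixes f :: "real \<Rightarrow> real" and u :: "'a::euclidean_space \<Rightarrow> real"
  assumes f: "hoelder_on \<alpha> UNIV f" and u: "hoelder_on 1 UNIV u" and "0 < \<alpha>"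
  shows "hoelder_on \<alpha> UNIV (\<lambda>x. f (u x))"
proof (rule hoelder_onI)
  fix r
  obtain C where C: "C \<ge> 0"
    "\<And>x y. norm x \<le> r \<Longrightarrow> norm y \<le> r \<Longrightarrow> \<bar>u x - u y\<bar> \<le> C * dist x y powr 1"
    using hoelder_obtain[OF u] by blast
  obtain A where A: "A \<ge> 0" "\<And>x. norm x \<le> r \<Longrightarrow> \<bar>u x\<bar> \<le> A"
    using continuous_bounded_cball[OF hoelder_imp_continuous[OF u zero_less_one]] by blast
  obtain D where D: "D \<ge> 0"
    "\<And>x y. norm x \<le> A \<Longrightarrow> norm y \<le> A \<Longrightarrow> \<bar>f x - f y\<bar> \<le> D * dist x y powr \<alpha>"
    using hoelder_obtain[OF f] by blast
  have "\<bar>f (u x) - f (u y)\<bar> \<le> (D * C powr \<alpha>) * dist x y powr \<alpha>"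
    if "norm x \<le> r" "norm y \<le> r" for x y
  proof -
    have "\<bar>f (u x) - f (u y)\<bar> \<le> D * dist (u x) (u y) powr \<alpha>"
      using A that by (intro D) auto
    also have "\<dots> \<le> D * (C * dist x y) powr \<alpha>"
      using C that D \<open>0 < \<alpha>\<close> by (intro mult_left_mono powr_mono2) (auto simp: dist_real_def)
    finally show ?thesis using C by (simp add: powr_mult algebra_simps)
  qed
  then show "\<exists>C. \<forall>x y. norm x \<le> r \<longrightarrow> norm y \<le> r \<longrightarrow> \<bar>f (u x) - f (u y)\<bar> \<le> C * dist x y powr \<alpha>"
    by blast
qed

lemma lipschitz_imp_hoelder:
  fixes u :: "'a::euclidean_space \<Rightarrow> real"
  assumes u: "hoelder_on 1 UNIV u" and "0 < \<alpha>" "\<alpha> \<le> 1"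
  shows "hoelder_on \<alpha> UNIV u"
proof (rule hoelder_onI)
  fix r :: real
  obtain C where C: "C \<ge> 0"
    "\<And>x y. norm x \<le> r \<Longrightarrow> norm y \<le> r \<Longrightarrow> \<bar>u x - u y\<bar> \<le> C * dist x y powr 1"
    using hoelder_obtain[OF u] by blast
  have "\<bar>u x - u y\<bar> \<le> (C * (2 * r) powr (1 - \<alpha>)) * dist x y powr \<alpha>"
    if "norm x \<le> r" "norm y \<le> r" for x y
  proof -
    have "dist x y powr 1 = dist x y powr (1 - \<alpha>) * dist x y powr \<alpha>"
      by (simp flip: powr_add)
    also have "\<dots> \<le> (2 * r) powr (1 - \<alpha>) * dist x y powr \<alpha>"
      using that norm_triangle_ineq4[of x y] assms by (intro mult_right_mono powr_mono2) (auto simp: dist_norm)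
    finally have "C * dist x y powr 1 \<le> C * ((2 * r) powr (1 - \<alpha>) * dist x y powr \<alpha>)"
      using C(1) by (rule mult_left_mono)
    then show ?thesis using C(2)[OF that] by (simp add: algebra_simps)
  qed
  then show "\<exists>C. \<forall>x y. norm x \<le> r \<longrightarrow> norm y \<le> r \<longrightarrow> \<bar>u x - u y\<bar> \<le> C * dist x y powr \<alpha>"
    by blast
qed

lemma hoelder_compose_affine:
  fixes u :: "'b::euclidean_space \<Rightarrow> real" and L :: "'a::euclidean_space \<Rightarrow> 'b"
  assumes u: "hoelder_on \<alpha> UNIV u" and L: "bounded_linear L" and "0 < \<alpha>"
  shows "hoelder_on \<alpha> UNIV (\<lambda>x. u (L x + a))"
proof (rule hoelder_onI)
  fix r :: real
  obtain K where K: "K > 0" "\<And>x. norm (L x) \<le> norm x * K"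
    using bounded_linear.pos_bounded[OF L] by blast
  obtain C where C: "C \<ge> 0" "\<And>x y. norm x \<le> r * K + norm a \<Longrightarrow> norm y \<le> r * K + norm a
      \<Longrightarrow> \<bar>u x - u y\<bar> \<le> C * dist x y powr \<alpha>"
    using hoelder_obtain[OF u] by blast
  have N: "norm (L x + a) \<le> r * K + norm a" if "norm x \<le> r" for x
  proof -
    have "norm (L x) \<le> r * K"
      using K(2)[of x] mult_right_mono[OF that, of K] K(1) by linarith
    then show ?thesis using norm_triangle_ineq[of "L x" a] by linarith
  qed
  have "\<bar>u (L x + a) - u (L y + a)\<bar> \<le> (C * K powr \<alpha>) * dist x y powr \<alpha>"
    if "norm x \<le> r" "norm y \<le> r" for x y
  proof -
    have "\<bar>u (L x + a) - u (L y + a)\<bar> \<le> C * dist (L x + a) (L y + a) powr \<alpha>"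
      using N that by (intro C(2)) auto
    also have "dist (L x + a) (L y + a) = norm (L (x - y))"
      by (simp add: dist_norm linear_diff[OF bounded_linear.linear, OF L])
    also have "C * norm (L (x - y)) powr \<alpha> \<le> C * (dist x y * K) powr \<alpha>"
      using K(2)[of "x - y"] C(1) \<open>0 < \<alpha>\<close> by (intro mult_left_mono powr_mono2) (auto simp: dist_norm)
    finally show ?thesis using K(1) by (simp add: powr_mult algebra_simps)
  qed
  then show "\<exists>C. \<forall>x y. norm x \<le> r \<longrightarrow> norm y \<le> r \<longrightarrow> \<bar>u (L x + a) - u (L y + a)\<bar> \<le> C * dist x y powr \<alpha>"
    by blast
qed

lemma hoelder_linear:
  fixes L :: "'a::euclidean_space \<Rightarrow> real"
  assumes "bounded_linear L"
  shows "hoelder_on 1 UNIV L"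
proof -
  obtain K where K: "\<And>x. norm (L x) \<le> norm x * K"
    using bounded_linear.bounded[OF assms] by blast
  have "\<bar>L x - L y\<bar> \<le> K * dist x y powr 1" for x y
    using K[of "x - y"] by (simp add: linear_diff[OF bounded_linear.linear, OF assms] dist_norm mult.commute)
  then show ?thesis
    unfolding hoelder_on_def by blast
qed

section \<open>The classes \<open>C_loc\<close> and their calculus\<close>

lemma partials_on_append: "partials_on S (bs @ [b]) u = partials_on S bs (partial_on S b u)"
  by (induction bs) auto

lemma C_hoelder_0: "C_hoelder 0 \<alpha> S u \<longleftrightarrow> hoelder_on \<alpha> S u"
  by (auto simp: C_hoelder_def)

text \<open>Turns the definition by lists into a recursion on the order. The derivative split off is
  the one taken first, that is, the last element of the list, because the remaining list then acts
  on a fixed function \<open>partial_on S b u\<close>.\<close>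

lemma C_hoelder_Suc:
  "C_hoelder (Suc k) \<alpha> S u \<longleftrightarrow>
     u differentiable_on S \<and> (\<forall>b\<in>Basis. C_hoelder k \<alpha> S (partial_on S b u))"
    (is "?L \<longleftrightarrow> ?R")
proof
  assume L: ?L
  have "u differentiable_on S"
    using L unfolding C_hoelder_def by (metis lists.Nil list.size(3) partials_on.simps(1) zero_less_Suc)
  moreover have "C_hoelder k \<alpha> S (partial_on S b u)" if "b \<in> Basis" for b
    unfolding C_hoelder_def
  proof
    fix bs :: "'a list" assume "bs \<in> lists Basis"
    then have "bs @ [b] \<in> lists Basis" using that by auto
    then show "(length bs < k \<longrightarrow> partials_on S bs (partial_on S b u) differentiable_on S) \<and>
        (length bs = k \<longrightarrow> hoelder_on \<alpha> S (partials_on S bs (partial_on S b u)))"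
      using L unfolding C_hoelder_def partials_on_append[symmetric] by auto
  qed
  ultimately show ?R by blast
next
  assume R: ?R
  show ?L
    unfolding C_hoelder_def
  proof
    fix bs :: "'a list" assume bs: "bs \<in> lists Basis"
    show "(length bs < Suc k \<longrightarrow> partials_on S bs u differentiable_on S) \<and>
        (length bs = Suc k \<longrightarrow> hoelder_on \<alpha> S (partials_on S bs u))"
    proof (cases bs rule: rev_cases)
      case Nil
      then show ?thesis using R by simp
    next
      case (snoc cs b)
      then have "cs \<in> lists Basis" "b \<in> Basis" using bs by auto
      then show ?thesis
        using R unfolding C_hoelder_def snoc partials_on_append by auto
    qed
  qed
qed

lemma C_loc_SucI:
  fixes u :: "'a::euclidean_space \<Rightarrow> real"
  assumes D: "\<And>x. (u has_derivative (\<lambda>h. \<Sum>b\<in>Basis. D b x * (h \<bullet> b))) (at x)"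
    and C: "\<And>b. b \<in> Basis \<Longrightarrow> C_loc k \<alpha> (D b)"
  shows "C_loc (Suc k) \<alpha> u"
proof -
  have "pd b u = D b" if "b \<in> Basis" for b
    using pd_eq_sumI[OF D that] by blast
  then show ?thesis
    unfolding C_hoelder_Suc differentiable_on_def
    using D C by (auto simp: differentiable_def)
qed

lemma C_loc_SucD:
  fixes u :: "'a::euclidean_space \<Rightarrow> real"
  assumes "C_loc (Suc k) \<alpha> u"
  shows "(u has_derivative (\<lambda>h. \<Sum>b\<in>Basis. pd b u x * (h \<bullet> b))) (at x)"
    and "b \<in> Basis \<Longrightarrow> C_loc k \<alpha> (pd b u)"
  using assms unfolding C_hoelder_Suc differentiable_on_def
  by (auto intro: has_derivative_pd)

lemma onorm_sum_Basis_le: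
  fixes c :: "'a::euclidean_space \<Rightarrow> real"
  assumes "\<And>b. b \<in> Basis \<Longrightarrow> \<bar>c b\<bar> \<le> M"
  shows "\<bar>\<Sum>b\<in>Basis. c b * (h \<bullet> b)\<bar> \<le> (real DIM('a) * M) * norm h"
proof -
  have "\<bar>\<Sum>b\<in>Basis. c b * (h \<bullet> b)\<bar> \<le> (\<Sum>b\<in>Basis. \<bar>c b * (h \<bullet> b)\<bar>)"
    by (rule sum_abs)
  also have "\<dots> \<le> (\<Sum>b\<in>(Basis::'a set). M * norm h)"
    using assms by (intro sum_mono) (auto simp: abs_mult Basis_le_norm intro!: mult_mono order_trans[OF abs_ge_zero])
  finally show ?thesis by (simp add: mult.assoc)
qed

lemma bounded_pd_imp_lipschitz:
  fixes u :: "'a::euclidean_space \<Rightarrow> real"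
  assumes "convex S"
    and D: "\<And>x. x \<in> S \<Longrightarrow> (u has_derivative (\<lambda>h. \<Sum>b\<in>Basis. D b x * (h \<bullet> b))) (at x)"
    and M: "\<And>b x. b \<in> Basis \<Longrightarrow> x \<in> S \<Longrightarrow> \<bar>D b x\<bar> \<le> M"
    and "x \<in> S" "y \<in> S"
  shows "\<bar>u x - u y\<bar> \<le> (real DIM('a) * M) * dist x y"
proof -
  have "norm (u x - u y) \<le> (real DIM('a) * M) * norm (x - y)"
  proof (rule differentiable_bound[OF \<open>convex S\<close> _ _ \<open>x \<in> S\<close> \<open>y \<in> S\<close>])
    fix z assume "z \<in> S"
    show "(u has_derivative (\<lambda>h. \<Sum>b\<in>Basis. D b z * (h \<bullet> b))) (at z within S)"
      using D[OF \<open>z \<in> S\<close>] has_derivative_at_withinI by blast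
    show "onorm (\<lambda>h. \<Sum>b\<in>Basis. D b z * (h \<bullet> b)) \<le> real DIM('a) * M"
      using onorm_sum_Basis_le[OF M[OF _ \<open>z \<in> S\<close>]] by (intro onorm_le) auto
  qed
  then show ?thesis by (simp add: dist_norm)
qed

lemma C_loc_imp_continuous:
  fixes u :: "'a::euclidean_space \<Rightarrow> real"
  assumes "C_loc k \<alpha> u" "0 < \<alpha>"
  shows "continuous_on S u"
proof (cases k)
  case 0
  then show ?thesis using assms hoelder_imp_continuous by (auto simp: C_hoelder_0)
next
  case (Suc m)
  then have "isCont u x" for x
    using C_loc_SucD(1) assms(1) has_derivative_continuous by blast
  then show ?thesis by (simp add: continuous_at_imp_continuous_on)
qed

lemma C_loc_Suc_imp_lipschitz:
  fixes u :: "'a::euclidean_space \<Rightarrow> real"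
  assumes "C_loc (Suc k) \<alpha> u" "0 < \<alpha>"
  shows "hoelder_on 1 UNIV u"
proof (rule hoelder_onI)
  fix r
  have "\<exists>B. \<forall>x. norm x \<le> r \<longrightarrow> \<bar>pd b u x\<bar> \<le> B" if "b \<in> Basis" for b
    using C_loc_imp_continuous[OF C_loc_SucD(2)[OF assms(1) that] assms(2)]
      continuous_bounded_cball[of "pd b u" r] by metis
  then obtain B where B: "\<And>b x. b \<in> Basis \<Longrightarrow> norm x \<le> r \<Longrightarrow> \<bar>pd b u x\<bar> \<le> B b"
    by metis
  define M where "M = (\<Sum>b\<in>(Basis::'a set). \<bar>B b\<bar>)"
  have "\<bar>pd b u x\<bar> \<le> M" if "b \<in> Basis" "x \<in> cball 0 r" for b x
  proof -
    have "\<bar>B b\<bar> \<le> M" unfolding M_def using that(1) by (intro member_le_sum) auto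
    then show ?thesis using B[of b x] that by auto
  qed
  from bounded_pd_imp_lipschitz[OF convex_cball C_loc_SucD(1)[OF assms(1)] this, of 0 r]
  show "\<exists>C. \<forall>x y. norm x \<le> r \<longrightarrow> norm y \<le> r \<longrightarrow> \<bar>u x - u y\<bar> \<le> C * dist x y powr 1"
    by auto
qed

text \<open>The definition imposes Hoelder continuity on the top derivatives only; for the order
  below it comes from the mean value inequality, which makes a function with continuous partial
  derivatives locally Lipschitz.\<close>

lemma C_loc_Suc_imp:
  fixes u :: "'a::euclidean_space \<Rightarrow> real"
  assumes "C_loc (Suc k) \<alpha> u" "0 < \<alpha>" "\<alpha> \<le> 1"
  shows "C_loc k \<alpha> u"
  using assms(1)
proof (induction k arbitrary: u)
  case 0
  then show ?case
    using lipschitz_imp_hoelder[OF C_loc_Suc_imp_lipschitz[OF 0 assms(2)] assms(2,3)]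
    by (simp add: C_hoelder_0)
next
  case (Suc k)
  then show ?case
    by (intro C_loc_SucI[OF C_loc_SucD(1)[OF Suc.prems]] Suc.IH C_loc_SucD(2)[OF Suc.prems])
qed

lemma C_loc_mono:
  fixes u :: "'a::euclidean_space \<Rightarrow> real"
  assumes "C_loc k \<alpha> u" "0 < \<alpha>" "\<alpha> \<le> 1" "j \<le> k"
  shows "C_loc j \<alpha> u"
  using assms(4,1) by (induction rule: inc_induct) (use C_loc_Suc_imp assms in blast)+

lemma C_loc_const: "C_loc k \<alpha> (\<lambda>x::'a::euclidean_space. c)"
proof (induction k arbitrary: c)
  case (Suc k)
  show ?case
    by (rule C_loc_SucI[where D = "\<lambda>_ _. 0"]) (auto intro: Suc)
qed (simp add: C_hoelder_0 hoelder_const)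

lemma C_loc_add:
  fixes u v :: "'a::euclidean_space \<Rightarrow> real"
  assumes "C_loc k \<alpha> u" "C_loc k \<alpha> v"
  shows "C_loc k \<alpha> (\<lambda>x. u x + v x)"
  using assms
proof (induction k arbitrary: u v)
  case (Suc k)
  have "((\<lambda>x. u x + v x) has_derivative (\<lambda>h. \<Sum>b\<in>Basis. (pd b u x + pd b v x) * (h \<bullet> b))) (at x)" for x
    using has_derivative_add[OF C_loc_SucD(1)[OF Suc.prems(1)] C_loc_SucD(1)[OF Suc.prems(2)], of x]
    by (simp add: ring_distribs sum.distrib)
  then show ?case
    by (rule C_loc_SucI) (intro Suc.IH C_loc_SucD(2)[OF Suc.prems(1)] C_loc_SucD(2)[OF Suc.prems(2)])
qed (simp add: C_hoelder_0 hoelder_add)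

lemma C_loc_mult:
  fixes u v :: "'a::euclidean_space \<Rightarrow> real"
  assumes "C_loc k \<alpha> u" "C_loc k \<alpha> v" "0 < \<alpha>" "\<alpha> \<le> 1"
  shows "C_loc k \<alpha> (\<lambda>x. u x * v x)"
  using assms(1,2)
proof (induction k arbitrary: u v)
  case 0
  then show ?case by (simp add: C_hoelder_0 hoelder_mult \<open>0 < \<alpha>\<close>)
next
  case (Suc k)
  have D: "((\<lambda>x. u x * v x) has_derivative
      (\<lambda>h. \<Sum>b\<in>Basis. (u x * pd b v x + pd b u x * v x) * (h \<bullet> b))) (at x)" for x
    using has_derivative_mult[OF C_loc_SucD(1)[OF Suc.prems(1)] C_loc_SucD(1)[OF Suc.prems(2)], of x]
    by (simp add: ring_distribs sum.distrib sum_distrib_left sum_distrib_right mult.assoc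
        mult.left_commute mult.commute)
  have C: "C_loc k \<alpha> u" "C_loc k \<alpha> v"
    using Suc.prems C_loc_Suc_imp assms(3,4) by auto
  show ?case
    by (rule C_loc_SucI[OF D])
      (rule C_loc_add Suc.IH C_loc_SucD(2)[OF Suc.prems(1)] C_loc_SucD(2)[OF Suc.prems(2)] C | assumption)+
qed

lemma C_loc_cmult:
  fixes u :: "'a::euclidean_space \<Rightarrow> real"
  assumes "C_loc k \<alpha> u" "0 < \<alpha>" "\<alpha> \<le> 1"
  shows "C_loc k \<alpha> (\<lambda>x. c * u x)"
  by (intro C_loc_mult C_loc_const assms)

lemma C_loc_diff:
  fixes u v :: "'a::euclidean_space \<Rightarrow> real"
  assumes "C_loc k \<alpha> u" "C_loc k \<alpha> v" "0 < \<alpha>" "\<alpha> \<le> 1"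
  shows "C_loc k \<alpha> (\<lambda>x. u x - v x)"
  using C_loc_add[OF assms(1) C_loc_cmult[OF assms(2-4), of "-1"]] by simp

lemma C_loc_sum:
  fixes u :: "'i \<Rightarrow> 'a::euclidean_space \<Rightarrow> real"
  assumes "\<And>i. i \<in> I \<Longrightarrow> C_loc k \<alpha> (u i)"
  shows "C_loc k \<alpha> (\<lambda>x. \<Sum>i\<in>I. u i x)"
  using assms by (induction I rule: infinite_finite_induct) (auto intro: C_loc_add C_loc_const)

lemma C_loc_linear:
  fixes L :: "'a::euclidean_space \<Rightarrow> real"
  assumes L: "bounded_linear L" and "0 < \<alpha>" "\<alpha> \<le> 1"
  shows "C_loc k \<alpha> L"
proof (cases k)
  case 0
  then show ?thesis
    by (simp add: C_hoelder_0 lipschitz_imp_hoelder hoelder_linear assms)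
next
  case (Suc m)
  have "(L has_derivative L) (at x)" for x
    by (rule bounded_linear_imp_has_derivative[OF L])
  moreover have "L h = (\<Sum>b\<in>Basis. L b * (h \<bullet> b))" for h
    using Linear_Algebra.linear_componentwise[OF bounded_linear.linear[OF L], of h 1] by (simp add: mult.commute)
  then have "L = (\<lambda>h. \<Sum>b\<in>Basis. L b * (h \<bullet> b))"
    by blast
  ultimately have "(L has_derivative (\<lambda>h. \<Sum>b\<in>Basis. L b * (h \<bullet> b))) (at x)" for x
    by metis
  then show ?thesis
    unfolding Suc by (rule C_loc_SucI) (rule C_loc_const)
qed

lemma C_loc_compose_affine:
  fixes u :: "'b::euclidean_space \<Rightarrow> real" and L :: "'a::euclidean_space \<Rightarrow> 'b"
  assumes "C_loc k \<alpha> u" and L: "bounded_linear L" and "0 < \<alpha>" "\<alpha> \<le> 1"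
  shows "C_loc k \<alpha> (\<lambda>x. u (L x + a))"
  using assms(1)
proof (induction k arbitrary: u)
  case 0
  then show ?case by (simp add: C_hoelder_0 hoelder_compose_affine assms)
next
  case (Suc k)
  have D: "((\<lambda>x. u (L x + a)) has_derivative
      (\<lambda>h. \<Sum>b\<in>Basis. (\<Sum>c\<in>Basis. pd c u (L x + a) * (L b \<bullet> c)) * (h \<bullet> b))) (at x)" for x
  proof -
    have "((\<lambda>x. L x + a) has_derivative L) (at x)"
      using has_derivative_add[OF bounded_linear_imp_has_derivative[OF L] has_derivative_const] by simp
    from has_derivative_compose[OF this C_loc_SucD(1)[OF Suc.prems]]
    have "((\<lambda>x. u (L x + a)) has_derivative (\<lambda>h. \<Sum>c\<in>Basis. pd c u (L x + a) * (L h \<bullet> c))) (at x)"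
      by simp
    moreover have "(\<lambda>h. \<Sum>c\<in>Basis. pd c u (L x + a) * (L h \<bullet> c)) =
        (\<lambda>h. \<Sum>b\<in>Basis. (\<Sum>c\<in>Basis. pd c u (L x + a) * (L b \<bullet> c)) * (h \<bullet> b))"
    proof
      fix h
      have "L h \<bullet> c = (\<Sum>b\<in>Basis. (L b \<bullet> c) * (h \<bullet> b))" for c
        using Linear_Algebra.linear_componentwise[OF bounded_linear.linear[OF bounded_linear_compose
              [OF bounded_linear_inner_left[of c] L]], of h 1]
        by (simp add: mult.commute)
      then have "(\<lambda>c. L h \<bullet> c) = (\<lambda>c. \<Sum>b\<in>Basis. (L b \<bullet> c) * (h \<bullet> b))"
        by (rule ext)
      then have "(\<Sum>c\<in>Basis. pd c u (L x + a) * (L h \<bullet> c)) =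
          (\<Sum>c\<in>Basis. pd c u (L x + a) * (\<Sum>b\<in>Basis. (L b \<bullet> c) * (h \<bullet> b)))"
        by (rule arg_cong[where f = "\<lambda>F. \<Sum>c\<in>Basis. pd c u (L x + a) * F c"])
      also have "\<dots> = (\<Sum>b\<in>Basis. (\<Sum>c\<in>Basis. pd c u (L x + a) * (L b \<bullet> c)) * (h \<bullet> b))"
        unfolding sum_distrib_left sum_distrib_right by (subst sum.swap) (simp add: mult.assoc)
      finally show "(\<Sum>c\<in>Basis. pd c u (L x + a) * (L h \<bullet> c)) =
          (\<Sum>b\<in>Basis. (\<Sum>c\<in>Basis. pd c u (L x + a) * (L b \<bullet> c)) * (h \<bullet> b))" .
    qed
    ultimately show ?thesis by (rule has_derivative_eq_rhs)
  qed
  have "C_loc k \<alpha> (\<lambda>x. pd c u (L x + a))" if "c \<in> Basis" for c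
    using Suc.IH[OF C_loc_SucD(2)[OF Suc.prems that]] .
  then show ?case
    by (intro C_loc_SucI[OF D] C_loc_sum C_loc_mult C_loc_const assms)
qed

text \<open>Asking one degree more of \<open>u\<close> than of \<open>f\<close> keeps the inner
  function Lipschitz down to the base case. The bootstrap can afford this, because the potential
  gains two degrees.\<close>

lemma C_loc_compose:
  fixes f :: "real \<Rightarrow> real" and u :: "'a::euclidean_space \<Rightarrow> real"
  assumes "C_loc k \<alpha> f" "C_loc (Suc k) \<alpha> u" "0 < \<alpha>" "\<alpha> \<le> 1"
  shows "C_loc k \<alpha> (\<lambda>x. f (u x))"
  using assms(1,2)
proof (induction k arbitrary: f u)
  case 0
  then show ?case
    using hoelder_compose_lipschitz[OF _ C_loc_Suc_imp_lipschitz[OF 0(2) assms(3)] assms(3)]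
    by (simp add: C_hoelder_0)
next
  case (Suc k)
  have D: "((\<lambda>x. f (u x)) has_derivative (\<lambda>h. \<Sum>b\<in>Basis. (pd 1 f (u x) * pd b u x) * (h \<bullet> b))) (at x)" for x
    using has_derivative_compose[OF C_loc_SucD(1)[OF Suc.prems(2)] C_loc_SucD(1)[OF Suc.prems(1)], of x]
    by (simp add: sum_distrib_left mult.assoc)
  show ?case
    using Suc.IH[OF C_loc_SucD(2)[OF Suc.prems(1)] C_loc_Suc_imp[OF Suc.prems(2) assms(3,4)], of 1]
      C_loc_Suc_imp[OF C_loc_SucD(2)[OF Suc.prems(2)] assms(3,4)]
    by (intro C_loc_SucI[OF D] C_loc_mult assms) auto
qed

section \<open>Convolution with compactly supported functions\<close>

definition csupp :: "real \<Rightarrow> ('a::euclidean_space \<Rightarrow> real) \<Rightarrow> bool" where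
  "csupp r g \<longleftrightarrow> continuous_on UNIV g \<and> (\<forall>x. r < norm x \<longrightarrow> g x = 0)"

definition conv :: "('a::euclidean_space \<Rightarrow> real) \<Rightarrow> ('a \<Rightarrow> real) \<Rightarrow> 'a \<Rightarrow> real" where
  "conv K g x = (\<integral>y. K (x - y) * g y \<partial>lborel)"

lemma has_derivative_imp_continuous_on:
  assumes "\<And>x. (f has_derivative D x) (at x)"
  shows "continuous_on S f"
  using assms has_derivative_continuous continuous_at_imp_continuous_on by blast

lemma integrable_csupp:
  assumes "csupp r g"
  shows "integrable lborel g"
proof -
  have "integrable lborel (\<lambda>x. indicator (cball 0 r) x *\<^sub>R g x)"
    using assms unfolding csupp_def
    by (intro borel_integrable_compact) (auto intro: continuous_on_subset)
  moreover have "(\<lambda>x. indicator (cball 0 r) x *\<^sub>R g x) = g"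
    using assms unfolding csupp_def by (auto simp: indicator_def fun_eq_iff)
  ultimately show ?thesis by simp
qed

lemma csupp_conv_integrand:
  assumes "continuous_on UNIV K" "csupp r g"
  shows "csupp r (\<lambda>y. K (x - y) * g y)"
  using assms unfolding csupp_def
  by (auto intro!: continuous_intros continuous_on_compose2[OF assms(1)])

lemma csupp_bounded:
  fixes g :: "'a::euclidean_space \<Rightarrow> real"
  assumes "csupp r g"
  obtains M where "M \<ge> 0" "\<And>x. \<bar>g x\<bar> \<le> M"
proof -
  obtain M where M: "M \<ge> 0" "\<And>x. norm x \<le> r \<Longrightarrow> \<bar>g x\<bar> \<le> M"
    using assms continuous_bounded_cball unfolding csupp_def by metis
  then have "\<bar>g x\<bar> \<le> M" for x
    using assms unfolding csupp_def by (cases "norm x \<le> r") auto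
  then show ?thesis using that M(1) by blast
qed

lemma integral_lborel_reflect_translate:
  fixes h :: "'a::euclidean_space \<Rightarrow> real"
  assumes "h \<in> borel_measurable borel"
  shows "(\<integral>y. h (x - y) \<partial>lborel) = (\<integral>y. h y \<partial>lborel)"
proof -
  have "(\<integral>y. h y \<partial>lborel) = (\<integral>y. h y \<partial>(density (distr lborel borel (\<lambda>y. x + (-1) *\<^sub>R y)) (\<lambda>_. 1)))"
    using lborel_affine[of "-1" x] by simp
  also have "\<dots> = (\<integral>y. h (x - y) \<partial>lborel)"
    using assms by (simp add: density_1 integral_distr)
  finally show ?thesis by simp
qed

text \<open>Bridge from the Lebesgue integral to integrals over a compact box, the setting of
  \<open>leibniz_rule\<close>.\<close>

lemma csupp_integral_cbox:
  fixes h :: "'a::euclidean_space \<Rightarrow> real"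
  assumes "csupp r h"
  shows "(\<integral>y. h y \<partial>lborel) = integral (cbox (- r *\<^sub>R One) (r *\<^sub>R One)) h"
proof -
  have "h x = 0" if "x \<notin> cbox (- r *\<^sub>R One) (r *\<^sub>R One)" for x
  proof -
    have "\<exists>b\<in>Basis. \<bar>x \<bullet> b\<bar> > r"
    proof (rule ccontr)
      assume "\<not> ?thesis"
      then have "\<forall>b\<in>Basis. \<bar>x \<bullet> b\<bar> \<le> r"
        by (simp add: not_less)
      then show False
        using that by (auto simp: mem_box abs_le_iff minus_le_iff)
    qed
    then obtain b where b: "b \<in> Basis" "\<bar>x \<bullet> b\<bar> > r"
      by blast
    then have "norm x > r"
      using Basis_le_norm[of b x] by linarith
    then show ?thesis using assms unfolding csupp_def by blast
  qed
  then have "integral (cbox (- r *\<^sub>R One) (r *\<^sub>R One)) h = integral UNIV h"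
    by (subst integral_restrict_UNIV[symmetric]) (auto intro!: integral_cong)
  then show ?thesis
    using integral_lborel[OF integrable_csupp[OF assms]] by simp
qed

text \<open>All derivatives fall on the kernel, so that continuity and compact support of
  \<open>g\<close> are enough.\<close>

lemma conv_has_derivative:
  fixes K :: "'a::euclidean_space \<Rightarrow> real"
  assumes K: "\<And>x. (K has_derivative (\<lambda>h. \<Sum>b\<in>Basis. DK b x * (h \<bullet> b))) (at x)"
    and DK: "\<And>b. b \<in> Basis \<Longrightarrow> continuous_on UNIV (DK b)"
    and g: "csupp r g"
  shows "(conv K g has_derivative (\<lambda>h. \<Sum>b\<in>Basis. conv (DK b) g x * (h \<bullet> b))) (at x)"
proof -
  define Q :: "'a set" where "Q = cbox (- r *\<^sub>R One) (r *\<^sub>R One)"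
  define G where "G z = (\<Sum>b\<in>Basis. DK b z *\<^sub>R b)" for z
  have contK: "continuous_on UNIV K"
    using K by (rule has_derivative_imp_continuous_on)
  have contg: "continuous_on UNIV g"
    using g unfolding csupp_def by blast
  have contG: "continuous_on UNIV G"
    unfolding G_def by (intro continuous_intros DK)
  have Gh: "G z \<bullet> h = (\<Sum>b\<in>Basis. DK b z * (h \<bullet> b))" for z h
    by (simp add: G_def inner_sum_left inner_commute[of h])
  \<comment> \<open>The Leibniz rule wants the derivative as a continuous family of bounded linear
    maps; hence the gradient is packaged as the inner product with the vector
    \<open>G (x - y)\<close>.\<close>
  define F where "F x y = g y *\<^sub>R blinfun_inner_right (G (x - y))" for x y
  have D: "((\<lambda>x. K (x - y) * g y) has_derivative blinfun_apply (F z y)) (at z within UNIV)" for z y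
  proof -
    have "((\<lambda>x. x - y) has_derivative (\<lambda>h. h)) (at z)"
      by (auto intro!: derivative_eq_intros)
    from has_derivative_mult_left[OF has_derivative_compose[OF this K[of "z - y"]], of "g y"]
    have "((\<lambda>x. K (x - y) * g y) has_derivative (\<lambda>h. (\<Sum>b\<in>Basis. DK b (z - y) * (h \<bullet> b)) * g y)) (at z)"
      by simp
    moreover have "blinfun_apply (F z y) = (\<lambda>h. (\<Sum>b\<in>Basis. DK b (z - y) * (h \<bullet> b)) * g y)"
      by (simp add: fun_eq_iff F_def blinfun.scaleR_left Gh mult.commute)
    ultimately show ?thesis by simp
  qed
  have I: "(\<lambda>y. K (z - y) * g y) integrable_on Q" for z
    unfolding Q_def
    by (intro integrable_continuous continuous_intros continuous_on_compose2[OF contK]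
        continuous_on_subset[OF contg]) auto
  have contF: "continuous_on (UNIV \<times> Q) (\<lambda>(x, y). F x y)"
    unfolding F_def case_prod_beta
    by (intro continuous_intros continuous_on_compose2[OF contg] continuous_on_compose2[OF contG]
        bounded_linear.continuous_on[OF bounded_linear_blinfun_inner_right]) auto
  have "((\<lambda>z. integral Q (\<lambda>y. K (z - y) * g y)) has_derivative integral Q (F x)) (at x within UNIV)"
    unfolding Q_def by (rule leibniz_rule[OF _ _ contF[unfolded Q_def]])
      (use D I[unfolded Q_def] in auto)
  moreover have "integral Q (\<lambda>y. K (z - y) * g y) = conv K g z" for z
    unfolding conv_def Q_def
    by (rule csupp_integral_cbox[symmetric, OF csupp_conv_integrand[OF contK g]])
  moreover have "blinfun_apply (integral Q (F x)) = (\<lambda>h. \<Sum>b\<in>Basis. conv (DK b) g x * (h \<bullet> b))"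
  proof
    fix h
    have "F x integrable_on Q"
      unfolding F_def Q_def
      by (intro integrable_continuous continuous_intros continuous_on_subset[OF contg] continuous_on_compose2[OF contG]
        bounded_linear.continuous_on[OF bounded_linear_blinfun_inner_right]) auto
    then have "blinfun_apply (integral Q (F x)) h = integral Q (\<lambda>y. blinfun_apply (F x y) h)"
      by (rule blinfun_apply_integral)
    also have "\<dots> = integral Q (\<lambda>y. \<Sum>b\<in>Basis. (DK b (x - y) * g y) * (h \<bullet> b))"
      unfolding F_def
      by (simp add: blinfun.scaleR_left Gh sum_distrib_left mult.assoc mult.left_commute)
    also have "\<dots> = (\<Sum>b\<in>Basis. integral Q (\<lambda>y. (DK b (x - y) * g y) * (h \<bullet> b)))"
      unfolding Q_def using DK
      by (intro integral_sum integrable_continuous continuous_intros continuous_on_compose2[OF DK]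
        continuous_on_subset[OF contg]) auto
    also have "\<dots> = (\<Sum>b\<in>Basis. conv (DK b) g x * (h \<bullet> b))"
      unfolding conv_def Q_def using csupp_integral_cbox[OF csupp_conv_integrand[OF DK g]]
      by (intro sum.cong) (auto simp: integral_mult_left)
    finally show "blinfun_apply (integral Q (F x)) h = (\<Sum>b\<in>Basis. conv (DK b) g x * (h \<bullet> b))" .
  qed
  ultimately show ?thesis by simp
qed

text \<open>The convolution inherits the regularity of the kernel. In the base case, points of norm
  at most \<rho> only see the kernel on the ball of radius \<rho> + r, and the local Hoelder
  constant there is integrated against the absolute value of \<open>g\<close>.\<close>

lemma conv_C_loc:
  fixes K :: "'a::euclidean_space \<Rightarrow> real"
  assumes "C_loc k \<alpha> K" "csupp r g" "0 < \<alpha>"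
  shows "C_loc k \<alpha> (conv K g)"
  using assms(1)
proof (induction k arbitrary: K)
  case 0
  have K: "hoelder_on \<alpha> UNIV K" and contK: "continuous_on UNIV K"
    using 0 C_loc_imp_continuous[OF 0 assms(3)] by (auto simp: C_hoelder_0)
  have "hoelder_on \<alpha> UNIV (conv K g)"
  proof (rule hoelder_onI)
    fix \<rho>
    obtain C where C: "C \<ge> 0" "\<And>x y. norm x \<le> \<rho> + r \<Longrightarrow> norm y \<le> \<rho> + r
        \<Longrightarrow> \<bar>K x - K y\<bar> \<le> C * dist x y powr \<alpha>"
      using hoelder_obtain[OF K] by blast
    have "\<bar>conv K g x - conv K g y\<bar> \<le> (C * (\<integral>z. \<bar>g z\<bar> \<partial>lborel)) * dist x y powr \<alpha>"
      if xy: "norm x \<le> \<rho>" "norm y \<le> \<rho>" for x y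
    proof -
      have int: "integrable lborel (\<lambda>z. K (x - z) * g z)" for x
        by (rule integrable_csupp[OF csupp_conv_integrand[OF contK assms(2)]])
      have "\<bar>K (x - z) * g z - K (y - z) * g z\<bar> \<le> C * dist x y powr \<alpha> * \<bar>g z\<bar>" for z
      proof (cases "norm z \<le> r")
        case True
        then have "norm (x - z) \<le> \<rho> + r" "norm (y - z) \<le> \<rho> + r"
          using xy norm_triangle_ineq4[of x z] norm_triangle_ineq4[of y z] by linarith+
        then have "\<bar>K (x - z) - K (y - z)\<bar> \<le> C * dist x y powr \<alpha>"
          using C(2)[of "x - z" "y - z"] by (simp add: dist_norm)
        then have "\<bar>K (x - z) - K (y - z)\<bar> * \<bar>g z\<bar> \<le> C * dist x y powr \<alpha> * \<bar>g z\<bar>"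
          by (rule mult_right_mono) simp
        then show ?thesis by (simp add: left_diff_distrib[symmetric] abs_mult)
      next
        case False
        then show ?thesis using assms(2) by (simp add: csupp_def)
      qed
      then have "\<bar>\<integral>z. K (x - z) * g z - K (y - z) * g z \<partial>lborel\<bar> \<le> (\<integral>z. C * dist x y powr \<alpha> * \<bar>g z\<bar> \<partial>lborel)"
        using integrable_csupp[OF assms(2)] int
        by (intro integral_abs_bound_integral) auto
      then show ?thesis
        unfolding conv_def using int by (simp add: mult.assoc mult.commute mult.left_commute)
    qed
    then show "\<exists>C. \<forall>x y. norm x \<le> \<rho> \<longrightarrow> norm y \<le> \<rho> \<longrightarrow> \<bar>conv K g x - conv K g y\<bar> \<le> C * dist x y powr \<alpha>"
      by blast
  qed
  then show ?case by (simp add: C_hoelder_0)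
next
  case (Suc k)
  note D = conv_has_derivative[OF C_loc_SucD(1)[OF Suc.prems]
      C_loc_imp_continuous[OF C_loc_SucD(2)[OF Suc.prems] assms(3)] assms(2)]
  show ?case
    by (rule C_loc_SucI[OF D Suc.IH[OF C_loc_SucD(2)[OF Suc.prems]]])
qed

text \<open>Translation invariance makes the total integral of the translates constant; the
  derivative of that constant is the integral of the derivative.\<close>

lemma integral_pd_eq_0:
  fixes \<psi> :: "'a::euclidean_space \<Rightarrow> real"
  assumes D: "\<And>x. (\<psi> has_derivative (\<lambda>h. \<Sum>b\<in>Basis. D b x * (h \<bullet> b))) (at x)"
    and cD: "\<And>b. b \<in> Basis \<Longrightarrow> continuous_on UNIV (D b)"
    and \<psi>0: "\<And>x. r < norm x \<Longrightarrow> \<psi> x = 0" and b: "b \<in> Basis"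
  shows "(\<integral>y. D b y \<partial>lborel) = 0"
proof -
  \<comment> \<open>A cutoff equal to 1 on the ball of radius r + 1. For norm x < 1 this ball
    contains the support of the reflected translate, so that the convolution with the cutoff is the
    total integral, while the second factor has the compact support that
    \<open>conv_has_derivative\<close> demands.\<close>
  define \<zeta> :: "'a \<Rightarrow> real" where "\<zeta> y = max 0 (min 1 (r + 2 - norm y))" for y
  have \<zeta>: "csupp (r + 2) \<zeta>"
    unfolding csupp_def \<zeta>_def by (auto intro!: continuous_intros)
  have c\<psi>: "continuous_on UNIV \<psi>"
    using D by (rule has_derivative_imp_continuous_on)
  have near: "conv \<phi> \<zeta> x = (\<integral>y. \<phi> y \<partial>lborel)"
    if "norm x < 1" "\<And>x. r < norm x \<Longrightarrow> \<phi> x = 0" "continuous_on UNIV \<phi>" for \<phi> x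
  proof -
    have "\<phi> (x - y) * \<zeta> y = \<phi> (x - y)" for y
    proof (cases "norm y \<le> r + 1")
      case True
      then show ?thesis by (simp add: \<zeta>_def)
    next
      case False
      then have "r < norm (x - y)"
        using that(1) norm_triangle_ineq2[of y x] by (simp add: norm_minus_commute)
      then show ?thesis using that(2) by simp
    qed
    then have "conv \<phi> \<zeta> x = (\<integral>y. \<phi> (x - y) \<partial>lborel)"
      unfolding conv_def by presburger
    then show ?thesis
      using integral_lborel_reflect_translate[of \<phi> x] that(3)
      by (simp add: borel_measurable_continuous_onI)
  qed
  have D0: "D b x = 0" if "r < norm x" for x
  proof -
    have "open {y::'a. r < norm y}"
      by (intro open_Collect_less continuous_intros)
    then have "(\<psi> has_derivative (\<lambda>h. 0)) (at x)"
      using that \<psi>0 by (intro has_derivative_transform_within_open[OF has_derivative_const[of 0]]) auto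
    then show ?thesis
      using pd_eqI pd_eq_sumI[OF D b, of x] by metis
  qed
  have "(conv \<psi> \<zeta> has_derivative (\<lambda>h. 0)) (at 0)"
    by (rule has_derivative_transform_within_open[OF has_derivative_const open_ball[of 0 1]])
      (use near[OF _ \<psi>0 c\<psi>] in auto)
  then have "conv (D b) \<zeta> 0 = 0"
    using pd_eqI pd_eq_sumI[OF conv_has_derivative[OF D cD \<zeta>] b, of 0] by metis
  then show ?thesis
    using near[of 0 "D b"] D0 cD[OF b] by simp
qed

lemma integral_bound_cball:
  fixes h :: "'a::euclidean_space \<Rightarrow> real"
  assumes h: "\<And>y. dist x y \<le> \<rho> \<Longrightarrow> \<bar>h y\<bar> \<le> B" "\<And>y. \<rho> < dist x y \<Longrightarrow> h y = 0" and "0 \<le> \<rho>"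
  shows "\<bar>\<integral>y. h y \<partial>lborel\<bar> \<le> B * (unit_ball_vol DIM('a) * \<rho> ^ DIM('a))"
proof -
  have B: "B \<ge> 0" using h(1)[of x] \<open>0 \<le> \<rho>\<close> by simp
  have fin: "emeasure lborel (cball x \<rho>) < \<infinity>"
    using emeasure_bounded_finite[of "cball x \<rho>"] by simp
  have int: "integrable lborel (\<lambda>y. B * indicator (cball x \<rho>) y :: real)"
    using fin by (intro integrable_mult_right integrable_real_indicator) auto
  have "\<bar>\<integral>y. h y \<partial>lborel\<bar> \<le> (\<integral>y. \<bar>h y\<bar> \<partial>lborel)"
    using integral_norm_bound[of lborel h] by simp
  also have "\<dots> \<le> (\<integral>y. B * indicator (cball x \<rho>) y \<partial>lborel)"
    by (rule integral_mono'[OF int]) (use h B in \<open>auto simp: indicator_def not_le\<close>)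
  also have "\<dots> = B * measure lborel (cball x \<rho>)"
    using fin by simp
  also have "measure lborel (cball x \<rho>) = unit_ball_vol DIM('a) * \<rho> ^ DIM('a)"
    using content_cball[OF \<open>0 \<le> \<rho>\<close>, of x] by simp
  finally show ?thesis .
qed

text \<open>Termwise differentiation. The majorants \<open>a b j\<close> are independent of the
  point, so that the Weierstrass test makes the series of partial derivatives converge uniformly on
  the whole space.\<close>

lemma has_derivative_suminf_pd:
  fixes F :: "nat \<Rightarrow> 'a::euclidean_space \<Rightarrow> real"
  assumes D: "\<And>j x. (F j has_derivative (\<lambda>h. \<Sum>b\<in>Basis. D b j x * (h \<bullet> b))) (at x)"
    and a: "\<And>b. b \<in> Basis \<Longrightarrow> summable (a b)"
    and le: "\<And>b j x. b \<in> Basis \<Longrightarrow> \<bar>D b j x\<bar> \<le> a b j"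
    and F: "\<And>x. summable (\<lambda>j. F j x)"
  shows "((\<lambda>x. \<Sum>j. F j x) has_derivative (\<lambda>h. \<Sum>b\<in>Basis. (\<Sum>j. D b j x) * (h \<bullet> b))) (at x)"
proof -
  let ?f' = "\<lambda>j x h. \<Sum>b\<in>Basis. D b j x * (h \<bullet> b)"
  let ?g' = "\<lambda>x h. \<Sum>b\<in>Basis. (\<Sum>j. D b j x) * (h \<bullet> b)"
  have unif: "\<forall>\<^sub>F n in sequentially. \<forall>x\<in>UNIV. \<forall>h. norm ((\<Sum>j<n. ?f' j x h) - ?g' x h) \<le> e * norm h"
    if "e > 0" for e
  proof -
    define d where "d = e / DIM('a)"
    have d: "d > 0" "real DIM('a) * d = e" using that by (auto simp: d_def)
    have "\<forall>\<^sub>F n in sequentially. \<forall>x. \<bar>(\<Sum>j<n. D b j x) - (\<Sum>j. D b j x)\<bar> < d" if "b \<in> Basis" for b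
      using Weierstrass_m_test[of UNIV "D b" "a b"] le[OF that] a[OF that] d(1)
      by (auto simp: uniform_limit_iff dist_real_def)
    then have "\<forall>\<^sub>F n in sequentially. \<forall>b\<in>(Basis::'a set). \<forall>x. \<bar>(\<Sum>j<n. D b j x) - (\<Sum>j. D b j x)\<bar> < d"
      by (simp add: eventually_ball_finite_distrib)
    then show ?thesis
    proof (rule eventually_mono, intro ballI allI)
      fix n x h
      assume *: "\<forall>b\<in>(Basis::'a set). \<forall>x. \<bar>(\<Sum>j<n. D b j x) - (\<Sum>j. D b j x)\<bar> < d"
      have "(\<Sum>j<n. ?f' j x h) - ?g' x h = (\<Sum>b\<in>Basis. ((\<Sum>j<n. D b j x) - (\<Sum>j. D b j x)) * (h \<bullet> b))"
        by (subst sum.swap) (simp add: left_diff_distrib sum_subtractf sum_distrib_right)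
      also have "\<bar>\<dots>\<bar> \<le> (real DIM('a) * d) * norm h"
        using * by (intro onorm_sum_Basis_le) (auto intro: less_imp_le)
      finally show "norm ((\<Sum>j<n. ?f' j x h) - ?g' x h) \<le> e * norm h"
        using d by simp
    qed
  qed
  have "\<exists>G. \<forall>x\<in>UNIV. (\<lambda>j. F j x) sums G x \<and> (G has_derivative ?g' x) (at x within UNIV)"
    by (rule has_derivative_series[OF convex_UNIV _ unif _ summable_sums[OF F]]) (use D in auto)
  then obtain G where G: "\<And>x. (\<lambda>j. F j x) sums G x" "\<And>x. (G has_derivative ?g' x) (at x)"
    by blast
  then have "G = (\<lambda>x. \<Sum>j. F j x)"
    by (auto simp: sums_iff)
  then show ?thesis using G(2) by simp
qed

section \<open>The dyadic kernels\<close>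

lemma DERIV_glue:
  fixes f g :: "real \<Rightarrow> real"
  assumes f: "\<And>s. c \<le> s \<Longrightarrow> (f has_real_derivative f' s) (at s)"
    and g: "\<And>s. s \<le> c \<Longrightarrow> (g has_real_derivative g' s) (at s)"
    and eq: "f c = g c" "f' c = g' c"
  shows "((\<lambda>s. if c \<le> s then f s else g s) has_real_derivative (if c \<le> s then f' s else g' s)) (at s)"
proof -
  let ?F = "\<lambda>s. if c \<le> s then f s else g s"
  consider "s < c" | "s > c" | "s = c" by linarith
  then show ?thesis
  proof cases
    case 1
    have "(?F has_real_derivative g' s) (at s)"
      by (rule has_field_derivative_transform_within_open[OF g open_lessThan[of c]]) (use 1 in auto)
    then show ?thesis using 1 by simp
  next
    case 2
    have "(?F has_real_derivative f' s) (at s)"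
      by (rule has_field_derivative_transform_within_open[OF f open_greaterThan[of c]]) (use 2 in auto)
    then show ?thesis using 2 by simp
  next
    case 3
    have "(?F has_real_derivative f' c) (at c within {c..})"
      by (rule has_field_derivative_transform_within[OF has_field_derivative_at_within[OF f], of _ 1]) auto
    moreover have "(?F has_real_derivative g' c) (at c within {..c})"
      by (rule has_field_derivative_transform_within[OF has_field_derivative_at_within[OF g], of _ 1])
        (use eq(1) in auto)
    ultimately have "(?F has_real_derivative f' c) (at c within {c..} \<union> {..c})"
      unfolding has_field_derivative_iff eq(2) by (rule Lim_Un)
    moreover have "{c..} \<union> {..c} = UNIV" by auto
    ultimately show ?thesis using 3 by simp
  qed
qed

text \<open>Below 1, the function \<open>ln s / 2\<close> is continued by its second Taylor polynomial at 1.\<close>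

definition log_profile :: "real \<Rightarrow> real" where
  "log_profile s = (if 1 \<le> s then ln s / 2 else ((s - 1) - (s - 1)\<^sup>2 / 2) / 2)"

definition log_profile1 :: "real \<Rightarrow> real" where
  "log_profile1 s = (if 1 \<le> s then 1 / (2 * s) else (2 - s) / 2)"

definition log_profile2 :: "real \<Rightarrow> real" where
  "log_profile2 s = (if 1 \<le> s then - 1 / (2 * s\<^sup>2) else - 1 / 2)"

lemma DERIV_log_profile: "(log_profile has_real_derivative log_profile1 s) (at s)"
proof -
  have "((\<lambda>s. ln s / 2) has_real_derivative 1 / (2 * s)) (at s)" if "1 \<le> s" for s :: real
    using that by (auto intro!: derivative_eq_intros)
  moreover have "((\<lambda>s. ((s - 1) - (s - 1)\<^sup>2 / 2) / 2) has_real_derivative (2 - s) / 2) (at s)" for s :: real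
    by (auto intro!: derivative_eq_intros simp: diff_divide_distrib)
  ultimately show ?thesis
    unfolding log_profile_def[abs_def] log_profile1_def by (intro DERIV_glue) auto
qed

lemma DERIV_log_profile1: "(log_profile1 has_real_derivative log_profile2 s) (at s)"
proof -
  have "((\<lambda>s. 1 / (2 * s)) has_real_derivative - 1 / (2 * s\<^sup>2)) (at s)" if "1 \<le> s" for s :: real
    using that by (auto intro!: derivative_eq_intros simp: power2_eq_square)
  moreover have "((\<lambda>s. (2 - s) / 2) has_real_derivative - 1 / 2) (at s)" for s :: real
    by (auto intro!: derivative_eq_intros)
  ultimately show ?thesis
    unfolding log_profile1_def[abs_def] log_profile2_def by (intro DERIV_glue) auto
qed

lemma hoelder_log_profile2: "hoelder_on 1 UNIV log_profile2"
proof -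
  have "\<bar>log_profile2 s - log_profile2 t\<bar> \<le> \<bar>s - t\<bar>" for s t
  proof -
    \<comment> \<open>Both branches become one expression in \<open>1 / max s 1\<close>, a Lipschitz
      function with values in the unit interval, and squaring is Lipschitz there.\<close>
    have eq: "log_profile2 s = - (1 / (max s 1)\<^sup>2) / 2" for s
      by (auto simp: log_profile2_def max_def)
    define a b where "a = 1 / max s 1" and "b = 1 / max t 1"
    have ab: "0 < a" "a \<le> 1" "0 < b" "b \<le> 1"
      by (auto simp: a_def b_def)
    have "a - b = (max t 1 - max s 1) * (a * b)"
      by (simp add: a_def b_def field_simps)
    then have "\<bar>a - b\<bar> = \<bar>max t 1 - max s 1\<bar> * (a * b)"
      using ab by (simp add: abs_mult)
    also have "\<dots> \<le> \<bar>s - t\<bar> * 1"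
      using ab by (intro mult_mono) (auto simp: mult_le_one)
    finally have 1: "\<bar>a - b\<bar> \<le> \<bar>s - t\<bar>" by simp
    have "log_profile2 s - log_profile2 t = (b - a) * (b + a) / 2"
      unfolding eq a_def b_def by (simp add: power2_eq_square field_simps)
    also have "\<bar>\<dots>\<bar> = \<bar>a - b\<bar> * ((a + b) / 2)"
      using ab by (simp add: abs_mult abs_minus_commute add.commute)
    also have "\<dots> \<le> \<bar>a - b\<bar> * 1"
      using ab by (intro mult_left_mono) auto
    finally show ?thesis using 1 by simp
  qed
  then show ?thesis
    unfolding hoelder_on_def by (auto simp: dist_real_def intro!: exI[of _ 1])
qed

lemma C_loc_real_SucI:
  fixes f :: "real \<Rightarrow> real"
  assumes "\<And>s. (f has_real_derivative f' s) (at s)" "C_loc k \<alpha> f'"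
  shows "C_loc (Suc k) \<alpha> f"
proof -
  have "(f has_derivative (\<lambda>h. \<Sum>b\<in>Basis. f' s * (h \<bullet> b))) (at s)" for s
    using assms(1)[of s] by (simp add: has_field_derivative_def)
  then show ?thesis
    by (rule C_loc_SucI[where D = "\<lambda>_. f'"]) (rule assms(2))
qed

lemma C_loc_log_profile1: "C_loc 1 1 log_profile1"
  using C_loc_real_SucI[OF DERIV_log_profile1, of 0 1] hoelder_log_profile2 by (simp add: C_hoelder_0)

text \<open>Equals ln |x| for |x| at least 1. Taking the profile as a function of the squared norm
  leaves a polynomial in the unit disc, and so no singularity at the origin.\<close>

definition log_kernel :: "complex \<Rightarrow> real" where
  "log_kernel x = log_profile (x \<bullet> x)"

text \<open>The Laplacian of \<open>log_kernel\<close>. It is supported in the unit disc because ln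
  |x| is harmonic, and serves as the mollifier in the computation of the Laplacian of the
  potential.\<close>

definition bump_kernel :: "complex \<Rightarrow> real" where
  "bump_kernel x = 4 * max 0 (1 - x \<bullet> x)"

text \<open>The relation ln |2x| = ln |x| + ln 2 makes this vanish outside the unit disc. For x
  different from 0 the sum of \<open>dyadic_kernel (2 ^ j *\<^sub>R x)\<close> over j telescopes to
  ln |x| - \<open>log_kernel x\<close>.\<close>

definition dyadic_kernel :: "complex \<Rightarrow> real" where
  "dyadic_kernel x = log_kernel (2 *\<^sub>R x) - log_kernel x - ln 2"

definition laplace :: "(complex \<Rightarrow> real) \<Rightarrow> complex \<Rightarrow> real" where
  "laplace u x = (\<Sum>b\<in>Basis. pd b (pd b u) x)"

lemma log_kernel_derivative:
  "(log_kernel has_derivative (\<lambda>h. \<Sum>b\<in>Basis. (2 * log_profile1 (x \<bullet> x) * (x \<bullet> b)) * (h \<bullet> b))) (at x)"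
proof -
  have "((\<lambda>x. x \<bullet> x) has_derivative (\<lambda>h. 2 * (x \<bullet> h))) (at x)"
    by (auto intro!: derivative_eq_intros simp: inner_commute)
  from has_derivative_compose[OF this DERIV_log_profile[unfolded has_field_derivative_def]]
  have "(log_kernel has_derivative (\<lambda>h. log_profile1 (x \<bullet> x) * (2 * (x \<bullet> h)))) (at x)"
    unfolding log_kernel_def[abs_def] .
  moreover have "(\<lambda>h. log_profile1 (x \<bullet> x) * (2 * (x \<bullet> h))) =
      (\<lambda>h. \<Sum>b\<in>Basis. (2 * log_profile1 (x \<bullet> x) * (x \<bullet> b)) * (h \<bullet> b))"
    by (rule ext, subst euclidean_inner[of x]) (simp add: sum_distrib_left mult.assoc mult.left_commute)
  ultimately show ?thesis
    by simp
qed

lemma pd_log_kernel: "b \<in> Basis \<Longrightarrow> pd b log_kernel x = 2 * log_profile1 (x \<bullet> x) * (x \<bullet> b)"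
  by (rule pd_eq_sumI[OF log_kernel_derivative])

lemma pd_pd_log_kernel_derivative:
  assumes "b \<in> Basis"
  shows "(pd b log_kernel has_derivative (\<lambda>h. \<Sum>c\<in>Basis.
    (4 * log_profile2 (x \<bullet> x) * (x \<bullet> b) * (x \<bullet> c) + 2 * log_profile1 (x \<bullet> x) * (b \<bullet> c)) * (h \<bullet> c))) (at x)"
proof -
  have "((\<lambda>x. x \<bullet> x) has_derivative (\<lambda>h. 2 * (x \<bullet> h))) (at x)"
    by (auto intro!: derivative_eq_intros simp: inner_commute)
  from has_derivative_compose[OF this DERIV_log_profile1[unfolded has_field_derivative_def]]
  have "((\<lambda>x. log_profile1 (x \<bullet> x)) has_derivative (\<lambda>h. log_profile2 (x \<bullet> x) * (2 * (x \<bullet> h)))) (at x)" .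
  then have "((\<lambda>x. 2 * log_profile1 (x \<bullet> x) * (x \<bullet> b)) has_derivative
      (\<lambda>h. 4 * log_profile2 (x \<bullet> x) * (x \<bullet> b) * (x \<bullet> h) + 2 * log_profile1 (x \<bullet> x) * (b \<bullet> h))) (at x)"
    by (auto intro!: derivative_eq_intros simp: algebra_simps inner_commute)
  moreover have "(\<lambda>x. 2 * log_profile1 (x \<bullet> x) * (x \<bullet> b)) = pd b log_kernel"
    using pd_log_kernel[OF assms] by auto
  moreover have "(\<lambda>h. 4 * log_profile2 (x \<bullet> x) * (x \<bullet> b) * (x \<bullet> h) + 2 * log_profile1 (x \<bullet> x) * (b \<bullet> h)) =
      (\<lambda>h. \<Sum>c\<in>Basis. (4 * log_profile2 (x \<bullet> x) * (x \<bullet> b) * (x \<bullet> c) +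
         2 * log_profile1 (x \<bullet> x) * (b \<bullet> c)) * (h \<bullet> c))"
    (is "?A = ?B")
  proof
    fix h
    show "?A h = ?B h"
      by (subst euclidean_inner[of x h], subst euclidean_inner[of b h])
        (simp add: sum_distrib_left sum.distrib[symmetric] distrib_right mult.assoc)
  qed
  ultimately show ?thesis
    by simp
qed

lemma C_loc_sqnorm: "C_loc k 1 (\<lambda>x::complex. x \<bullet> x)"
proof -
  have "C_loc k 1 (\<lambda>x::complex. \<Sum>b\<in>Basis. (x \<bullet> b) * (x \<bullet> b))"
    by (intro C_loc_sum C_loc_mult C_loc_linear bounded_linear_inner_left) auto
  then show ?thesis by (simp only: euclidean_inner[symmetric])
qed

lemma C_loc_log_kernel: "C_loc 2 1 log_kernel"
proof -
  have "C_loc (Suc 1) 1 log_profile"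
    by (rule C_loc_real_SucI[OF DERIV_log_profile C_loc_log_profile1])
  then have "C_loc (Suc 1) 1 log_kernel"
    unfolding log_kernel_def[abs_def] by (rule C_loc_compose[OF _ C_loc_sqnorm]) auto
  then show ?thesis by (simp add: numeral_2_eq_2)
qed

lemma laplace_log_kernel: "laplace log_kernel x = bump_kernel x"
proof -
  have "laplace log_kernel x = (\<Sum>b\<in>Basis. 4 * log_profile2 (x \<bullet> x) * (x \<bullet> b) * (x \<bullet> b) + 2 * log_profile1 (x \<bullet> x) * (b \<bullet> b))"
    unfolding laplace_def by (intro sum.cong pd_eq_sumI[OF pd_pd_log_kernel_derivative]) auto
  \<comment> \<open>The plane has two basis vectors, so that the multiple of the identity in the
    Hessian contributes 2 + 2 to the trace.\<close>
  also have "\<dots> = 4 * log_profile2 (x \<bullet> x) * (\<Sum>b\<in>Basis. (x \<bullet> b) * (x \<bullet> b)) + 4 * log_profile1 (x \<bullet> x)"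
    by (simp add: sum.distrib sum_distrib_left mult.assoc)
  also have "\<dots> = 4 * log_profile2 (x \<bullet> x) * (x \<bullet> x) + 4 * log_profile1 (x \<bullet> x)"
    by (simp only: euclidean_inner[symmetric])
  also have "\<dots> = bump_kernel x"
    by (auto simp: log_profile2_def log_profile1_def bump_kernel_def max_def field_simps power2_eq_square)
  finally show ?thesis .
qed

lemma csupp_pd:
  fixes u :: "'a::euclidean_space \<Rightarrow> real"
  assumes "csupp r u" "C_loc (Suc k) \<alpha> u" "0 < \<alpha>" "b \<in> Basis"
  shows "csupp r (pd b u)"
proof -
  have "pd b u x = 0" if "r < norm x" for x
  proof -
    have "open {y::'a. r < norm y}"
      by (intro open_Collect_less continuous_intros)
    then have "(u has_derivative (\<lambda>h. 0)) (at x)"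
      using that assms(1) unfolding csupp_def
      by (intro has_derivative_transform_within_open[OF has_derivative_const[of 0]]) auto
    then show ?thesis by (rule pd_eqI)
  qed
  then show ?thesis
    unfolding csupp_def using C_loc_imp_continuous[OF C_loc_SucD(2)[OF assms(2,4)] assms(3)] by blast
qed

text \<open>A local Hoelder bound covers a ball slightly larger than the support. If one point lies
  outside that ball and the other in the support, their distance is at least 1 and the sup bound
  takes over. Constants uniform in the points are what the dyadic series require.\<close>

lemma csupp_global_hoelder:
  fixes u :: "'a::euclidean_space \<Rightarrow> real"
  assumes "csupp r u" "hoelder_on \<alpha> UNIV u" "0 < \<alpha>"
  obtains A where "A \<ge> 0" "\<And>x y. \<bar>u x - u y\<bar> \<le> A * dist x y powr \<alpha>"
proof -
  obtain C where C: "C \<ge> 0" "\<And>x y. norm x \<le> r + 1 \<Longrightarrow> norm y \<le> r + 1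
      \<Longrightarrow> \<bar>u x - u y\<bar> \<le> C * dist x y powr \<alpha>"
    using hoelder_obtain[OF assms(2)] by blast
  obtain M where M: "M \<ge> 0" "\<And>x. \<bar>u x\<bar> \<le> M"
    using csupp_bounded[OF assms(1)] by blast
  have u0: "u x = 0" if "r < norm x" for x
    using assms(1) that by (simp add: csupp_def)
  have far: "\<bar>u x\<bar> \<le> (C + M) * dist x y powr \<alpha>" if "norm x \<le> r" "r + 1 < norm y" for x y
  proof -
    have "1 \<le> dist x y"
      using that norm_triangle_ineq2[of y x] by (simp add: dist_norm norm_minus_commute)
    then have "M * 1 \<le> (C + M) * dist x y powr \<alpha>"
      using C(1) M(1) \<open>0 < \<alpha>\<close> by (intro mult_mono ge_one_powr_ge_zero) auto
    then show ?thesis using M(2)[of x] by simp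
  qed
  have "\<bar>u x - u y\<bar> \<le> (C + M) * dist x y powr \<alpha>" for x y
  proof -
    consider "norm x \<le> r + 1" "norm y \<le> r + 1" | "norm x \<le> r" "r + 1 < norm y"
      | "norm y \<le> r" "r + 1 < norm x" | "r < norm x" "r < norm y"
      by linarith
    then show ?thesis
    proof cases
      case 1
      have "C * dist x y powr \<alpha> \<le> (C + M) * dist x y powr \<alpha>"
        using M(1) by (intro mult_right_mono) auto
      then show ?thesis using C(2)[OF 1] by linarith
    next
      case 2
      then show ?thesis using far[OF 2] u0[of y] by simp
    next
      case 3
      then show ?thesis using far[OF 3] u0[of x] by (simp add: dist_commute)
    next
      case 4
      then show ?thesis using u0 C(1) M(1) by simp
    qed
  qed
  then show ?thesis using that[of "C + M"] C(1) M(1) by simp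
qed

section \<open>Partial derivatives of rescaled functions and of the dyadic kernel\<close>

lemma C_loc_compose_scaleR:
  fixes u :: "'a::euclidean_space \<Rightarrow> real"
  assumes "C_loc k \<alpha> u" "0 < \<alpha>" "\<alpha> \<le> 1"
  shows "C_loc k \<alpha> (\<lambda>x. u (a *\<^sub>R x))"
  using C_loc_compose_affine[OF assms(1) bounded_linear_scaleR_right assms(2,3), of a 0] by simp

lemma pd_compose_scaleR:
  fixes u :: "'a::euclidean_space \<Rightarrow> real"
  assumes "C_loc (Suc k) \<alpha> u" "b \<in> Basis"
  shows "pd b (\<lambda>x. u (a *\<^sub>R x)) x = a * pd b u (a *\<^sub>R x)"
proof -
  have "((\<lambda>x. a *\<^sub>R x) has_derivative (\<lambda>h. a *\<^sub>R h)) (at x)"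
    by (auto intro!: derivative_eq_intros)
  from has_derivative_compose[OF this C_loc_SucD(1)[OF assms(1)]]
  have "((\<lambda>x. u (a *\<^sub>R x)) has_derivative (\<lambda>h. \<Sum>b\<in>Basis. (a * pd b u (a *\<^sub>R x)) * (h \<bullet> b))) (at x)"
    by (simp add: mult.assoc mult.left_commute)
  then show ?thesis by (rule pd_eq_sumI[OF _ assms(2)])
qed

lemma pd_diff:
  fixes u v :: "'a::euclidean_space \<Rightarrow> real"
  assumes "C_loc (Suc k) \<alpha> u" "C_loc (Suc m) \<beta> v" "b \<in> Basis"
  shows "pd b (\<lambda>x. u x - v x) x = pd b u x - pd b v x"
  using assms(3)
    pd_eqI[OF has_derivative_diff[OF C_loc_SucD(1)[OF assms(1)] C_loc_SucD(1)[OF assms(2)]], of b x]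
    pd_eqI[OF C_loc_SucD(1)[OF assms(1)], of b x] pd_eqI[OF C_loc_SucD(1)[OF assms(2)], of b x]
  by simp

lemma pd_cmult:
  fixes u :: "'a::euclidean_space \<Rightarrow> real"
  assumes "C_loc (Suc k) \<alpha> u"
  shows "pd b (\<lambda>x. c * u x) x = c * pd b u x"
proof -
  have "((\<lambda>x. c * u x) has_derivative (\<lambda>h. c * (\<Sum>b\<in>Basis. pd b u x * (h \<bullet> b)))) (at x)"
    by (rule has_derivative_mult_right[OF C_loc_SucD(1)[OF assms]])
  then show ?thesis
    using pd_eqI[OF C_loc_SucD(1)[OF assms], of b x] pd_eqI by metis
qed

lemma pd_const: "pd b (\<lambda>x. c) x = 0"
  by (rule pd_eqI[OF has_derivative_const])

lemma C_loc_dyadic_kernel: "C_loc 2 1 dyadic_kernel"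
  unfolding dyadic_kernel_def[abs_def]
  by (intro C_loc_diff C_loc_compose_scaleR[OF C_loc_log_kernel] C_loc_log_kernel C_loc_const) auto

lemma csupp_dyadic_kernel: "csupp 1 dyadic_kernel"
  unfolding csupp_def
proof (intro conjI allI impI)
  show "continuous_on UNIV dyadic_kernel"
    by (rule C_loc_imp_continuous[OF C_loc_dyadic_kernel]) simp
  fix x :: complex assume "1 < norm x"
  then have "1 < x \<bullet> x"
    by (simp add: dot_square_norm)
  moreover have "ln (4 * (x \<bullet> x)) = 2 * ln 2 + ln (x \<bullet> x)"
    using \<open>1 < x \<bullet> x\<close> ln_mult_pos[of 4 "x \<bullet> x"] ln_realpow[of 2 2] by fastforce
  ultimately show "dyadic_kernel x = 0"
    by (simp add: dyadic_kernel_def log_kernel_def log_profile_def add_divide_distrib)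
qed

text \<open>In the plane \<open>4 * bump_kernel (2 *\<^sub>R x)\<close> is the rescaling that
  preserves the integral. Hence this is a difference of consecutive mollifiers, the source of the
  telescoping.\<close>

lemma laplace_dyadic_kernel: "laplace dyadic_kernel x = 4 * bump_kernel (2 *\<^sub>R x) - bump_kernel x"
proof -
  have C: "C_loc (Suc 1) 1 log_kernel"
    using C_loc_log_kernel by (simp add: numeral_2_eq_2)
  have C': "C_loc (Suc 1) 1 (\<lambda>x. log_kernel (2 *\<^sub>R x))"
    by (rule C_loc_compose_scaleR[OF C]) auto
  have pd1: "pd b dyadic_kernel = (\<lambda>x. 2 * pd b log_kernel (2 *\<^sub>R x) - pd b log_kernel x)"
    if "b \<in> Basis" for b
  proof
    fix x
    have "pd b dyadic_kernel x = pd b (\<lambda>x. log_kernel (2 *\<^sub>R x) - log_kernel x) x - pd b (\<lambda>x. ln 2) x"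
      unfolding dyadic_kernel_def[abs_def]
      by (rule pd_diff[OF C_loc_diff[OF C' C] C_loc_const[of "Suc 0" 1] that]) auto
    also have "\<dots> = 2 * pd b log_kernel (2 *\<^sub>R x) - pd b log_kernel x"
      using pd_diff[OF C' C that] pd_compose_scaleR[OF C that] by (simp add: pd_const)
    finally show "pd b dyadic_kernel x = 2 * pd b log_kernel (2 *\<^sub>R x) - pd b log_kernel x" .
  qed
  have pd2: "pd b (pd b dyadic_kernel) x = 4 * pd b (pd b log_kernel) (2 *\<^sub>R x) - pd b (pd b log_kernel) x"
    if b: "b \<in> Basis" for b
  proof -
    have D: "C_loc (Suc 0) 1 (pd b log_kernel)"
      using C_loc_SucD(2)[OF C b] by simp
    then have D': "C_loc (Suc 0) 1 (\<lambda>x. pd b log_kernel (2 *\<^sub>R x))"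
      by (rule C_loc_compose_scaleR) auto
    show ?thesis
      unfolding pd1[OF b] using pd_diff[OF C_loc_cmult[OF D', of 2] D b] pd_cmult[OF D', of b 2]
        pd_compose_scaleR[OF D b] by simp
  qed
  show ?thesis
    unfolding laplace_log_kernel[symmetric] unfolding laplace_def
    by (simp add: pd2 sum_subtractf sum_distrib_left)
qed

section \<open>Dyadic potentials\<close>

text \<open>There is no normalising factor: the powers of 2 produced by differentiation are
  collected in the weight \<open>w\<close> of \<open>pot\<close>.\<close>

definition scl :: "nat \<Rightarrow> (complex \<Rightarrow> real) \<Rightarrow> complex \<Rightarrow> real" where
  "scl j K x = K (2 ^ j *\<^sub>R x)"

lemma C_loc_scl: "C_loc k \<alpha> K \<Longrightarrow> 0 < \<alpha> \<Longrightarrow> \<alpha> \<le> 1 \<Longrightarrow> C_loc k \<alpha> (scl j K)"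
  unfolding scl_def[abs_def] by (rule C_loc_compose_scaleR)

lemma pd_scl: "C_loc (Suc k) \<alpha> K \<Longrightarrow> b \<in> Basis \<Longrightarrow> pd b (scl j K) x = 2 ^ j * scl j (pd b K) x"
  unfolding scl_def[abs_def] by (rule pd_compose_scaleR)

lemma csupp_scl:
  assumes "csupp 1 K"
  shows "csupp 1 (scl j K)"
proof -
  have "1 < norm (2 ^ j *\<^sub>R x)" if "1 < norm x" for x :: complex
  proof -
    have "1 * norm x \<le> 2 ^ j * norm x"
      by (intro mult_right_mono) auto
    then show ?thesis using that by simp
  qed
  then show ?thesis
    using assms unfolding csupp_def scl_def
    by (auto intro!: continuous_on_compose2[of UNIV K] continuous_intros)
qed

lemma conv_cmult_left: "conv (\<lambda>x. c * K x) g x = c * conv K g x"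
  by (simp add: conv_def mult.assoc)

text \<open>Here the kernel carries the compact support, so that the other factor may be a constant,
  as in the subtraction of \<open>g x\<close>.\<close>

lemma csupp_conv_integrand':
  fixes K g :: "'a::euclidean_space \<Rightarrow> real"
  assumes "csupp r K" "continuous_on UNIV g"
  shows "csupp (norm x + r) (\<lambda>y. K (x - y) * g y)"
  unfolding csupp_def
proof (intro conjI allI impI)
  show "continuous_on UNIV (\<lambda>y. K (x - y) * g y)"
    using assms unfolding csupp_def
    by (auto intro!: continuous_intros continuous_on_compose2[of UNIV K])
  fix y :: 'a assume "norm x + r < norm y"
  then have "r < norm (x - y)"
    using norm_triangle_ineq2[of y x] by (simp add: norm_minus_commute)
  then show "K (x - y) * g y = 0"
    using assms(1) by (simp add: csupp_def)
qed

section \<open>Size and oscillation of a single dyadic term\<close>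

lemma scl_outside:
  assumes "csupp 1 K" "(1/2) ^ j < dist x y"
  shows "scl j K (x - y) = 0"
proof -
  have "2 ^ j * (1/2::real) ^ j < 2 ^ j * dist x y"
    using assms(2) by (intro mult_strict_left_mono) auto
  then have "1 < norm (2 ^ j *\<^sub>R (x - y))"
    by (simp add: dist_norm power_mult_distrib[symmetric])
  then show ?thesis
    using assms(1) by (simp add: csupp_def scl_def)
qed

text \<open>Only the disc of radius 2^-j about x matters, and its area is pi 4^-j. As the bound on
  \<open>g\<close> is required on this disc alone, \<open>M\<close> may depend on j; the oscillation
  estimates exploit this.\<close>

lemma conv_scl_bound:
  assumes K: "csupp 1 K" "\<And>z. \<bar>K z\<bar> \<le> B"
    and g: "\<And>y. dist x y \<le> (1/2) ^ j \<Longrightarrow> \<bar>g y\<bar> \<le> M"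
  shows "\<bar>conv (scl j K) g x\<bar> \<le> pi * B * M * (1/4) ^ j"
proof -
  have B: "0 \<le> B" using K(2)[of 0] by linarith
  have "\<bar>conv (scl j K) g x\<bar> \<le> (B * M) * (unit_ball_vol DIM(complex) * ((1/2) ^ j) ^ DIM(complex))"
    unfolding conv_def
  proof (rule integral_bound_cball[where x = x])
    show "\<bar>scl j K (x - y) * g y\<bar> \<le> B * M" if "dist x y \<le> (1/2) ^ j" for y
      using K(2)[of "2 ^ j *\<^sub>R (x - y)"] g[OF that] B unfolding scl_def abs_mult by (intro mult_mono) auto
    show "scl j K (x - y) * g y = 0" if "(1/2) ^ j < dist x y" for y
      using scl_outside[OF K(1) that] by simp
  qed auto
  also have "((1/2::real) ^ j) ^ DIM(complex) = (1/4) ^ j"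
    by (simp add: power2_eq_square power_mult_distrib[symmetric])
  finally show ?thesis by (simp add: unit_ball_vol_2 mult_ac)
qed

lemma power_powr_commute: "(x::real) > 0 \<Longrightarrow> (x ^ j) powr a = (x powr a) ^ j"
  by (simp add: powr_realpow[symmetric] powr_powr mult.commute)

text \<open>The sum is split at the scale 2^-J comparable to d. At coarser scales the difference
  estimate applies and the ratio 2 q > 1, a consequence of \<alpha> < 1, lets the last terms
  dominate; at finer scales the two sums are estimated separately with the ratio q < 1. Both parts
  are of order d^\<alpha>.\<close>

lemma dyadic_sum_hoelder:
  fixes s t :: "nat \<Rightarrow> real"
  assumes \<alpha>: "0 < \<alpha>" "\<alpha> < 1" and q: "q = (1/2) powr \<alpha>" and d: "0 < d" and ab: "0 \<le> a" "0 \<le> b"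
    and s: "\<And>j. \<bar>s j\<bar> \<le> a * q ^ j" and t: "\<And>j. \<bar>t j\<bar> \<le> a * q ^ j"
    and st: "\<And>j. 2 ^ j * d \<le> 1 \<Longrightarrow> \<bar>s j - t j\<bar> \<le> b * d * (2 * q) ^ j"
  shows "\<bar>suminf s - suminf t\<bar> \<le> (2 * a / (1 - q) + 2 * b / (2 * q - 1)) * d powr \<alpha>"
proof -
  have q1: "0 < q" "q < 1"
    using \<alpha> powr_less_mono'[of "1/2" 0 \<alpha>] by (auto simp: q)
  have q2: "1 < 2 * q"
    using \<alpha> powr_less_mono'[of "1/2" \<alpha> 1] by (auto simp: q)
  have geo: "summable (\<lambda>j. c * q ^ j)" for c
    using q1 by (intro summable_mult summable_geometric) auto
  have sums: "summable s" "summable t"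
    using s t by (auto intro!: summable_comparison_test'[OF geo])
  have "\<exists>J. (1/2::real) ^ J \<le> d"
    using real_arch_pow_inv[OF d, of "1/2"] less_imp_le by fastforce
  \<comment> \<open>Minimality puts d below 2^-j for every j < J, which is just the range where the
    difference estimate is available.\<close>
  define J where "J = (LEAST J. (1/2::real) ^ J \<le> d)"
  have J: "(1/2) ^ J \<le> d"
    unfolding J_def by (rule LeastI_ex) fact
  have J': "d < (1/2) ^ j" if "j < J" for j
    using not_less_Least[of j "\<lambda>J. (1/2::real) ^ J \<le> d"] that unfolding J_def by auto
  have qJ: "q ^ J \<le> d powr \<alpha>"
  proof -
    have "q ^ J = ((1/2) ^ J) powr \<alpha>" by (simp add: q power_powr_commute)
    also have "\<dots> \<le> d powr \<alpha>" using J \<alpha> by (intro powr_mono2) auto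
    finally show ?thesis .
  qed
  have "\<bar>(\<Sum>j<J. s j - t j)\<bar> \<le> 2 * b / (2 * q - 1) * d powr \<alpha>"
  proof (cases J)
    case 0
    then show ?thesis using ab q2 by simp
  next
    \<comment> \<open>Minimality at J - 1 gives 2^J <= 2 / d, whence (2 q)^J = (2^J)^(1 - \<alpha>)
      is at most 2 d^\<alpha> / d.\<close>
    case (Suc m)
    have "d < (1/2) ^ m" using J'[of m] Suc by simp
    then have "2 ^ m * d < 1"
      by (simp add: field_simps)
    then have m: "(2::real) ^ J \<le> 2 / d"
      using d Suc by (simp add: field_simps)
    have "(2 * q) ^ J = (2 ^ J) powr (1 - \<alpha>)"
    proof -
      have "2 * q = 2 powr (1 - \<alpha>)"
        by (simp add: q powr_diff powr_divide)
      then show ?thesis by (simp add: power_powr_commute)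
    qed
    also have "\<dots> \<le> (2 / d) powr (1 - \<alpha>)"
      using m \<alpha> by (intro powr_mono2) auto
    also have "\<dots> = 2 powr (1 - \<alpha>) * (d powr \<alpha> / d)"
      using d by (simp add: powr_divide powr_diff)
    also have "\<dots> \<le> 2 * (d powr \<alpha> / d)"
      using \<alpha> d powr_mono[of "1 - \<alpha>" 1 2] by (intro mult_right_mono) auto
    finally have dq: "d * (2 * q) ^ J \<le> 2 * d powr \<alpha>"
      using d by (simp add: field_simps)
    have "\<bar>(\<Sum>j<J. s j - t j)\<bar> \<le> (\<Sum>j<J. b * d * (2 * q) ^ j)"
    proof (rule order_trans[OF sum_abs sum_mono])
      fix j assume "j \<in> {..<J}"
      then have "d < (1/2) ^ j" using J' by simp
      then have "2 ^ j * d \<le> 1" by (simp add: field_simps)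
      then show "\<bar>s j - t j\<bar> \<le> b * d * (2 * q) ^ j" by (rule st)
    qed
    also have "\<dots> = b * d * (((2 * q) ^ J - 1) / (2 * q - 1))"
      using q2 by (subst geometric_sum[symmetric]) (simp_all add: sum_distrib_left)
    also have "\<dots> \<le> b / (2 * q - 1) * (d * (2 * q) ^ J)"
      using q2 ab d by (simp add: field_simps mult_left_mono)
    also have "\<dots> \<le> b / (2 * q - 1) * (2 * d powr \<alpha>)"
      using dq q2 ab by (intro mult_left_mono) auto
    finally show ?thesis by (simp add: mult_ac)
  qed
  moreover have "\<bar>(\<Sum>j. s (j + J) - t (j + J))\<bar> \<le> 2 * a / (1 - q) * d powr \<alpha>"
  proof -
    have le: "\<bar>s (j + J) - t (j + J)\<bar> \<le> (2 * a * q ^ J) * q ^ j" for j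
      using s[of "j + J"] t[of "j + J"] by (simp add: power_add mult_ac)
    have "\<bar>(\<Sum>j. s (j + J) - t (j + J))\<bar> \<le> (\<Sum>j. (2 * a * q ^ J) * q ^ j)"
      using norm_suminf_le[of "\<lambda>j. s (j + J) - t (j + J)", OF _ geo] le by simp
    also have "\<dots> = 2 * a / (1 - q) * q ^ J"
      using q1 by (subst suminf_mult) (auto simp: suminf_geometric summable_geometric)
    also have "\<dots> \<le> 2 * a / (1 - q) * d powr \<alpha>"
      using qJ q1 ab by (intro mult_left_mono) auto
    finally show ?thesis .
  qed
  moreover have "suminf s - suminf t = (\<Sum>j. s (j + J) - t (j + J)) + (\<Sum>j<J. s j - t j)"
  proof -
    have "suminf s - suminf t = (\<Sum>j. s j - t j)"
      using sums by (simp add: suminf_diff)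
    then show ?thesis
      using suminf_split_initial_segment[OF summable_diff[OF sums], of J] by simp
  qed
  ultimately show ?thesis
    by (simp add: distrib_right)
qed

lemma integral_scl_pd_eq_0:
  assumes "csupp 1 \<psi>" "C_loc (Suc k) \<alpha> \<psi>" "0 < \<alpha>" "\<alpha> \<le> 1" "b \<in> Basis"
  shows "(\<integral>y. scl j (pd b \<psi>) y \<partial>lborel) = 0"
proof -
  have C: "C_loc (Suc k) \<alpha> (scl j \<psi>)"
    by (rule C_loc_scl[OF assms(2-4)])
  have "(\<integral>y. pd b (scl j \<psi>) y \<partial>lborel) = 0"
    by (rule integral_pd_eq_0[OF C_loc_SucD(1)[OF C] C_loc_imp_continuous[OF C_loc_SucD(2)[OF C] assms(3)]
          _ assms(5), of 1]) (use csupp_scl[OF assms(1)] in \<open>auto simp: csupp_def\<close>)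
  then show ?thesis
    by (simp add: pd_scl[OF assms(2,5)])
qed

text \<open>Used with c = 0 for second derivatives of the dyadic kernel, and with the integral of
  the rescaled bump for the mollifiers.\<close>

lemma conv_scl_minus_const:
  assumes K: "csupp 1 K" "(\<integral>y. scl j K y \<partial>lborel) = c" and g: "continuous_on UNIV g"
  shows "conv (scl j K) (\<lambda>y. g y - a) x = conv (scl j K) g x - a * c"
proof -
  have S: "csupp 1 (scl j K)" by (rule csupp_scl[OF K(1)])
  have 1: "integrable lborel (\<lambda>y. scl j K (x - y) * g y)"
    by (rule integrable_csupp[OF csupp_conv_integrand'[OF S g]])
  have 2: "integrable lborel (\<lambda>y. scl j K (x - y) * a)"
    using integrable_csupp[OF csupp_conv_integrand'[OF S continuous_on_const]] .
  have "(\<integral>y. scl j K (x - y) * a \<partial>lborel) = (\<integral>y. scl j K (x - y) \<partial>lborel) * a"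
    by simp
  also have "(\<integral>y. scl j K (x - y) \<partial>lborel) = c"
    using integral_lborel_reflect_translate[of "scl j K" x] S K(2)
    by (simp add: csupp_def borel_measurable_continuous_onI)
  finally have "(\<integral>y. scl j K (x - y) * g y - scl j K (x - y) * a \<partial>lborel) = conv (scl j K) g x - a * c"
    unfolding conv_def using Bochner_Integration.integral_diff[OF 1 2] by (simp only: mult.commute)
  then show ?thesis
    by (simp add: conv_def right_diff_distrib)
qed

lemma powr_dist_scale:
  assumes "dist x y \<le> c * (1/2) ^ j" "0 < \<alpha>" "0 \<le> c"
  shows "dist x y powr \<alpha> \<le> c powr \<alpha> * ((1/2) powr \<alpha>) ^ j"
proof -
  have "dist x y powr \<alpha> \<le> (c * (1/2) ^ j) powr \<alpha>"
    using assms by (intro powr_mono2) auto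
  then show ?thesis
    using assms(3) by (simp add: powr_mult power_powr_commute)
qed

text \<open>As the kernel has mean zero, \<open>g\<close> may be replaced by
  \<open>g y - g x\<close>, which is at most A 2^(-j \<alpha>) on the relevant disc. The area 4^-j
  cancels the weight 4^j and a geometric factor remains.\<close>

lemma conv_scl_osc:
  assumes K: "csupp 1 K" "\<And>z. \<bar>K z\<bar> \<le> B" "(\<integral>y. scl j K y \<partial>lborel) = 0"
    and g: "continuous_on UNIV g" "0 \<le> A" "\<And>y z. \<bar>g y - g z\<bar> \<le> A * dist y z powr \<alpha>" and "0 < \<alpha>"
  shows "\<bar>4 ^ j * conv (scl j K) g x\<bar> \<le> (pi * B * A) * ((1/2) powr \<alpha>) ^ j"
proof -
  have "\<bar>conv (scl j K) (\<lambda>y. g y - g x) x\<bar> \<le> pi * B * (A * ((1/2) powr \<alpha>) ^ j) * (1/4) ^ j"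
  proof (rule conv_scl_bound[OF K(1,2)])
    fix y assume y: "dist x y \<le> (1/2) ^ j"
    have "\<bar>g y - g x\<bar> \<le> A * dist x y powr \<alpha>"
      using g(3)[of y x] by (simp add: dist_commute)
    also have "\<dots> \<le> A * ((1/2) powr \<alpha>) ^ j"
      using powr_dist_scale[of x y 1 j \<alpha>] y \<open>0 < \<alpha>\<close> g(2) by (intro mult_left_mono) auto
    finally show "\<bar>g y - g x\<bar> \<le> A * ((1/2) powr \<alpha>) ^ j" .
  qed
  then have "\<bar>conv (scl j K) g x\<bar> \<le> pi * B * (A * ((1/2) powr \<alpha>) ^ j) * (1/4) ^ j"
    using conv_scl_minus_const[OF K(1,3) g(1)] by simp
  then have "4 ^ j * \<bar>conv (scl j K) g x\<bar> \<le> 4 ^ j * (pi * B * (A * ((1/2) powr \<alpha>) ^ j) * (1/4) ^ j)"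
    by (rule mult_left_mono) simp
  also have "\<dots> = (4 ^ j * (1/4) ^ j) * (pi * B * A) * ((1/2) powr \<alpha>) ^ j"
    by (simp only: mult_ac)
  also have "(4::real) ^ j * (1/4) ^ j = 1"
    by (simp add: power_mult_distrib[symmetric])
  finally show ?thesis by (simp add: abs_mult)
qed

text \<open>As both kernels have integral 0, the constant \<open>g x\<close> can be subtracted in both convolutions.\<close>

lemma conv_scl_osc_diff:
  assumes K: "csupp 1 K" "\<And>z w. \<bar>K z - K w\<bar> \<le> L * dist z w" "(\<integral>y. scl j K y \<partial>lborel) = 0"
    and g: "continuous_on UNIV g" "0 \<le> A" "\<And>y z. \<bar>g y - g z\<bar> \<le> A * dist y z powr \<alpha>"
    and \<alpha>: "0 < \<alpha>" "\<alpha> \<le> 1" and d: "2 ^ j * dist x x' \<le> 1" and "0 \<le> L"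
  shows "\<bar>4 ^ j * conv (scl j K) g x - 4 ^ j * conv (scl j K) g x'\<bar>
      \<le> (8 * pi * L * A) * dist x x' * (2 * (1/2) powr \<alpha>) ^ j"
proof -
  define q where "q = (1/2::real) powr \<alpha>"
  define H where "H y = (scl j K (x - y) - scl j K (x' - y)) * (g y - g x)" for y
  define D where "D = L * (2 ^ j * dist x x') * (A * (2 * q ^ j))"
  have int: "integrable lborel (\<lambda>y. scl j K (z - y) * (g y - g x))" for z
    by (intro integrable_csupp[OF csupp_conv_integrand'[OF csupp_scl[OF K(1)]]] continuous_intros g(1))
  have "\<bar>conv (scl j K) g x - conv (scl j K) g x'\<bar> =
      \<bar>conv (scl j K) (\<lambda>y. g y - g x) x - conv (scl j K) (\<lambda>y. g y - g x) x'\<bar>"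
    using conv_scl_minus_const[OF K(1,3) g(1)] by simp
  also have "\<dots> = \<bar>\<integral>y. H y \<partial>lborel\<bar>"
    unfolding conv_def H_def using int by (simp add: left_diff_distrib)
  \<comment> \<open>Since x and x' are at most 2^-j apart, the disc of radius 2 * 2^-j about x
    contains the supports of both kernels. The final constant 8 is 4 from its area times the factor
    2 inside \<open>D\<close>; that factor bounds 2^\<alpha>.\<close>
  also have "\<dots> \<le> D * (unit_ball_vol DIM(complex) * (2 * (1/2) ^ j) ^ DIM(complex))"
  proof (rule integral_bound_cball[where x = x])
    fix y
    have LD: "\<bar>scl j K (x - y) - scl j K (x' - y)\<bar> \<le> L * (2 ^ j * dist x x')"
    proof -
      have "dist (2 ^ j *\<^sub>R (x - y)) (2 ^ j *\<^sub>R (x' - y)) = 2 ^ j * dist x x'"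
        by (simp add: dist_norm scaleR_diff_right[symmetric])
      then show ?thesis
        using K(2)[of "2 ^ j *\<^sub>R (x - y)" "2 ^ j *\<^sub>R (x' - y)"] by (simp add: scl_def)
    qed
    {
      assume y: "dist x y \<le> 2 * (1/2) ^ j"
      have "\<bar>g y - g x\<bar> \<le> A * dist x y powr \<alpha>"
        using g(3)[of y x] by (simp add: dist_commute)
      also have "\<dots> \<le> A * (2 powr \<alpha> * q ^ j)"
        unfolding q_def using powr_dist_scale[OF y \<alpha>(1)] g(2) by (intro mult_left_mono) auto
      also have "\<dots> \<le> A * (2 * q ^ j)"
        using \<alpha> g(2) powr_mono[of \<alpha> 1 2] by (intro mult_left_mono mult_right_mono) (auto simp: q_def)
      finally show "\<bar>H y\<bar> \<le> D"
        unfolding H_def D_def abs_mult using LD \<open>0 \<le> L\<close> by (intro mult_mono) auto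
    next
      assume y: "2 * (1/2) ^ j < dist x y"
      have "dist x x' \<le> (1/2) ^ j"
        using d by (simp add: field_simps)
      then have "(1/2) ^ j < dist x' y" "(1/2) ^ j < dist x y"
        using y dist_triangle[of x y x'] zero_less_power[of "1/2::real" j] by linarith+
      then show "H y = 0"
        unfolding H_def using scl_outside[OF K(1)] by simp
    }
  qed auto
  also have "(2 * (1/2::real) ^ j) ^ DIM(complex) = 4 * (1/4) ^ j"
    by (simp add: power2_eq_square power_mult_distrib[symmetric])
  also have "D * (unit_ball_vol DIM(complex) * (4 * (1/4) ^ j)) =
      (8 * pi * L * A) * dist x x' * (2 * q) ^ j * (1/4) ^ j"
    by (simp add: D_def unit_ball_vol_2 power_mult_distrib mult_ac)
  finally have "4 ^ j * \<bar>conv (scl j K) g x - conv (scl j K) g x'\<bar> \<le>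
      4 ^ j * ((8 * pi * L * A) * dist x x' * (2 * q) ^ j * (1/4) ^ j)"
    by (rule mult_left_mono) simp
  also have "\<dots> = (4 ^ j * (1/4) ^ j) * ((8 * pi * L * A) * dist x x' * (2 * q) ^ j)"
    by (simp only: mult_ac)
  also have "(4::real) ^ j * (1/4) ^ j = 1"
    by (simp add: power_mult_distrib[symmetric])
  finally show ?thesis
    by (simp add: q_def abs_mult right_diff_distrib[symmetric])
qed

text \<open>Each derivative of \<open>scl j K\<close> costs a factor 2^j, so that w = 1, 2, 4
  correspond to the potential, its gradient and its Hessian.\<close>

definition pot :: "real \<Rightarrow> (complex \<Rightarrow> real) \<Rightarrow> (complex \<Rightarrow> real) \<Rightarrow> (complex \<Rightarrow> real) \<Rightarrow> complex \<Rightarrow> real" where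
  "pot w K0 K g x = conv K0 g x + (\<Sum>j. w ^ j * conv (scl j K) g x)"

text \<open>The ratio w / 4 shows how far size alone goes: the potential and its gradient converge
  for bounded \<open>g\<close>, whereas w = 4 is the borderline case that needs cancellation or
  decay of \<open>g\<close>.\<close>

lemma pot_term_bound:
  assumes "csupp 1 K" "\<And>z. \<bar>K z\<bar> \<le> B" "\<And>y. \<bar>g y\<bar> \<le> M" "0 \<le> w"
  shows "\<bar>w ^ j * conv (scl j K) g x\<bar> \<le> (pi * B * M) * (w / 4) ^ j"
proof -
  have "\<bar>conv (scl j K) g x\<bar> \<le> pi * B * M * (1/4) ^ j"
    by (rule conv_scl_bound[OF assms(1,2)]) (rule assms(3))
  then have "w ^ j * \<bar>conv (scl j K) g x\<bar> \<le> w ^ j * (pi * B * M * (1/4) ^ j)"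
    using assms(4) by (intro mult_left_mono) auto
  also have "\<dots> = (pi * B * M) * (w / 4) ^ j"
    by (simp add: power_divide)
  finally show ?thesis using assms(4) by (simp add: abs_mult)
qed

text \<open>The majorant of the differentiated series is left open, because it comes from size for
  the gradient and from cancellation for the Hessian.\<close>

lemma pot_has_derivative:
  assumes K0: "C_loc 1 \<beta> K0" and K: "C_loc 1 \<beta> K" and \<beta>: "0 < \<beta>" "\<beta> \<le> 1" and g: "csupp r g"
    and a: "\<And>b. b \<in> Basis \<Longrightarrow> summable (a b)"
      "\<And>b j x. b \<in> Basis \<Longrightarrow> \<bar>(2 * w) ^ j * conv (scl j (pd b K)) g x\<bar> \<le> a b j"
    and F: "\<And>x. summable (\<lambda>j. w ^ j * conv (scl j K) g x)"
  shows "(pot w K0 K g has_derivative (\<lambda>h. \<Sum>b\<in>Basis. pot (2 * w) (pd b K0) (pd b K) g x * (h \<bullet> b))) (at x)"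
proof -
  have K0': "C_loc (Suc 0) \<beta> K0" and K': "C_loc (Suc 0) \<beta> K"
    using K0 K by auto
  have S: "C_loc (Suc 0) \<beta> (scl j K)" for j
    by (rule C_loc_scl[OF K' \<beta>])
  have D: "((\<lambda>x. w ^ j * conv (scl j K) g x) has_derivative
      (\<lambda>h. \<Sum>b\<in>Basis. ((2 * w) ^ j * conv (scl j (pd b K)) g x) * (h \<bullet> b))) (at x)" for j x
  proof -
    have "(conv (scl j K) g has_derivative (\<lambda>h. \<Sum>b\<in>Basis. conv (pd b (scl j K)) g x * (h \<bullet> b))) (at x)"
      by (rule conv_has_derivative[OF C_loc_SucD(1)[OF S] _ g])
        (rule C_loc_imp_continuous[OF C_loc_SucD(2)[OF S] \<beta>(1)])
    moreover have "conv (pd b (scl j K)) g x = 2 ^ j * conv (scl j (pd b K)) g x" if "b \<in> Basis" for b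
      using pd_scl[OF K' that] conv_cmult_left[of "2 ^ j" "scl j (pd b K)" g x]
      by presburger
    ultimately have "(conv (scl j K) g has_derivative
        (\<lambda>h. \<Sum>b\<in>Basis. (2 ^ j * conv (scl j (pd b K)) g x) * (h \<bullet> b))) (at x)"
      by (simp cong: sum.cong)
    from has_derivative_mult_right[OF this, of "w ^ j"] show ?thesis
      by (simp add: sum_distrib_left power_mult_distrib mult_ac)
  qed
  have "(conv K0 g has_derivative (\<lambda>h. \<Sum>b\<in>Basis. conv (pd b K0) g x * (h \<bullet> b))) (at x)"
    by (rule conv_has_derivative[OF C_loc_SucD(1)[OF K0'] _ g])
      (rule C_loc_imp_continuous[OF C_loc_SucD(2)[OF K0'] \<beta>(1)])
  from has_derivative_add[OF this has_derivative_suminf_pd[OF D a F]] show ?thesis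
    unfolding pot_def[abs_def] by (simp add: distrib_right sum.distrib)
qed


section \<open>The logarithmic potential\<close>

text \<open>Formally the convolution of \<open>g\<close> with ln |x|; the normalisation by 1 / (2
  pi) is postponed to \<open>corr\<close>, where it appears as division by
  \<open>mass\<close>.\<close>

definition npot :: "(complex \<Rightarrow> real) \<Rightarrow> complex \<Rightarrow> real" where
  "npot g = pot 1 log_kernel dyadic_kernel g"

definition grad_pot :: "complex \<Rightarrow> (complex \<Rightarrow> real) \<Rightarrow> complex \<Rightarrow> real" where
  "grad_pot b g = pot 2 (pd b log_kernel) (pd b dyadic_kernel) g"

definition hess_pot :: "complex \<Rightarrow> complex \<Rightarrow> (complex \<Rightarrow> real) \<Rightarrow> complex \<Rightarrow> real" where
  "hess_pot c b g = pot 4 (pd c (pd b log_kernel)) (pd c (pd b dyadic_kernel)) g"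

lemma log_kernel_facts:
  shows "C_loc (Suc (Suc 0)) 1 log_kernel"
    and "b \<in> Basis \<Longrightarrow> C_loc (Suc 0) 1 (pd b log_kernel)"
    and "b \<in> Basis \<Longrightarrow> c \<in> Basis \<Longrightarrow> C_loc 0 1 (pd c (pd b log_kernel))"
proof -
  show *: "C_loc (Suc (Suc 0)) 1 log_kernel"
    using C_loc_log_kernel by (simp add: numeral_2_eq_2)
  show **: "b \<in> Basis \<Longrightarrow> C_loc (Suc 0) 1 (pd b log_kernel)"
    by (rule C_loc_SucD(2)[OF *])
  show "b \<in> Basis \<Longrightarrow> c \<in> Basis \<Longrightarrow> C_loc 0 1 (pd c (pd b log_kernel))"
    by (rule C_loc_SucD(2)[OF **])
qed

lemma dyadic_kernel_facts:
  shows "C_loc (Suc (Suc 0)) 1 dyadic_kernel"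
    and "b \<in> Basis \<Longrightarrow> C_loc (Suc 0) 1 (pd b dyadic_kernel)"
    and "b \<in> Basis \<Longrightarrow> c \<in> Basis \<Longrightarrow> C_loc 0 1 (pd c (pd b dyadic_kernel))"
    and "b \<in> Basis \<Longrightarrow> csupp 1 (pd b dyadic_kernel)"
    and "b \<in> Basis \<Longrightarrow> c \<in> Basis \<Longrightarrow> csupp 1 (pd c (pd b dyadic_kernel))"
proof -
  show *: "C_loc (Suc (Suc 0)) 1 dyadic_kernel"
    using C_loc_dyadic_kernel by (simp add: numeral_2_eq_2)
  show **: "b \<in> Basis \<Longrightarrow> C_loc (Suc 0) 1 (pd b dyadic_kernel)"
    by (rule C_loc_SucD(2)[OF *])
  show "b \<in> Basis \<Longrightarrow> c \<in> Basis \<Longrightarrow> C_loc 0 1 (pd c (pd b dyadic_kernel))"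
    by (rule C_loc_SucD(2)[OF **])
  show ***: "b \<in> Basis \<Longrightarrow> csupp 1 (pd b dyadic_kernel)"
    by (rule csupp_pd[OF csupp_dyadic_kernel *]) auto
  show "b \<in> Basis \<Longrightarrow> c \<in> Basis \<Longrightarrow> csupp 1 (pd c (pd b dyadic_kernel))"
    by (rule csupp_pd[OF *** **]) auto
qed

lemma pot_summable:
  assumes "csupp 1 K" "csupp r g" "0 \<le> w" "w < 4"
  shows "summable (\<lambda>j. w ^ j * conv (scl j K) g x)"
proof -
  obtain B M where "\<And>z. \<bar>K z\<bar> \<le> B" "\<And>y. \<bar>g y\<bar> \<le> M"
    using csupp_bounded[OF assms(1)] csupp_bounded[OF assms(2)] by metis
  then have "norm (w ^ j * conv (scl j K) g x) \<le> (pi * B * M) * (w / 4) ^ j" for j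
    using pot_term_bound[OF assms(1) _ _ assms(3)] by simp
  moreover have "summable (\<lambda>j. (pi * B * M) * (w / 4) ^ j)"
    using assms by (intro summable_mult summable_geometric) auto
  ultimately show ?thesis
    by (rule summable_comparison_test'[rotated, where N = 0])
qed

lemma npot_has_derivative:
  assumes g: "csupp r g"
  shows "(npot g has_derivative (\<lambda>h. \<Sum>b\<in>Basis. grad_pot b g x * (h \<bullet> b))) (at x)"
proof -
  obtain M where M: "\<And>y. \<bar>g y\<bar> \<le> M"
    using csupp_bounded[OF g] by metis
  have "\<exists>B. \<forall>z. \<bar>pd b dyadic_kernel z\<bar> \<le> B" if "b \<in> Basis" for b
    using csupp_bounded[OF dyadic_kernel_facts(4)[OF that]] by metis
  then obtain B where B: "\<And>b z. b \<in> Basis \<Longrightarrow> \<bar>pd b dyadic_kernel z\<bar> \<le> B b"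
    by metis
  have "(pot 1 log_kernel dyadic_kernel g has_derivative
      (\<lambda>h. \<Sum>b\<in>Basis. pot (2 * 1) (pd b log_kernel) (pd b dyadic_kernel) g x * (h \<bullet> b))) (at x)"
  proof (rule pot_has_derivative[where \<beta> = 1 and a = "\<lambda>b j. (pi * B b * M) * (2 / 4) ^ j"])
    show "C_loc 1 1 log_kernel" "C_loc 1 1 dyadic_kernel"
      using C_loc_mono[OF C_loc_log_kernel] C_loc_mono[OF C_loc_dyadic_kernel] by auto
    show "\<bar>(2 * 1) ^ j * conv (scl j (pd b dyadic_kernel)) g x\<bar> \<le> (pi * B b * M) * (2 / 4) ^ j"
      if "b \<in> Basis" for b j x
      using pot_term_bound[OF dyadic_kernel_facts(4)[OF that] B[OF that] M, of 2] by simp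
    show "summable (\<lambda>j. (pi * B b * M) * (2 / 4) ^ j)" for b
      by (intro summable_mult summable_geometric) auto
    show "summable (\<lambda>j. 1 ^ j * conv (scl j dyadic_kernel) g x)" for x
      by (rule pot_summable[OF csupp_dyadic_kernel g]) auto
  qed (use g in auto)
  then show ?thesis by (simp add: npot_def grad_pot_def)
qed

text \<open>Size bounds the terms of the Hessian series only by a constant. The decay comes from
  Hoelder continuity of \<open>g\<close> and the vanishing integrals of the second derivatives of
  \<open>dyadic_kernel\<close>.\<close>

lemma grad_pot_has_derivative:
  assumes g: "csupp r g" "hoelder_on \<alpha> UNIV g" and \<alpha>: "0 < \<alpha>" "\<alpha> \<le> 1" and b: "b \<in> Basis"
  shows "(grad_pot b g has_derivative (\<lambda>h. \<Sum>c\<in>Basis. hess_pot c b g x * (h \<bullet> c))) (at x)"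
proof -
  obtain A where A: "A \<ge> 0" "\<And>x y. \<bar>g x - g y\<bar> \<le> A * dist x y powr \<alpha>"
    using csupp_global_hoelder[OF g \<alpha>(1)] by metis
  have "\<exists>B. \<forall>z. \<bar>pd c (pd b dyadic_kernel) z\<bar> \<le> B" if "c \<in> Basis" for c
    using csupp_bounded[OF dyadic_kernel_facts(5)[OF b that]] by metis
  then obtain B where B: "\<And>c z. c \<in> Basis \<Longrightarrow> \<bar>pd c (pd b dyadic_kernel) z\<bar> \<le> B c"
    by metis
  have q: "(1/2) powr \<alpha> < 1"
    using \<alpha> powr_less_mono'[of "1/2" 0 \<alpha>] by auto
  have "(pot 2 (pd b log_kernel) (pd b dyadic_kernel) g has_derivative
      (\<lambda>h. \<Sum>c\<in>Basis. pot (2 * 2) (pd c (pd b log_kernel)) (pd c (pd b dyadic_kernel)) g x * (h \<bullet> c))) (at x)"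
  proof (rule pot_has_derivative[where \<beta> = 1 and a = "\<lambda>c j. (pi * B c * A) * ((1/2) powr \<alpha>) ^ j"])
    show "C_loc 1 1 (pd b log_kernel)" "C_loc 1 1 (pd b dyadic_kernel)"
      using log_kernel_facts(2)[OF b] dyadic_kernel_facts(2)[OF b] by auto
    show "\<bar>(2 * 2) ^ j * conv (scl j (pd c (pd b dyadic_kernel))) g x\<bar> \<le> (pi * B c * A) * ((1/2) powr \<alpha>) ^ j"
      if c: "c \<in> Basis" for c j x
      using conv_scl_osc[OF dyadic_kernel_facts(5)[OF b c] B[OF c] _ _ A \<alpha>(1), of j x]
        integral_scl_pd_eq_0[OF dyadic_kernel_facts(4,2)[OF b] _ _ c] g(1)
      by (simp add: csupp_def)
    show "summable (\<lambda>j. (pi * B c * A) * ((1/2) powr \<alpha>) ^ j)" for c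
      using q by (intro summable_mult summable_geometric) auto
    show "summable (\<lambda>j. 2 ^ j * conv (scl j (pd b dyadic_kernel)) g x)" for x
      by (rule pot_summable[OF dyadic_kernel_facts(4)[OF b] g(1)]) auto
  qed (use g in auto)
  then show ?thesis by (simp add: hess_pot_def grad_pot_def)
qed

text \<open>The core of the Schauder estimate: \<open>conv_scl_osc\<close> and
  \<open>conv_scl_osc_diff\<close> are the two inputs of \<open>dyadic_sum_hoelder\<close>. The
  constant \<open>L\<close> exists because the kernel has Lipschitz second derivatives.\<close>

lemma hoelder_hess_pot:
  assumes g: "csupp r g" "hoelder_on \<alpha> UNIV g" and \<alpha>: "0 < \<alpha>" "\<alpha> < 1" and bc: "b \<in> Basis" "c \<in> Basis"
  shows "hoelder_on \<alpha> UNIV (hess_pot c b g)"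
proof -
  let ?K = "pd c (pd b dyadic_kernel)"
  define q where "q = (1/2::real) powr \<alpha>"
  obtain A where A: "A \<ge> 0" "\<And>x y. \<bar>g x - g y\<bar> \<le> A * dist x y powr \<alpha>"
    using csupp_global_hoelder[OF g \<alpha>(1)] by metis
  have K: "csupp 1 ?K" "(\<integral>y. scl j ?K y \<partial>lborel) = 0" for j
    using dyadic_kernel_facts(5)[OF bc]
      integral_scl_pd_eq_0[OF dyadic_kernel_facts(4,2)[OF bc(1)] _ _ bc(2)] by auto
  obtain B where B: "B \<ge> 0" "\<And>z. \<bar>?K z\<bar> \<le> B"
    using csupp_bounded[OF K(1)] by metis
  obtain L where L: "L \<ge> 0" "\<And>z w. \<bar>?K z - ?K w\<bar> \<le> L * dist z w"
    using csupp_global_hoelder[OF K(1), of 1] dyadic_kernel_facts(3)[OF bc] by (auto simp: C_hoelder_0)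
  define a where "a = pi * B * A"
  define d where "d = 8 * pi * L * A"
  have ad: "0 \<le> a" "0 \<le> d"
    using A B L by (auto simp: a_def d_def)
  define C where "C = 2 * a / (1 - q) + 2 * d / (2 * q - 1)"
  have cg: "continuous_on UNIV g" using g(1) by (simp add: csupp_def)
  have "\<bar>(\<Sum>j. 4 ^ j * conv (scl j ?K) g x) - (\<Sum>j. 4 ^ j * conv (scl j ?K) g y)\<bar> \<le> C * dist x y powr \<alpha>"
    for x y
  proof (cases "x = y")
    case False
    have osc: "\<bar>4 ^ j * conv (scl j ?K) g z\<bar> \<le> a * q ^ j" for j z
      unfolding a_def q_def by (rule conv_scl_osc[OF K(1) B(2) K(2) cg A \<alpha>(1)])
    show ?thesis
      unfolding C_def
    proof (rule dyadic_sum_hoelder[OF \<alpha> q_def _ ad osc osc])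
      show "0 < dist x y" using False by simp
      show "\<bar>4 ^ j * conv (scl j ?K) g x - 4 ^ j * conv (scl j ?K) g y\<bar> \<le> d * dist x y * (2 * q) ^ j"
        if "2 ^ j * dist x y \<le> 1" for j
        unfolding d_def q_def
        by (rule conv_scl_osc_diff[OF K(1) L(2) K(2) cg A \<alpha>(1) _ that L(1)]) (use \<alpha> in auto)
    qed
  qed simp
  then have "hoelder_on \<alpha> UNIV (\<lambda>x. \<Sum>j. 4 ^ j * conv (scl j ?K) g x)"
    unfolding hoelder_on_def by blast
  moreover have "hoelder_on \<alpha> UNIV (conv (pd c (pd b log_kernel)) g)"
    using lipschitz_imp_hoelder[OF _ \<alpha>(1) less_imp_le[OF \<alpha>(2)]]
      conv_C_loc[OF log_kernel_facts(3)[OF bc] g(1) zero_less_one]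
    unfolding C_hoelder_0 by blast
  ultimately show ?thesis
    unfolding hess_pot_def pot_def[abs_def] by (rule hoelder_add[rotated])
qed

lemma npot_C_loc_2:
  assumes g: "csupp r g" "hoelder_on \<alpha> UNIV g" and \<alpha>: "0 < \<alpha>" "\<alpha> < 1"
  shows "C_loc (Suc (Suc 0)) \<alpha> (npot g)"
proof (rule C_loc_SucI[OF npot_has_derivative[OF g(1)]])
  fix b :: complex assume b: "b \<in> Basis"
  show "C_loc (Suc 0) \<alpha> (grad_pot b g)"
    by (rule C_loc_SucI[OF grad_pot_has_derivative[OF g \<alpha>(1) less_imp_le[OF \<alpha>(2)] b]])
      (simp add: C_hoelder_0 hoelder_hess_pot[OF g \<alpha> b])
qed

lemma pd_npot: "csupp r g \<Longrightarrow> b \<in> Basis \<Longrightarrow> pd b (npot g) = grad_pot b g"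
  using pd_eq_sumI[OF npot_has_derivative] by blast

text \<open>Integration by parts: the derivative in y of \<open>K (x - y) * g y\<close> has integral
  zero, and the inner minus sign turns this into the exchange of derivatives.\<close>

lemma conv_pd_commute:
  fixes K g :: "'a::euclidean_space \<Rightarrow> real"
  assumes K: "C_loc (Suc 0) \<beta> K" "0 < \<beta>" and g: "C_loc (Suc 0) \<alpha> g" "0 < \<alpha>" "csupp r g" and b: "b \<in> Basis"
  shows "conv K (pd b g) x = conv (pd b K) g x"
proof -
  have cK: "continuous_on UNIV K" "continuous_on UNIV (pd b K)" if "b \<in> Basis" for b
    using C_loc_imp_continuous[OF K] C_loc_imp_continuous[OF C_loc_SucD(2)[OF K(1) that] K(2)] by auto
  have cg: "continuous_on UNIV g" "continuous_on UNIV (pd b g)" if "b \<in> Basis" for b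
    using C_loc_imp_continuous[OF g(1,2)] C_loc_imp_continuous[OF C_loc_SucD(2)[OF g(1) that] g(2)] by auto
  have D: "((\<lambda>y. K (x - y) * g y) has_derivative
      (\<lambda>h. \<Sum>b\<in>Basis. (K (x - y) * pd b g y - pd b K (x - y) * g y) * (h \<bullet> b))) (at y)" for y
  proof -
    have "((\<lambda>y. x - y) has_derivative (\<lambda>h. - h)) (at y)"
      by (auto intro!: derivative_eq_intros)
    from has_derivative_mult[OF has_derivative_compose[OF this C_loc_SucD(1)[OF K(1)]] C_loc_SucD(1)[OF g(1)]]
    show ?thesis
      by (simp add: algebra_simps sum_subtractf sum.distrib sum_distrib_left sum_negf)
  qed
  have "(\<integral>y. K (x - y) * pd b g y - pd b K (x - y) * g y \<partial>lborel) = 0"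
  proof (rule integral_pd_eq_0[OF D _ _ b])
    show "continuous_on UNIV (\<lambda>y. K (x - y) * pd c g y - pd c K (x - y) * g y)" if "c \<in> Basis" for c
      by (intro continuous_intros continuous_on_compose2[OF cK(1)[OF that]]
          continuous_on_compose2[OF cK(2)[OF that]] cg[OF that]) auto
    show "K (x - y) * g y = 0" if "r < norm y" for y
      using g(3) that by (simp add: csupp_def)
  qed
  moreover have "integrable lborel (\<lambda>y. K (x - y) * pd b g y)"
    by (rule integrable_csupp[OF csupp_conv_integrand[OF cK(1)[OF b] csupp_pd[OF g(3,1,2) b]]])
  moreover have "integrable lborel (\<lambda>y. pd b K (x - y) * g y)"
    by (rule integrable_csupp[OF csupp_conv_integrand[OF cK(2)[OF b] g(3)]])
  ultimately show ?thesis
    unfolding conv_def by simp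
qed

lemma npot_pd_commute:
  assumes g: "C_loc (Suc 0) \<alpha> g" "0 < \<alpha>" "csupp r g" and b: "b \<in> Basis"
  shows "npot (pd b g) = grad_pot b g"
proof
  fix x
  have C: "C_loc (Suc 0) 1 log_kernel" "C_loc (Suc 0) 1 dyadic_kernel"
    using C_loc_mono[OF C_loc_log_kernel] C_loc_mono[OF C_loc_dyadic_kernel] by auto
  have "conv (scl j dyadic_kernel) (pd b g) x = 2 ^ j * conv (scl j (pd b dyadic_kernel)) g x" for j
  proof -
    have "conv (scl j dyadic_kernel) (pd b g) x = conv (pd b (scl j dyadic_kernel)) g x"
      by (rule conv_pd_commute[OF C_loc_scl[OF C(2)] _ g b]) auto
    also have "\<dots> = 2 ^ j * conv (scl j (pd b dyadic_kernel)) g x"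
      using pd_scl[OF C(2) b] conv_cmult_left[of "2 ^ j" "scl j (pd b dyadic_kernel)" g x] by presburger
    finally show ?thesis .
  qed
  then show "npot (pd b g) x = grad_pot b g x"
    using conv_pd_commute[OF C(1) _ g b] by (simp add: npot_def grad_pot_def pot_def)
qed

text \<open>The kernels have only two continuous derivatives, so that further ones must be moved to
  \<open>g\<close>. By \<open>npot_pd_commute\<close> the gradient of the potential is the potential
  of a derivative of \<open>g\<close>, which reduces k + 1 to k.\<close>

theorem npot_C_loc:
  assumes "csupp r g" "C_loc k \<alpha> g" "0 < \<alpha>" "\<alpha> < 1"
  shows "C_loc (Suc (Suc k)) \<alpha> (npot g)"
  using assms(1,2)
proof (induction k arbitrary: g)
  case 0
  then show ?case using npot_C_loc_2 assms(3,4) by (simp add: C_hoelder_0)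
next
  case (Suc k)
  have "C_loc (Suc 0) \<alpha> g"
    using C_loc_mono[OF Suc.prems(2), of "Suc 0"] assms(3,4) by simp
  then have "C_loc (Suc (Suc k)) \<alpha> (grad_pot b g)" if "b \<in> Basis" for b
    using Suc.IH[OF csupp_pd[OF Suc.prems assms(3) that] C_loc_SucD(2)[OF Suc.prems(2) that]]
      npot_pd_commute[OF _ assms(3) Suc.prems(1) that] by simp
  then show ?case
    by (intro C_loc_SucI[OF npot_has_derivative[OF Suc.prems(1)]])
qed

section \<open>Bounds for the gradient and for the Hessian at the origin\<close>

lemma suminf_abs_le_geometric:
  fixes s :: "nat \<Rightarrow> real"
  assumes "\<And>j. \<bar>s j\<bar> \<le> a * q ^ j" "0 \<le> q" "q < 1"
  shows "\<bar>suminf s\<bar> \<le> a / (1 - q)"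
proof -
  have "summable (\<lambda>j. a * q ^ j)"
    using assms by (intro summable_mult summable_geometric) auto
  then have "\<bar>suminf s\<bar> \<le> (\<Sum>j. a * q ^ j)"
    using norm_suminf_le[of s] assms(1) by simp
  also have "\<dots> = a / (1 - q)"
    using assms by (subst suminf_mult) (auto simp: suminf_geometric summable_geometric)
  finally show ?thesis .
qed

lemma conv_bound:
  fixes K g :: "complex \<Rightarrow> real"
  assumes "0 \<le> r" and g: "csupp r g" "\<And>y. \<bar>g y\<bar> \<le> M" and K: "\<And>z. norm z \<le> norm x + r \<Longrightarrow> \<bar>K z\<bar> \<le> B"
  shows "\<bar>conv K g x\<bar> \<le> (B * (pi * r\<^sup>2)) * M"
proof -
  have "0 \<le> B" using K[of 0] \<open>0 \<le> r\<close> by (simp add: order_trans[OF abs_ge_zero])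
  have "\<bar>conv K g x\<bar> \<le> (B * M) * (unit_ball_vol DIM(complex) * r ^ DIM(complex))"
    unfolding conv_def
  proof (rule integral_bound_cball[where x = 0 and \<rho> = r])
    fix y :: complex
    {
      assume "dist 0 y \<le> r"
      then have "\<bar>K (x - y)\<bar> \<le> B"
        using K[of "x - y"] norm_triangle_ineq4[of x y] by simp
      then show "\<bar>K (x - y) * g y\<bar> \<le> B * M"
        using g(2)[of y] \<open>0 \<le> B\<close> unfolding abs_mult by (intro mult_mono) auto
    next
      assume "r < dist 0 y"
      then show "K (x - y) * g y = 0"
        using g(1) by (simp add: csupp_def)
    }
  qed fact
  then show ?thesis by (simp add: unit_ball_vol_2 mult_ac)
qed

text \<open>The constant depends on the radius alone and the bound is linear in the sup norm of
  \<open>g\<close>; this is what permits a contraction argument in the sup norm.\<close>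

lemma grad_pot_bound:
  assumes "0 \<le> r"
  obtains C where "0 \<le> C" "\<And>g M x b. b \<in> Basis \<Longrightarrow> csupp r g \<Longrightarrow> (\<And>y. \<bar>g y\<bar> \<le> M) \<Longrightarrow> norm x \<le> r
    \<Longrightarrow> \<bar>grad_pot b g x\<bar> \<le> C * M"
proof -
  have "\<exists>C\<ge>0. \<forall>g M x. csupp r g \<longrightarrow> (\<forall>y. \<bar>g y\<bar> \<le> M) \<longrightarrow> norm x \<le> r \<longrightarrow> \<bar>grad_pot b g x\<bar> \<le> C * M"
    if b: "b \<in> Basis" for b
  proof -
    obtain B0 where B0: "B0 \<ge> 0" "\<And>z. norm z \<le> r + r \<Longrightarrow> \<bar>pd b log_kernel z\<bar> \<le> B0"
      using continuous_bounded_cball[OF C_loc_imp_continuous[OF log_kernel_facts(2)[OF b] zero_less_one]]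
      by blast
    obtain B where B: "B \<ge> 0" "\<And>z. \<bar>pd b dyadic_kernel z\<bar> \<le> B"
      using csupp_bounded[OF dyadic_kernel_facts(4)[OF b]] by blast
    have "\<bar>grad_pot b g x\<bar> \<le> (B0 * (pi * r\<^sup>2) + 2 * pi * B) * M"
      if g: "csupp r g" "\<forall>y. \<bar>g y\<bar> \<le> M" and x: "norm x \<le> r" for g M x
    proof -
      have "\<bar>conv (pd b log_kernel) g x\<bar> \<le> (B0 * (pi * r\<^sup>2)) * M"
        using x B0 g(2) by (intro conv_bound[OF assms g(1)]) auto
      moreover have "\<bar>\<Sum>j. 2 ^ j * conv (scl j (pd b dyadic_kernel)) g x\<bar> \<le> (pi * B * M) / (1 - 2 / 4)"
        using pot_term_bound[OF dyadic_kernel_facts(4)[OF b] B(2), of g M 2] g(2)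
        by (intro suminf_abs_le_geometric) auto
      ultimately show ?thesis
        unfolding grad_pot_def pot_def by (simp add: distrib_right)
    qed
    then show ?thesis
      using B0(1) B(1) by (intro exI[of _ "B0 * (pi * r\<^sup>2) + 2 * pi * B"]) auto
  qed
  then obtain C where C: "\<And>b. b \<in> Basis \<Longrightarrow> 0 \<le> C b" "\<And>b g M x. b \<in> Basis \<Longrightarrow> csupp r g \<Longrightarrow>
      (\<forall>y. \<bar>g y\<bar> \<le> M) \<Longrightarrow> norm x \<le> r \<Longrightarrow> \<bar>grad_pot b g x\<bar> \<le> C b * M"
    by metis
  have "\<bar>grad_pot b g x\<bar> \<le> (\<Sum>b\<in>Basis. C b) * M"
    if "b \<in> Basis" "csupp r g" "\<And>y. \<bar>g y\<bar> \<le> M" "norm x \<le> r" for b g M x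
  proof -
    have "0 \<le> M" using that(3)[of 0] by linarith
    moreover have "C b \<le> (\<Sum>b\<in>Basis. C b)"
      using that(1) C(1) by (intro member_le_sum) auto
    ultimately have "C b * M \<le> (\<Sum>b\<in>Basis. C b) * M"
      by (rule mult_right_mono[rotated])
    then show ?thesis using C(2)[OF that(1,2) _ that(4), of M] that(3) by force
  qed
  moreover have "0 \<le> (\<Sum>b\<in>Basis. C b)"
    using C(1) by (rule sum_nonneg)
  ultimately show ?thesis using that by blast
qed

text \<open>Linear vanishing of \<open>g\<close> at the origin replaces Hoelder continuity: on the
  disc of radius 2^-j about 0 the density is at most A 2^-j, so that size alone gives the ratio
  1/2.\<close>

lemma hess_pot_0_bound:
  assumes "0 \<le> r" and bc: "b \<in> Basis" "c \<in> Basis"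
  obtains C where "0 \<le> C" "\<And>g A. csupp r g \<Longrightarrow> (\<And>y. \<bar>g y\<bar> \<le> A * norm y) \<Longrightarrow> \<bar>hess_pot c b g 0\<bar> \<le> C * A"
proof -
  let ?K = "pd c (pd b dyadic_kernel)"
  obtain B0 where B0: "B0 \<ge> 0" "\<And>z. norm z \<le> r \<Longrightarrow> \<bar>pd c (pd b log_kernel) z\<bar> \<le> B0"
    using continuous_bounded_cball[OF C_loc_imp_continuous[OF log_kernel_facts(3)[OF bc] zero_less_one]]
    by blast
  obtain B where B: "B \<ge> 0" "\<And>z. \<bar>?K z\<bar> \<le> B"
    using csupp_bounded[OF dyadic_kernel_facts(5)[OF bc]] by blast
  have "\<bar>hess_pot c b g 0\<bar> \<le> (B0 * (pi * r\<^sup>2) * r + 2 * pi * B) * A"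
    if g: "csupp r g" "\<And>y. \<bar>g y\<bar> \<le> A * norm y" for g A
  proof -
    have A: "0 \<le> A" using g(2)[of 1] by simp
    have "\<bar>g y\<bar> \<le> A * r" for y
    proof (cases "norm y \<le> r")
      case True
      then show ?thesis using g(2)[of y] mult_left_mono[OF True A] by linarith
    next
      case False
      then show ?thesis using g(1) A assms(1) by (simp add: csupp_def)
    qed
    then have "\<bar>conv (pd c (pd b log_kernel)) g 0\<bar> \<le> (B0 * (pi * r\<^sup>2)) * (A * r)"
      using B0 by (intro conv_bound[OF assms(1) g(1)]) auto
    moreover have "\<bar>\<Sum>j. 4 ^ j * conv (scl j ?K) g 0\<bar> \<le> (pi * B * A) / (1 - 1/2)"
    proof (rule suminf_abs_le_geometric)
      fix j
      have "\<bar>conv (scl j ?K) g 0\<bar> \<le> pi * B * (A * (1/2) ^ j) * (1/4) ^ j"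
      proof (rule conv_scl_bound[OF dyadic_kernel_facts(5)[OF bc] B(2)])
        fix y :: complex assume "dist 0 y \<le> (1/2) ^ j"
        then have "A * norm y \<le> A * (1/2) ^ j"
          using A by (intro mult_left_mono) auto
        then show "\<bar>g y\<bar> \<le> A * (1/2) ^ j"
          using g(2)[of y] by linarith
      qed
      then have "4 ^ j * \<bar>conv (scl j ?K) g 0\<bar> \<le> 4 ^ j * (pi * B * (A * (1/2) ^ j) * (1/4) ^ j)"
        by (rule mult_left_mono) simp
      also have "\<dots> = (4 ^ j * (1/4) ^ j) * (pi * B * A * (1/2) ^ j)"
        by (simp only: mult_ac)
      also have "(4::real) ^ j * (1/4) ^ j = 1"
        by (simp add: power_mult_distrib[symmetric])
      finally show "\<bar>4 ^ j * conv (scl j ?K) g 0\<bar> \<le> (pi * B * A) * (1/2) ^ j"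
        by (simp add: abs_mult)
    qed auto
    ultimately show ?thesis
      unfolding hess_pot_def pot_def by (simp add: algebra_simps)
  qed
  then show ?thesis
    using that[of "B0 * (pi * r\<^sup>2) * r + 2 * pi * B"] B0(1) B(1) assms(1) by auto
qed

section \<open>Linearity of the potentials\<close>

lemma conv_diff_right:
  assumes "continuous_on UNIV K" "csupp r g" "csupp r g'"
  shows "conv K (\<lambda>y. g y - g' y) x = conv K g x - conv K g' x"
  unfolding conv_def
  using integrable_csupp[OF csupp_conv_integrand[OF assms(1,2), of x]]
    integrable_csupp[OF csupp_conv_integrand[OF assms(1,3), of x]]
  by (simp add: right_diff_distrib)

lemma csupp_diff: "csupp r g \<Longrightarrow> csupp r g' \<Longrightarrow> csupp r (\<lambda>y. g y - g' y)"
  unfolding csupp_def by (auto intro!: continuous_intros)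

lemma pot_diff:
  assumes K: "continuous_on UNIV K0" "csupp 1 K" and g: "csupp r g" "csupp r g'" and "0 \<le> w" "w < 4"
  shows "pot w K0 K (\<lambda>y. g y - g' y) x = pot w K0 K g x - pot w K0 K g' x"
proof -
  have "continuous_on UNIV (scl j K)" for j
    using csupp_scl[OF K(2)] by (simp add: csupp_def)
  then show ?thesis
    unfolding pot_def
    using suminf_diff[OF pot_summable[OF K(2) g(1) assms(5,6)] pot_summable[OF K(2) g(2) assms(5,6)], of x x]
    by (simp add: conv_diff_right[OF _ g] K(1) right_diff_distrib)
qed

lemma npot_diff:
  assumes "csupp r g" "csupp r g'"
  shows "npot (\<lambda>y. g y - g' y) x = npot g x - npot g' x"
  unfolding npot_def
  by (rule pot_diff[OF C_loc_imp_continuous[OF C_loc_log_kernel] csupp_dyadic_kernel assms]) auto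

lemma grad_pot_diff:
  assumes "csupp r g" "csupp r g'" "b \<in> Basis"
  shows "grad_pot b (\<lambda>y. g y - g' y) x = grad_pot b g x - grad_pot b g' x"
  unfolding grad_pot_def
  by (rule pot_diff[OF C_loc_imp_continuous[OF log_kernel_facts(2)[OF assms(3)] zero_less_one]
        dyadic_kernel_facts(4)[OF assms(3)] assms(1,2)]) simp_all

section \<open>The Laplacian of the potential\<close>

definition mass :: real where
  "mass = (\<integral>y. bump_kernel y \<partial>lborel)"

lemma csupp_bump_kernel: "csupp 1 bump_kernel"
proof -
  have "1 \<le> x \<bullet> x" if "1 < norm x" for x :: complex
    using that by (simp add: dot_square_norm)
  then show ?thesis
    unfolding csupp_def bump_kernel_def by (auto intro!: continuous_intros)
qed

text \<open>The exact value is 2 pi, the constant in the Laplacian of ln |x|. The lower bound comes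
  from the disc of radius 1/2, where \<open>bump_kernel\<close> is at least 4 (1 - 1/4) = 3.\<close>

lemma mass_pos: "0 < mass"
proof -
  have "integrable lborel (\<lambda>y. 3 * indicator (cball (0::complex) (1/2)) y :: real)"
    using emeasure_bounded_finite[of "cball (0::complex) (1/2)"]
    by (intro integrable_mult_right integrable_real_indicator) auto
  then have "(\<integral>y. 3 * indicator (cball (0::complex) (1/2)) y \<partial>lborel) \<le> mass"
    unfolding mass_def
  proof (intro integral_mono integrable_csupp[OF csupp_bump_kernel])
    fix y :: complex
    show "3 * indicator (cball 0 (1/2)) y \<le> bump_kernel y"
    proof (cases "norm y \<le> 1/2")
      case True
      then have "y \<bullet> y \<le> 1/4"
        using power_mono[OF True, of 2] by (simp add: dot_square_norm power2_eq_square)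
      then show ?thesis by (simp add: bump_kernel_def indicator_def)
    qed (simp add: bump_kernel_def)
  qed
  moreover have "0 < (\<integral>y. 3 * indicator (cball (0::complex) (1/2)) y \<partial>lborel :: real)"
    by (simp add: content_cball unit_ball_vol_2)
  ultimately show ?thesis by linarith
qed

lemma scl_laplace_dyadic:
  "(\<Sum>b\<in>Basis. scl j (pd b (pd b dyadic_kernel)) x) = 4 * scl (Suc j) bump_kernel x - scl j bump_kernel x"
  using laplace_dyadic_kernel[of "2 ^ j *\<^sub>R x"] by (simp add: laplace_def scl_def)

text \<open>Instead of a change of variables: consecutive members differ by the integral of the
  Laplacian of a compactly supported function, which is zero.\<close>

lemma integral_scl_bump: "4 ^ j * (\<integral>y. scl j bump_kernel y \<partial>lborel) = mass"
proof (induction j)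
  case 0
  show ?case by (simp add: mass_def scl_def)
next
  case (Suc j)
  have int: "integrable lborel (scl j bump_kernel)" for j
    by (rule integrable_csupp[OF csupp_scl[OF csupp_bump_kernel]])
  have "(\<integral>y. 4 * scl (Suc j) bump_kernel y - scl j bump_kernel y \<partial>lborel) =
      (\<integral>y. (\<Sum>b\<in>Basis. scl j (pd b (pd b dyadic_kernel)) y) \<partial>lborel)"
    by (simp only: scl_laplace_dyadic)
  also have "\<dots> = (\<Sum>b\<in>Basis. \<integral>y. scl j (pd b (pd b dyadic_kernel)) y \<partial>lborel)"
    by (intro Bochner_Integration.integral_sum integrable_csupp[OF csupp_scl[OF dyadic_kernel_facts(5)]])
  also have "\<dots> = 0"
    by (intro sum.neutral ballI integral_scl_pd_eq_0[OF dyadic_kernel_facts(4) dyadic_kernel_facts(2)]) auto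
  finally have "4 * (\<integral>y. scl (Suc j) bump_kernel y \<partial>lborel) = (\<integral>y. scl j bump_kernel y \<partial>lborel)"
    using int by simp
  then have "4 ^ j * (4 * (\<integral>y. scl (Suc j) bump_kernel y \<partial>lborel)) = mass"
    using Suc by metis
  then show ?case
    by (simp only: power_Suc mult_ac)
qed

text \<open>The Laplacian turns the dyadic series into a telescoping series of the mollifications \<open>M j\<close> of \<open>g\<close>.\<close>

lemma laplace_npot:
  assumes g: "csupp r g" "hoelder_on \<alpha> UNIV g" and \<alpha>: "0 < \<alpha>" "\<alpha> \<le> 1"
  shows "laplace (npot g) x = mass * g x"
proof -
  define q where "q = (1/2::real) powr \<alpha>"
  have q: "0 \<le> q" "q < 1"
    using \<alpha> powr_less_mono'[of "1/2" 0 \<alpha>] by (auto simp: q_def)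
  obtain A where A: "A \<ge> 0" "\<And>x y. \<bar>g x - g y\<bar> \<le> A * dist x y powr \<alpha>"
    using csupp_global_hoelder[OF g \<alpha>(1)] by metis
  have cg: "continuous_on UNIV g" using g(1) by (simp add: csupp_def)
  let ?K = "\<lambda>b. pd b (pd b dyadic_kernel)"
  define M where "M j = 4 ^ j * conv (scl j bump_kernel) g x" for j
  have int: "integrable lborel (\<lambda>y. scl j K (x - y) * g y)" if "csupp 1 K" for j K
    using csupp_scl[OF that] by (intro integrable_csupp[OF csupp_conv_integrand[OF _ g(1)]]) (simp add: csupp_def)
  have step: "(\<Sum>b\<in>Basis. 4 ^ j * conv (scl j (?K b)) g x) = M (Suc j) - M j" for j
  proof -
    have "(\<Sum>b\<in>Basis. conv (scl j (?K b)) g x) = (\<integral>y. (\<Sum>b\<in>Basis. scl j (?K b) (x - y) * g y) \<partial>lborel)"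
      unfolding conv_def
      by (intro Bochner_Integration.integral_sum[symmetric] int dyadic_kernel_facts(5))
    also have "\<dots> = (\<integral>y. 4 * (scl (Suc j) bump_kernel (x - y) * g y) - scl j bump_kernel (x - y) * g y \<partial>lborel)"
      by (simp only: sum_distrib_right[symmetric] scl_laplace_dyadic left_diff_distrib mult.assoc)
    also have "\<dots> = 4 * conv (scl (Suc j) bump_kernel) g x - conv (scl j bump_kernel) g x"
      unfolding conv_def using int[OF csupp_bump_kernel] by simp
    finally show ?thesis
      by (simp add: sum_distrib_left[symmetric] M_def right_diff_distrib)
  qed
  have summ: "summable (\<lambda>j. 4 ^ j * conv (scl j (?K b)) g x)" if b: "b \<in> Basis" for b
  proof -
    obtain B where B: "\<And>z. \<bar>?K b z\<bar> \<le> B"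
      using csupp_bounded[OF dyadic_kernel_facts(5)[OF b b]] by metis
    have "norm (4 ^ j * conv (scl j (?K b)) g x) \<le> (pi * B * A) * q ^ j" for j
      unfolding q_def real_norm_def
      by (rule conv_scl_osc[OF dyadic_kernel_facts(5)[OF b b] B
            integral_scl_pd_eq_0[OF dyadic_kernel_facts(4,2)[OF b] _ _ b] cg A \<alpha>(1)]) auto
    moreover have "summable (\<lambda>j. (pi * B * A) * q ^ j)"
      using q by (intro summable_mult summable_geometric) auto
    ultimately show ?thesis
      by (rule summable_comparison_test'[rotated, where N = 0])
  qed
  \<comment> \<open>\<open>M j\<close> integrates \<open>g\<close> against a kernel of total
    integral \<open>mass\<close> supported within 2^-j of x; the Hoelder condition makes the error
    decay like q^j.\<close>
  have lim: "M \<longlonglongrightarrow> mass * g x"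
  proof -
    have le: "norm (M j - mass * g x) \<le> (pi * 4 * A) * q ^ j" for j
    proof -
      have "\<bar>conv (scl j bump_kernel) (\<lambda>y. g y - g x) x\<bar> \<le> pi * 4 * (A * q ^ j) * (1/4) ^ j"
      proof (rule conv_scl_bound[OF csupp_bump_kernel])
        show "\<bar>bump_kernel z\<bar> \<le> 4" for z
          by (auto simp: bump_kernel_def)
        fix y assume y: "dist x y \<le> (1/2) ^ j"
        have "\<bar>g y - g x\<bar> \<le> A * dist x y powr \<alpha>"
          using A(2)[of y x] by (simp add: dist_commute)
        also have "\<dots> \<le> A * q ^ j"
          using powr_dist_scale[of x y 1 j \<alpha>] y \<alpha>(1) A(1) unfolding q_def by (intro mult_left_mono) auto
        finally show "\<bar>g y - g x\<bar> \<le> A * q ^ j" .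
      qed
      then have "4 ^ j * \<bar>conv (scl j bump_kernel) (\<lambda>y. g y - g x) x\<bar> \<le> 4 ^ j * (pi * 4 * (A * q ^ j) * (1/4) ^ j)"
        by (rule mult_left_mono) simp
      also have "\<dots> = (4 ^ j * (1/4) ^ j) * ((pi * 4 * A) * q ^ j)"
        by (simp only: mult_ac)
      also have "(4::real) ^ j * (1/4) ^ j = 1"
        by (simp add: power_mult_distrib[symmetric])
      also have "4 ^ j * \<bar>conv (scl j bump_kernel) (\<lambda>y. g y - g x) x\<bar> = \<bar>M j - mass * g x\<bar>"
      proof -
        have "4 ^ j * (conv (scl j bump_kernel) g x - g x * (\<integral>y. scl j bump_kernel y \<partial>lborel)) = M j - mass * g x"
          unfolding M_def integral_scl_bump[of j, symmetric] by (simp only: right_diff_distrib mult_ac)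
        then have "4 ^ j * conv (scl j bump_kernel) (\<lambda>y. g y - g x) x = M j - mass * g x"
          unfolding conv_scl_minus_const[OF csupp_bump_kernel refl cg] .
        then have "\<bar>4 ^ j * conv (scl j bump_kernel) (\<lambda>y. g y - g x) x\<bar> = \<bar>M j - mass * g x\<bar>"
          by (rule arg_cong)
        then show ?thesis by (simp add: abs_mult)
      qed
      finally show ?thesis by simp
    qed
    have "(\<lambda>j. (pi * 4 * A) * q ^ j) \<longlonglongrightarrow> 0"
      using q by (intro tendsto_mult_right_zero LIMSEQ_power_zero) auto
    then have "(\<lambda>j. M j - mass * g x) \<longlonglongrightarrow> 0"
      by (rule Lim_null_comparison[rotated]) (simp only: le eventually_True)
    then show ?thesis by (rule LIM_zero_cancel)
  qed
  have "laplace (npot g) x = (\<Sum>b\<in>Basis. hess_pot b b g x)"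
    unfolding laplace_def
    by (intro sum.cong refl) (simp add: pd_npot[OF g(1)] pd_eq_sumI[OF grad_pot_has_derivative[OF g \<alpha>]])
  also have "\<dots> = (\<Sum>b\<in>Basis. conv (pd b (pd b log_kernel)) g x) + (\<Sum>j. M (Suc j) - M j)"
    unfolding hess_pot_def pot_def sum.distrib 
    using suminf_sum[of Basis "\<lambda>b j. 4 ^ j * conv (scl j (?K b)) g x", OF summ] by (simp add: step)
  \<comment> \<open>The regularised kernel supplies exactly the initial term that the telescoping
    series subtracts.\<close>
  also have "(\<Sum>b\<in>Basis. conv (pd b (pd b log_kernel)) g x) = M 0"
  proof -
    have "integrable lborel (\<lambda>y. pd b (pd b log_kernel) (x - y) * g y)" if "b \<in> Basis" for b
      using C_loc_imp_continuous[OF log_kernel_facts(3)[OF that that]]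
      by (intro integrable_csupp[OF csupp_conv_integrand[OF _ g(1)]]) auto
    then have "(\<Sum>b\<in>Basis. conv (pd b (pd b log_kernel)) g x) =
        (\<integral>y. (\<Sum>b\<in>Basis. pd b (pd b log_kernel) (x - y) * g y) \<partial>lborel)"
      unfolding conv_def by (intro Bochner_Integration.integral_sum[symmetric])
    also have "\<dots> = (\<integral>y. laplace log_kernel (x - y) * g y \<partial>lborel)"
      by (simp only: sum_distrib_right[symmetric] laplace_def)
    finally show ?thesis
      by (simp add: M_def conv_def scl_def laplace_log_kernel)
  qed
  also have "(\<Sum>j. M (Suc j) - M j) = mass * g x - M 0"
    using telescope_sums[OF lim] by (simp add: sums_iff)
  finally show ?thesis by simp
qed

section \<open>Restriction to balls\<close>

lemma partial_on_eq_pd: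
  fixes u v :: "'a::euclidean_space \<Rightarrow> real"
  assumes S: "convex S" "interior S \<noteq> {}" "x \<in> S"
    and eq: "\<And>y. y \<in> S \<Longrightarrow> u y = v y" and v: "(v has_derivative D) (at x)"
  shows "partial_on S b u x = pd b v x" and "u differentiable (at x within S)"
proof -
  have "(u has_derivative D) (at x within S)"
    by (rule has_derivative_transform[OF S(3) eq has_derivative_at_withinI[OF v]])
  then show "partial_on S b u x = pd b v x" "u differentiable (at x within S)"
    using partial_on_eqI[OF S] pd_eqI[OF v] by (auto simp: differentiable_def)
qed

lemma C_loc_partials_on:
  fixes w :: "'a::euclidean_space \<Rightarrow> real"
  assumes "C_loc k \<alpha> w" "bs \<in> lists Basis" "length bs \<le> k"
  shows "C_loc (k - length bs) \<alpha> (partials_on UNIV bs w)"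
  using assms(2,3)
proof (induction bs)
  case Nil
  then show ?case using assms(1) by simp
next
  case (Cons b bs)
  then have "C_loc (Suc (k - length (b # bs))) \<alpha> (partials_on UNIV bs w)" "b \<in> Basis"
    by (auto simp: Suc_diff_Suc)
  then show ?case using C_loc_SucD(2) by auto
qed

lemma partials_on_eq:
  fixes u w :: "'a::euclidean_space \<Rightarrow> real"
  assumes S: "convex S" "interior S \<noteq> {}" and w: "C_loc k \<alpha> w"
    and eq: "\<And>y. y \<in> S \<Longrightarrow> u y = w y"
    and "bs \<in> lists Basis" "length bs \<le> k" "x \<in> S"
  shows "partials_on S bs u x = partials_on UNIV bs w x"
  using assms(5-7)
proof (induction bs arbitrary: x)
  case Nil
  then show ?case using eq by simp
next
  case (Cons b bs)
  then have "C_loc (Suc (k - length (b # bs))) \<alpha> (partials_on UNIV bs w)"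
    using C_loc_partials_on[OF w, of bs] by (auto simp: Suc_diff_Suc)
  from partial_on_eq_pd(1)[OF S Cons.prems(2) _ C_loc_SucD(1)[OF this]] Cons show ?case
    by auto
qed

text \<open>Derivatives within a convex set with interior points are unique, so that those of a
  function on the whole space restrict to them. Only the values of \<open>u\<close> on
  \<open>S\<close> enter, so that \<open>u\<close> may be undefined elsewhere.\<close>

lemma C_hoelder_restrict:
  fixes u w :: "'a::euclidean_space \<Rightarrow> real"
  assumes S: "convex S" "interior S \<noteq> {}" and w: "C_loc k \<alpha> w"
    and eq: "\<And>y. y \<in> S \<Longrightarrow> u y = w y"
  shows "C_hoelder k \<alpha> S u"
  unfolding C_hoelder_def
proof (intro ballI conjI impI)
  fix bs :: "'a list" assume bs: "bs \<in> lists Basis"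
  {
    assume len: "length bs < k"
    then have C: "C_loc (Suc (k - Suc (length bs))) \<alpha> (partials_on UNIV bs w)"
      using C_loc_partials_on[OF w bs] by (simp add: Suc_diff_Suc)
    show "partials_on S bs u differentiable_on S"
      unfolding differentiable_on_def
    proof
      fix x assume "x \<in> S"
      then show "partials_on S bs u differentiable (at x within S)"
        using partial_on_eq_pd(2)[OF S _ _ C_loc_SucD(1)[OF C]] partials_on_eq[OF S w eq bs] len by auto
    qed
  next
    assume len: "length bs = k"
    then have H: "hoelder_on \<alpha> UNIV (partials_on UNIV bs w)"
      using C_loc_partials_on[OF w bs] by (simp add: C_hoelder_0)
    show "hoelder_on \<alpha> S (partials_on S bs u)"
      unfolding hoelder_on_def
    proof (intro allI impI)
      fix K assume K: "K \<subseteq> S" "compact K"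
      obtain C where C: "\<forall>x\<in>K. \<forall>y\<in>K. \<bar>partials_on UNIV bs w x - partials_on UNIV bs w y\<bar> \<le> C * dist x y powr \<alpha>"
        using H[unfolded hoelder_on_def, rule_format, OF subset_UNIV K(2)] by blast
      have "partials_on S bs u x = partials_on UNIV bs w x" if "x \<in> K" for x
        using partials_on_eq[OF S w eq bs] len K(1) that by blast
      then show "\<exists>C. \<forall>x\<in>K. \<forall>y\<in>K. \<bar>partials_on S bs u x - partials_on S bs u y\<bar> \<le> C * dist x y powr \<alpha>"
        using C by (intro exI[of _ C]) simp
    qed
  }
qed

section \<open>Cutoff functions\<close>

lemma C_loc_lower_exponent:
  fixes u :: "'a::euclidean_space \<Rightarrow> real"
  assumes "C_loc k 1 u" "0 < \<alpha>" "\<alpha> \<le> 1"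
  shows "C_loc k \<alpha> u"
  using assms(1)
proof (induction k arbitrary: u)
  case 0
  then show ?case using lipschitz_imp_hoelder assms(2,3) by (simp add: C_hoelder_0)
next
  case (Suc k)
  show ?case
    by (rule C_loc_SucI[OF C_loc_SucD(1)[OF Suc.prems] Suc.IH[OF C_loc_SucD(2)[OF Suc.prems]]])
qed

text \<open>A spline of finite regularity is enough for building cutoffs; each integration of the
  truncated power gains one degree.\<close>

lemma C_loc_truncated_power: "C_loc m 1 (\<lambda>t::real. max 0 t ^ Suc m)"
proof (induction m)
  case 0
  have "\<bar>max 0 s - max 0 t\<bar> \<le> 1 * dist s t powr 1" for s t :: real
    by (auto simp: dist_real_def max_def)
  then show ?case
    unfolding C_hoelder_0 hoelder_on_def by (auto intro!: exI[of _ 1])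
next
  case (Suc m)
  have "((\<lambda>t::real. max 0 t ^ Suc (Suc m)) has_real_derivative real (Suc (Suc m)) * max 0 t ^ Suc m) (at t)" for t
  proof -
    have "((\<lambda>t::real. if 0 \<le> t then t ^ Suc (Suc m) else 0) has_real_derivative
        (if 0 \<le> t then real (Suc (Suc m)) * t ^ Suc m else 0)) (at t)"
      using DERIV_pow[of "Suc (Suc m)"]
      by (intro DERIV_glue[where g = "\<lambda>_. 0" and g' = "\<lambda>_. 0"
            and f' = "\<lambda>t. real (Suc (Suc m)) * t ^ Suc m"]) auto
    moreover have "(\<lambda>t::real. if 0 \<le> t then t ^ Suc (Suc m) else 0) = (\<lambda>t. max 0 t ^ Suc (Suc m))"
      by (auto simp: fun_eq_iff max_def)
    moreover have "(if 0 \<le> t then real (Suc (Suc m)) * t ^ Suc m else 0) = real (Suc (Suc m)) * max 0 t ^ Suc m"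
      by (auto simp: max_def)
    ultimately show ?thesis by simp
  qed
  moreover have "C_loc m 1 (\<lambda>t::real. real (Suc (Suc m)) * max 0 t ^ Suc m)"
    by (rule C_loc_cmult[OF Suc]) auto
  ultimately show ?case
    by (rule C_loc_real_SucI)
qed

lemma cutoff_exists:
  assumes "0 < R" "0 < \<alpha>" "\<alpha> \<le> 1"
  obtains \<zeta> :: "complex \<Rightarrow> real" where "C_loc m \<alpha> \<zeta>" "csupp (R + 1) \<zeta>"
    "\<And>x. 0 \<le> \<zeta> x" "\<And>x. \<zeta> x \<le> 1" "\<And>x. norm x \<le> R \<Longrightarrow> \<zeta> x = 1"
proof -
  \<comment> \<open>This vanishes on the disc of radius R and is at least 1 beyond R + 1, because (R
    + 1)^2 - R^2 >= 1. The exponent exceeds that of the outer power by one, since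
    \<open>C_loc_compose\<close> asks one more degree of the inner function.\<close>
  define \<rho> where "\<rho> x = max 0 (x \<bullet> x - R\<^sup>2) ^ Suc (Suc m)" for x :: complex
  define \<zeta> where "\<zeta> x = max 0 (1 - \<rho> x) ^ Suc m" for x
  have "C_loc (Suc m) 1 \<rho>"
    unfolding \<rho>_def[abs_def]
    by (rule C_loc_compose[OF C_loc_truncated_power]) (auto intro: C_loc_diff C_loc_sqnorm C_loc_const)
  then have "C_loc (Suc m) 1 (\<lambda>x. 1 - \<rho> x)"
    by (intro C_loc_diff C_loc_const) auto
  then have C: "C_loc m 1 \<zeta>"
    unfolding \<zeta>_def[abs_def] by (rule C_loc_compose[OF C_loc_truncated_power]) auto
  have \<rho>0: "0 \<le> \<rho> x" for x
    by (simp add: \<rho>_def)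
  have z: "\<zeta> x = 0" if "R + 1 < norm x" for x
  proof -
    have "(R + 1)\<^sup>2 \<le> (norm x)\<^sup>2"
      using that assms(1) by (intro power_mono) auto
    then have "1 \<le> x \<bullet> x - R\<^sup>2"
      using assms(1) by (simp add: dot_square_norm power2_sum)
    then have "1 \<le> \<rho> x"
      unfolding \<rho>_def by (intro one_le_power) auto
    then show ?thesis by (simp add: \<zeta>_def)
  qed
  have o: "\<zeta> x = 1" if "norm x \<le> R" for x
    using power_mono[OF that, of 2] by (simp add: \<zeta>_def \<rho>_def dot_square_norm)
  have le: "\<zeta> x \<le> 1" for x
    unfolding \<zeta>_def using \<rho>0[of x] by (intro power_le_one) auto
  show ?thesis
  proof (rule that[OF C_loc_lower_exponent[OF C assms(2,3)] _ _ le o])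
    show "csupp (R + 1) \<zeta>"
      unfolding csupp_def using C_loc_imp_continuous[OF C] z by auto
    show "0 \<le> \<zeta> x" for x
      by (simp add: \<zeta>_def)
  qed
qed

section \<open>The perturbed quadratic harmonic polynomial\<close>

definition quad :: "complex \<Rightarrow> real" where
  "quad z = Re z * Re z - Im z * Im z"

lemma quad_le: "\<bar>quad z\<bar> \<le> (norm z)\<^sup>2"
  unfolding quad_def cmod_power2 by (auto simp: power2_eq_square abs_le_iff)

lemma C_loc_quad: "C_loc k 1 quad"
  unfolding quad_def[abs_def]
  by (intro C_loc_diff C_loc_mult C_loc_linear bounded_linear_Re bounded_linear_Im) auto

lemma pd_quad: "b \<in> Basis \<Longrightarrow> pd b quad z = 2 * (Re z * Re b - Im z * Im b)"
proof (rule pd_eqI)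
  show "(quad has_derivative (\<lambda>h. 2 * (Re z * Re h - Im z * Im h))) (at z)"
    unfolding quad_def[abs_def]
    by (auto intro!: derivative_eq_intros simp: algebra_simps)
qed

lemma pd_pd_quad: "b \<in> Basis \<Longrightarrow> pd b (pd b quad) z = 2 * (Re b * Re b - Im b * Im b)"
proof -
  assume b: "b \<in> Basis"
  have "((\<lambda>z. 2 * (Re z * Re b - Im z * Im b)) has_derivative (\<lambda>h. 2 * (Re h * Re b - Im h * Im b))) (at z)"
    by (auto intro!: derivative_eq_intros)
  moreover have "(\<lambda>z. 2 * (Re z * Re b - Im z * Im b)) = pd b quad"
    using pd_quad[OF b] by auto
  ultimately show ?thesis
    using pd_eqI by metis
qed

text \<open>The \<open>W g\<close> of the overview. Affine functions are harmonic, so that removing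
  the 1-jet does not affect the Laplacian, and division by \<open>mass\<close> makes the Laplacian
  equal to \<open>g\<close>.\<close>

definition corr :: "(complex \<Rightarrow> real) \<Rightarrow> complex \<Rightarrow> real" where
  "corr g x = (npot g x - npot g 0 - (\<Sum>b\<in>Basis. grad_pot b g 0 * (x \<bullet> b))) / mass"

lemma corr_has_derivative:
  assumes "csupp r g"
  shows "(corr g has_derivative (\<lambda>h. \<Sum>b\<in>Basis. ((grad_pot b g x - grad_pot b g 0) / mass) * (h \<bullet> b))) (at x)"
proof -
  have "((\<lambda>x. \<Sum>b\<in>Basis. grad_pot b g 0 * (x \<bullet> b)) has_derivative (\<lambda>h. \<Sum>b\<in>Basis. grad_pot b g 0 * (h \<bullet> b))) (at x)"
    by (auto intro!: derivative_eq_intros)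
  from bounded_linear.has_derivative[OF bounded_linear_divide[of mass] has_derivative_diff[OF
        has_derivative_diff[OF npot_has_derivative[OF assms] has_derivative_const[of "npot g 0"]] this]]
  show ?thesis
    unfolding corr_def[abs_def]
    by (simp add: sum_subtractf[symmetric] left_diff_distrib sum_divide_distrib diff_divide_distrib)
qed

lemma corr_diff:
  assumes "csupp r g" "csupp r g'"
  shows "corr (\<lambda>y. g y - g' y) x = corr g x - corr g' x"
  unfolding corr_def using npot_diff[OF assms] grad_pot_diff[OF assms]
  by (simp add: left_diff_distrib sum_subtractf diff_divide_distrib)

text \<open>\<open>corr g\<close> vanishes at the origin and has a bounded gradient. The factor
  \<open>norm x\<close> later yields the linear vanishing of the fixed point. The 4 is the dimension
  times the two gradient terms, at x and at 0.\<close>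

lemma corr_bound:
  assumes "0 \<le> r"
  obtains C where "0 \<le> C" "\<And>g M x. csupp r g \<Longrightarrow> (\<And>y. \<bar>g y\<bar> \<le> M) \<Longrightarrow> norm x \<le> r \<Longrightarrow> \<bar>corr g x\<bar> \<le> C * M * norm x"
proof -
  obtain C where C: "0 \<le> C" "\<And>g M x b. b \<in> Basis \<Longrightarrow> csupp r g \<Longrightarrow> (\<And>y. \<bar>g y\<bar> \<le> M) \<Longrightarrow> norm x \<le> r
    \<Longrightarrow> \<bar>grad_pot b g x\<bar> \<le> C * M"
    using grad_pot_bound[OF assms] by blast
  have "\<bar>corr g x\<bar> \<le> (4 * C / mass) * M * norm x"
    if g: "csupp r g" "\<And>y. \<bar>g y\<bar> \<le> M" and x: "norm x \<le> r" for g M x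
  proof -
    have "\<bar>corr g x - corr g 0\<bar> \<le> (real DIM(complex) * (2 * (C * M) / mass)) * dist x 0"
    proof (rule bounded_pd_imp_lipschitz[OF convex_cball corr_has_derivative[OF g(1)]])
      fix b y :: complex assume "b \<in> Basis" "y \<in> cball 0 r"
      then have "\<bar>grad_pot b g y\<bar> \<le> C * M" "\<bar>grad_pot b g 0\<bar> \<le> C * M"
        using C(2)[of b g M] g assms by auto
      then have "\<bar>grad_pot b g y - grad_pot b g 0\<bar> \<le> 2 * (C * M)"
        by linarith
      then show "\<bar>(grad_pot b g y - grad_pot b g 0) / mass\<bar> \<le> 2 * (C * M) / mass"
        using mass_pos by (simp add: abs_divide divide_right_mono)
    qed (use x assms in auto)
    moreover have "corr g 0 = 0" by (simp add: corr_def)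
    ultimately show ?thesis by simp
  qed
  then show ?thesis
    using that[of "4 * C / mass"] C(1) mass_pos by auto
qed

section \<open>The fixed point equation\<close>

lemma continuous_on_corr: "csupp r g \<Longrightarrow> continuous_on S (corr g)"
  using has_derivative_imp_continuous_on[OF corr_has_derivative] .

text \<open>For \<open>g\<close> bounded by \<delta> times 2 \<epsilon> L^2, the argument of
  \<open>f\<close> is at most 2 \<epsilon> L^2, one half from \<open>quad\<close> and one half from
  \<open>corr g\<close>. This is within \<eta>, where \<open>f\<close> contracts by \<delta>, and
  the initial bound is reproduced. The same smallness of \<delta> gives the contraction factor
  1/2.\<close>

lemma fixed_point_exists:
  fixes f :: "real \<Rightarrow> real"
  assumes L: "0 < L" and \<zeta>: "csupp L \<zeta>" "\<And>x. 0 \<le> \<zeta> x" "\<And>x. \<zeta> x \<le> 1"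
    and C: "0 \<le> C" "\<And>g M x. csupp L g \<Longrightarrow> (\<And>y. \<bar>g y\<bar> \<le> M) \<Longrightarrow> norm x \<le> L \<Longrightarrow> \<bar>corr g x\<bar> \<le> C * M * norm x"
    and f: "continuous_on UNIV f" "f 0 = 0"
      "\<And>s t. \<bar>s\<bar> \<le> \<eta> \<Longrightarrow> \<bar>t\<bar> \<le> \<eta> \<Longrightarrow> \<bar>f s - f t\<bar> \<le> \<delta> * \<bar>s - t\<bar>"
    and \<delta>: "0 < \<delta>" "\<delta> * (2 * C * L) \<le> 1" and \<epsilon>: "0 < \<epsilon>" "2 * \<epsilon> * L\<^sup>2 \<le> \<eta>"
  shows "\<exists>g. csupp L g \<and> (\<forall>y. \<bar>g y\<bar> \<le> 2 * \<delta> * \<epsilon> * L\<^sup>2) \<and>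
    (\<forall>x. g x = \<zeta> x * f (\<epsilon> * quad x + corr g x))"
proof -
  define M where "M = 2 * \<delta> * \<epsilon> * L\<^sup>2"
  have M: "0 \<le> M" using \<delta>(1) \<epsilon>(1) by (simp add: M_def)
  \<comment> \<open>The singleton off the disc expresses the support condition as a pointwise closed
    constraint, so that \<open>X\<close> is closed and hence complete in the space of bounded
    continuous functions.\<close>
  define X where "X = PiC UNIV (\<lambda>x::complex. if norm x \<le> L then {-M..M} else {0::real})"
  define F where "F g x = \<zeta> x * f (\<epsilon> * quad x + corr g x)" for g x
  have X: "\<phi> \<in> X \<longleftrightarrow> (\<forall>x. \<bar>apply_bcontfun \<phi> x\<bar> \<le> M \<and> (L < norm x \<longrightarrow> apply_bcontfun \<phi> x = 0))" for \<phi>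
    unfolding X_def mem_PiC_iff using M by (auto simp: Pi_iff abs_le_iff not_le split: if_splits) (smt (verit))+
  have XI: "csupp L (apply_bcontfun \<phi>)" "\<bar>apply_bcontfun \<phi> y\<bar> \<le> M" if "\<phi> \<in> X" for \<phi> y
    using that unfolding X csupp_def by auto
  have arg: "\<bar>\<epsilon> * quad x + corr g x\<bar> \<le> 2 * \<epsilon> * L\<^sup>2"
    if "csupp L g" "\<And>y. \<bar>g y\<bar> \<le> M" "norm x \<le> L" for g x
  proof -
    have "\<bar>quad x\<bar> \<le> L\<^sup>2"
      using quad_le[of x] power_mono[OF that(3), of 2] by simp
    then have "\<bar>\<epsilon> * quad x\<bar> \<le> \<epsilon> * L\<^sup>2"
      using \<epsilon>(1) by (simp add: abs_mult)
    moreover have "\<bar>corr g x\<bar> \<le> \<epsilon> * L\<^sup>2"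
    proof -
      have "\<bar>corr g x\<bar> \<le> C * M * norm x" by (rule C(2)[OF that])
      also have "\<dots> \<le> C * M * L" using C(1) M that(3) by (intro mult_left_mono) auto
      also have "\<dots> = (\<delta> * (2 * C * L)) * (\<epsilon> * L\<^sup>2)" by (simp add: M_def)
      also have "\<dots> \<le> 1 * (\<epsilon> * L\<^sup>2)" using \<delta>(2) \<epsilon>(1) by (intro mult_right_mono) auto
      finally show ?thesis by simp
    qed
    ultimately show ?thesis by linarith
  qed
  have contF: "continuous_on UNIV (F g)" if "csupp L g" for g
  proof -
    have "continuous_on UNIV \<zeta>" using \<zeta>(1) by (simp add: csupp_def)
    moreover have "continuous_on UNIV quad" by (rule C_loc_imp_continuous[OF C_loc_quad]) simp
    ultimately show ?thesis
      unfolding F_def[abs_def]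
      by (intro continuous_intros continuous_on_compose2[OF f(1)] continuous_on_corr[OF that]) auto
  qed
  have F0: "F g x = 0" if "L < norm x" for g x
    using \<zeta>(1) that by (simp add: F_def csupp_def)
  have FM: "\<bar>F g x\<bar> \<le> M" if "csupp L g" "\<And>y. \<bar>g y\<bar> \<le> M" for g x
  proof (cases "norm x \<le> L")
    case True
    let ?u = "\<epsilon> * quad x + corr g x"
    have u: "\<bar>?u\<bar> \<le> 2 * \<epsilon> * L\<^sup>2" by (rule arg[OF that True])
    have "\<bar>f ?u\<bar> \<le> \<delta> * \<bar>?u\<bar>"
      using f(3)[of ?u 0] u \<epsilon> f(2) by simp
    also have "\<dots> \<le> \<delta> * (2 * \<epsilon> * L\<^sup>2)"
      using u \<delta>(1) by (intro mult_left_mono) auto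
    finally have "\<bar>f ?u\<bar> \<le> M" by (simp add: M_def mult_ac)
    then have "\<bar>\<zeta> x\<bar> * \<bar>f ?u\<bar> \<le> 1 * M"
      using \<zeta>(2,3)[of x] by (intro mult_mono) auto
    then show ?thesis by (simp add: F_def abs_mult)
  next
    case False
    then show ?thesis using F0 M by simp
  qed
  define T where "T \<phi> = Bcontfun (F (apply_bcontfun \<phi>))" for \<phi>
  have T: "apply_bcontfun (T \<phi>) = F (apply_bcontfun \<phi>)" if "\<phi> \<in> X" for \<phi>
    unfolding T_def
    by (rule Bcontfun_inverse) (use contF[OF XI(1)[OF that]] FM[OF XI[OF that]] in
        \<open>auto intro!: bcontfun_normI\<close>)
  have "\<exists>!\<phi>\<in>X. T \<phi> = \<phi>"
  proof (rule Banach_fix)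
    show "complete X"
      unfolding X_def by (intro closed_PiC[THEN complete_eq_closed[THEN iffD2]]) auto
    have "(0 :: complex \<Rightarrow>\<^sub>C real) \<in> X" unfolding X using M by simp
    then show "X \<noteq> {}" by blast
    show "T ` X \<subseteq> X"
      using FM[OF XI] F0 by (auto simp: X T)
    show "dist (T \<phi>) (T \<psi>) \<le> (1/2) * dist \<phi> \<psi>" if "\<phi> \<in> X" "\<psi> \<in> X" for \<phi> \<psi>
    proof (rule dist_bound)
      fix x
      let ?g = "apply_bcontfun \<phi>" and ?h = "apply_bcontfun \<psi>"
      have d: "\<bar>?g y - ?h y\<bar> \<le> dist \<phi> \<psi>" for y
        using dist_bounded[of \<phi> y \<psi>] by (simp add: dist_real_def)
      show "dist (apply_bcontfun (T \<phi>) x) (apply_bcontfun (T \<psi>) x) \<le> (1/2) * dist \<phi> \<psi>"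
      proof (cases "norm x \<le> L")
        case True
        let ?u = "\<epsilon> * quad x + corr ?g x" and ?v = "\<epsilon> * quad x + corr ?h x"
        have "\<bar>f ?u - f ?v\<bar> \<le> \<delta> * \<bar>?u - ?v\<bar>"
          using arg[OF XI[OF that(1)] True] arg[OF XI[OF that(2)] True] \<epsilon> by (intro f(3)) auto
        also have "?u - ?v = corr (\<lambda>y. ?g y - ?h y) x"
          using corr_diff[OF XI(1)[OF that(1)] XI(1)[OF that(2)]] by simp
        also have "\<delta> * \<bar>corr (\<lambda>y. ?g y - ?h y) x\<bar> \<le> \<delta> * (C * dist \<phi> \<psi> * L)"
        proof (rule mult_left_mono)
          have "\<bar>corr (\<lambda>y. ?g y - ?h y) x\<bar> \<le> C * dist \<phi> \<psi> * norm x"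
            by (rule C(2)[OF csupp_diff[OF XI(1)[OF that(1)] XI(1)[OF that(2)]] d True])
          also have "\<dots> \<le> C * dist \<phi> \<psi> * L"
            using True C(1) by (intro mult_left_mono) auto
          finally show "\<bar>corr (\<lambda>y. ?g y - ?h y) x\<bar> \<le> C * dist \<phi> \<psi> * L" .
        qed (use \<delta> in simp)
        also have "\<dots> = (\<delta> * (2 * C * L)) * (dist \<phi> \<psi> / 2)" by simp
        also have "\<dots> \<le> 1 * (dist \<phi> \<psi> / 2)" using \<delta>(2) by (intro mult_right_mono) auto
        finally have "\<bar>\<zeta> x\<bar> * \<bar>f ?u - f ?v\<bar> \<le> 1 * (dist \<phi> \<psi> / 2)"
          using \<zeta>(2,3)[of x] by (intro mult_mono) auto
        then show ?thesis
          using that by (simp add: T F_def dist_real_def abs_mult flip: right_diff_distrib)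
      next
        case False
        then show ?thesis using that F0 by (simp add: T)
      qed
    qed
  qed auto
  then obtain \<phi> where \<phi>: "\<phi> \<in> X" "T \<phi> = \<phi>" by blast
  show ?thesis
  proof (intro exI[of _ "apply_bcontfun \<phi>"] conjI allI)
    show "csupp L (apply_bcontfun \<phi>)" "\<bar>apply_bcontfun \<phi> y\<bar> \<le> 2 * \<delta> * \<epsilon> * L\<^sup>2" for y
      using XI[OF \<phi>(1)] by (auto simp: M_def)
    show "apply_bcontfun \<phi> x = \<zeta> x * f (\<epsilon> * quad x + corr (apply_bcontfun \<phi>) x)" for x
      using T[OF \<phi>(1)] \<phi>(2) unfolding F_def[abs_def] by metis
  qed
qed

text \<open>The start of the bootstrap, where the fixed point is only known to be continuous.
  Enlarging the radius of the support to t makes \<open>grad_pot_bound\<close> available on any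
  given disc.\<close>

lemma corr_lipschitz:
  assumes g: "csupp r g"
  shows "hoelder_on 1 UNIV (corr g)"
proof (rule hoelder_onI)
  fix s
  define t where "t = max 0 (max r s)"
  have gt: "csupp t g"
    using g by (simp add: csupp_def t_def)
  obtain M where M: "\<And>y. \<bar>g y\<bar> \<le> M"
    using csupp_bounded[OF g] by metis
  have "0 \<le> t" by (simp add: t_def)
  then obtain C where C: "\<And>g M x b. b \<in> Basis \<Longrightarrow> csupp t g \<Longrightarrow> (\<And>y. \<bar>g y\<bar> \<le> M) \<Longrightarrow> norm x \<le> t
    \<Longrightarrow> \<bar>grad_pot b g x\<bar> \<le> C * M"
    using grad_pot_bound by metis
  have "\<bar>(grad_pot b g x - grad_pot b g 0) / mass\<bar> \<le> 2 * (C * M) / mass"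
    if "b \<in> Basis" "x \<in> cball 0 t" for b x
  proof -
    have "\<bar>grad_pot b g x\<bar> \<le> C * M" "\<bar>grad_pot b g 0\<bar> \<le> C * M"
      using C[OF that(1) gt M, of x] C[OF that(1) gt M, of 0] that(2) \<open>0 \<le> t\<close> by auto
    then have "\<bar>grad_pot b g x - grad_pot b g 0\<bar> \<le> 2 * (C * M)"
      by linarith
    then show ?thesis
      using mass_pos by (simp add: abs_divide divide_right_mono)
  qed
  from bounded_pd_imp_lipschitz[OF convex_cball[of 0 t] corr_has_derivative[OF g] this]
  have "\<bar>corr g x - corr g y\<bar> \<le> (real DIM(complex) * (2 * (C * M) / mass)) * dist x y powr 1"
    if "norm x \<le> s" "norm y \<le> s" for x y
    using that by (simp add: t_def)
  then show "\<exists>C. \<forall>x y. norm x \<le> s \<longrightarrow> norm y \<le> s \<longrightarrow> \<bar>corr g x - corr g y\<bar> \<le> C * dist x y powr 1"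
    by blast
qed

lemma C_loc_corr:
  assumes "csupp r g" "C_loc k \<alpha> g" "0 < \<alpha>" "\<alpha> < 1"
  shows "C_loc (Suc (Suc k)) \<alpha> (corr g)"
proof -
  have "C_loc (Suc (Suc k)) \<alpha> (\<lambda>x. (1 / mass) * (npot g x - npot g 0 - (\<Sum>b\<in>Basis. grad_pot b g 0 * (x \<bullet> b))))"
    by (intro C_loc_cmult C_loc_diff C_loc_sum npot_C_loc[OF assms] C_loc_const C_loc_linear
        bounded_linear_inner_left) (use assms in auto)
  then show ?thesis by (simp add: corr_def[abs_def])
qed

section \<open>Solutions in the plane\<close>

lemma small_lipschitz_constant:
  fixes f :: "real \<Rightarrow> real"
  assumes f: "C_loc (Suc k) \<alpha> f" "0 < \<alpha>" and "deriv f 0 = 0" "0 < \<delta>"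
  obtains \<eta> where "0 < \<eta>" "\<And>s t. \<bar>s\<bar> \<le> \<eta> \<Longrightarrow> \<bar>t\<bar> \<le> \<eta> \<Longrightarrow> \<bar>f s - f t\<bar> \<le> \<delta> * \<bar>s - t\<bar>"
proof -
  have D: "(f has_derivative (\<lambda>h. \<Sum>b\<in>Basis. pd b f x * (h \<bullet> b))) (at x)" for x
    by (rule C_loc_SucD(1)[OF f(1)])
  have "(f has_real_derivative pd 1 f 0) (at 0)"
    using D[of 0] by (simp add: has_field_derivative_def)
  then have f'0: "pd 1 f 0 = 0"
    using assms(3) DERIV_imp_deriv by metis
  have "isCont (pd 1 f) 0"
    using C_loc_imp_continuous[OF C_loc_SucD(2)[OF f(1), of 1] f(2), of UNIV]
    by (simp add: continuous_on_eq_continuous_at)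
  then obtain d where d: "d > 0" "\<And>x. dist x 0 < d \<Longrightarrow> dist (pd 1 f x) (pd 1 f 0) < \<delta>"
    unfolding continuous_at_eps_delta using \<open>0 < \<delta>\<close> by metis
  show ?thesis
  proof (rule that[of "d / 2"])
    fix s t :: real assume st: "\<bar>s\<bar> \<le> d / 2" "\<bar>t\<bar> \<le> d / 2"
    have "\<bar>f s - f t\<bar> \<le> (real DIM(real) * \<delta>) * dist s t"
    proof (rule bounded_pd_imp_lipschitz[OF convex_cball D])
      show "\<bar>pd b f x\<bar> \<le> \<delta>" if "b \<in> Basis" "x \<in> cball 0 (d / 2)" for b x
        using d(2)[of x] d(1) that f'0 by (auto simp: dist_real_def)
    qed (use st in \<open>auto simp: dist_real_def\<close>)
    then show "\<bar>f s - f t\<bar> \<le> \<delta> * \<bar>s - t\<bar>"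
      by (simp add: dist_real_def)
  qed (use d in simp)
qed

lemma laplace_solution:
  assumes g: "csupp r g" "hoelder_on \<alpha> UNIV g" and \<alpha>: "0 < \<alpha>" "\<alpha> \<le> 1"
    and v: "v = (\<lambda>x. \<epsilon> * quad x + corr g x)"
  shows "laplace v x = g x"
    and "v 0 = 0"
    and "b \<in> Basis \<Longrightarrow> pd b v 0 = 0"
    and "pd 1 (pd 1 v) 0 = 2 * \<epsilon> + hess_pot 1 1 g 0 / mass"
proof -
  have Q: "C_loc (Suc (Suc 0)) 1 quad" by (rule C_loc_quad)
  show "v 0 = 0"
    by (simp add: v quad_def corr_def)
  have pd1: "pd b v = (\<lambda>x. \<epsilon> * pd b quad x + (grad_pot b g x - grad_pot b g 0) / mass)"
    if "b \<in> Basis" for b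
  proof
    fix x
    have "(v has_derivative (\<lambda>h. \<Sum>b\<in>Basis. (\<epsilon> * pd b quad x + (grad_pot b g x - grad_pot b g 0) / mass) * (h \<bullet> b))) (at x)"
      unfolding v
      using has_derivative_add[OF has_derivative_mult_right[OF C_loc_SucD(1)[OF Q], of \<epsilon>] corr_has_derivative[OF g(1)]]
      by (simp add: distrib_right sum.distrib sum_distrib_left mult.assoc)
    then show "pd b v x = \<epsilon> * pd b quad x + (grad_pot b g x - grad_pot b g 0) / mass"
      by (rule pd_eq_sumI[OF _ that])
  qed
  show "pd b v 0 = 0" if "b \<in> Basis"
    using pd_quad[OF that, of 0] by (simp add: pd1[OF that])
  have pd2: "pd b (pd b v) x = \<epsilon> * pd b (pd b quad) x + hess_pot b b g x / mass" if b: "b \<in> Basis" for b x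
  proof -
    have "((\<lambda>x. \<epsilon> * pd b quad x + (grad_pot b g x - grad_pot b g 0) / mass) has_derivative
        (\<lambda>h. \<epsilon> * (\<Sum>c\<in>Basis. pd c (pd b quad) x * (h \<bullet> c)) + ((\<Sum>c\<in>Basis. hess_pot c b g x * (h \<bullet> c)) - 0) / mass)) (at x)"
      by (intro has_derivative_add has_derivative_mult_right C_loc_SucD(1)[OF C_loc_SucD(2)[OF Q b]]
          bounded_linear.has_derivative[OF bounded_linear_divide] has_derivative_diff
          grad_pot_has_derivative[OF g \<alpha> b] has_derivative_const)
    then have "(pd b v has_derivative
        (\<lambda>h. \<Sum>c\<in>Basis. (\<epsilon> * pd c (pd b quad) x + hess_pot c b g x / mass) * (h \<bullet> c))) (at x)"
      unfolding pd1[OF b]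
      by (simp add: distrib_right sum.distrib sum_distrib_left sum_divide_distrib mult.assoc)
    then show ?thesis by (rule pd_eq_sumI[OF _ b])
  qed
  have one: "(1::complex) \<in> Basis" by (simp add: Basis_complex_def)
  show "pd 1 (pd 1 v) 0 = 2 * \<epsilon> + hess_pot 1 1 g 0 / mass"
    using pd2[OF one, of 0] pd_pd_quad[OF one, of 0] by simp
  have "laplace (npot g) x = (\<Sum>b\<in>Basis. hess_pot b b g x)"
    unfolding laplace_def
    by (intro sum.cong refl) (simp add: pd_npot[OF g(1)] pd_eq_sumI[OF grad_pot_has_derivative[OF g \<alpha>]])
  then have h: "(\<Sum>b\<in>Basis. hess_pot b b g x) = mass * g x"
    using laplace_npot[OF g \<alpha>] by simp
  have q: "(\<Sum>b\<in>Basis. pd b (pd b quad) x) = 0"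
    using pd_pd_quad by (simp add: Basis_complex_def)
  have "laplace v x = \<epsilon> * (\<Sum>b\<in>Basis. pd b (pd b quad) x) + (\<Sum>b\<in>Basis. hess_pot b b g x) / mass"
    unfolding laplace_def using pd2 by (simp add: sum.distrib sum_distrib_left sum_divide_distrib)
  then show "laplace v x = g x"
    unfolding h q using mass_pos by simp
qed

lemma planar_solutions_exist:
  fixes f :: "real \<Rightarrow> real"
  assumes f: "C_loc (Suc k) \<alpha> f" "f 0 = 0" "deriv f 0 = 0" and \<alpha>: "0 < \<alpha>" "\<alpha> < 1" and R: "0 < R"
  obtains \<epsilon>\<^sub>0 where "0 < \<epsilon>\<^sub>0" "\<And>\<epsilon>. 0 < \<epsilon> \<Longrightarrow> \<epsilon> \<le> \<epsilon>\<^sub>0 \<Longrightarrow> \<exists>v. C_loc (Suc (Suc (Suc k))) \<alpha> v \<and>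
    (\<forall>x\<in>cball 0 R. laplace v x = f (v x)) \<and> v 0 = 0 \<and> (\<forall>b\<in>Basis. pd b v 0 = 0) \<and> pd 1 (pd 1 v) 0 \<noteq> 0 \<and>
    \<epsilon> * R\<^sup>2 / 2 \<le> v (complex_of_real R) \<and> v (complex_of_real R) \<le> 3 * \<epsilon> * R\<^sup>2 / 2 \<and> v (\<i> * complex_of_real R) < 0"
proof -
  define L where "L = R + 1"
  have L: "0 < L" "R \<le> L" using R by (auto simp: L_def)
  have \<alpha>1: "\<alpha> \<le> 1" using \<alpha> by simp
  have one: "(1::complex) \<in> Basis" by (simp add: Basis_complex_def)
  obtain \<zeta> :: "complex \<Rightarrow> real" where \<zeta>: "C_loc (Suc k) \<alpha> \<zeta>" "csupp L \<zeta>"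
    "\<And>x. 0 \<le> \<zeta> x" "\<And>x. \<zeta> x \<le> 1" "\<And>x. norm x \<le> R \<Longrightarrow> \<zeta> x = 1"
    using cutoff_exists[OF R \<alpha>(1) \<alpha>1] unfolding L_def by metis
  obtain C where C: "0 \<le> C" "\<And>g M x. csupp L g \<Longrightarrow> (\<And>y. \<bar>g y\<bar> \<le> M) \<Longrightarrow> norm x \<le> L \<Longrightarrow> \<bar>corr g x\<bar> \<le> C * M * norm x"
    using corr_bound L(1) less_imp_le by metis
  obtain C' where C': "0 \<le> C'" "\<And>g A. csupp L g \<Longrightarrow> (\<And>y. \<bar>g y\<bar> \<le> A * norm y) \<Longrightarrow> \<bar>hess_pot 1 1 g 0\<bar> \<le> C' * A"
    using hess_pot_0_bound[OF less_imp_le[OF L(1)] one one] by metis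
  \<comment> \<open>Three demands on \<delta>: \<delta> a <= 1 gives the contraction, \<delta> b <=
    1 keeps the correction within \<epsilon> R^2 / 2 at norm R, where \<open>quad\<close>
    contributes \<epsilon> R^2 in modulus at the two test points, and \<delta> c <= 1 keeps its
    second derivative at the origin within \<epsilon>, against 2 \<epsilon> from
    \<open>quad\<close>.\<close>
  define a where "a = 2 * C * L"
  define b where "b = 4 * C * L\<^sup>2 / R"
  define c where "c = 2 * C' * L / mass"
  define \<delta> where "\<delta> = 1 / (1 + a + b + c)"
  have abc: "0 \<le> a" "0 \<le> b" "0 \<le> c"
    using C(1) C'(1) L R mass_pos by (auto simp: a_def b_def c_def)
  have \<delta>: "0 < \<delta>" "\<delta> * a \<le> 1" "\<delta> * b \<le> 1" "\<delta> * c \<le> 1"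
    using abc by (auto simp: \<delta>_def divide_simps)
  obtain \<eta> where \<eta>: "0 < \<eta>" "\<And>s t. \<bar>s\<bar> \<le> \<eta> \<Longrightarrow> \<bar>t\<bar> \<le> \<eta> \<Longrightarrow> \<bar>f s - f t\<bar> \<le> \<delta> * \<bar>s - t\<bar>"
    using small_lipschitz_constant[OF f(1) \<alpha>(1) f(3) \<delta>(1)] by metis
  show ?thesis
  \<comment> \<open>Below this threshold the arguments of \<open>f\<close>, bounded by 2 \<epsilon>
    L^2, stay in the interval where the Lipschitz constant is \<delta>. The choice of \<delta> and
    \<eta> does not involve \<epsilon>.\<close>
  proof (rule that[of "\<eta> / (2 * L\<^sup>2)"])
    show "0 < \<eta> / (2 * L\<^sup>2)" using \<eta>(1) L by simp
    fix \<epsilon> assume \<epsilon>: "0 < \<epsilon>" "\<epsilon> \<le> \<eta> / (2 * L\<^sup>2)"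
    have \<epsilon>\<eta>: "2 * \<epsilon> * L\<^sup>2 \<le> \<eta>"
      using \<epsilon>(2) L by (simp add: field_simps)
    have cf: "continuous_on UNIV f" by (rule C_loc_imp_continuous[OF f(1) \<alpha>(1)])
    have "\<exists>g. csupp L g \<and> (\<forall>y. \<bar>g y\<bar> \<le> 2 * \<delta> * \<epsilon> * L\<^sup>2) \<and> (\<forall>x. g x = \<zeta> x * f (\<epsilon> * quad x + corr g x))"
      by (rule fixed_point_exists[where C = C and \<eta> = \<eta>])
        (fact L \<zeta> C cf f \<eta> \<delta>(1) \<delta>(2)[unfolded a_def] \<epsilon> \<epsilon>\<eta>)+
    then obtain g where g: "csupp L g" "\<And>y. \<bar>g y\<bar> \<le> 2 * \<delta> * \<epsilon> * L\<^sup>2"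
      "\<And>x. g x = \<zeta> x * f (\<epsilon> * quad x + corr g x)"
      by blast
    define v where "v = (\<lambda>x. \<epsilon> * quad x + corr g x)"
    have gv: "g = (\<lambda>x. \<zeta> x * f (v x))"
      using g(3) by (auto simp: v_def)
    have corr: "\<bar>corr g x\<bar> \<le> \<epsilon> * R / 2 * norm x" if "norm x \<le> L" for x
    proof -
      have "C * (2 * \<delta> * \<epsilon> * L\<^sup>2) = \<delta> * b * (\<epsilon> * R / 2)"
        using R by (simp add: b_def)
      also have "\<dots> \<le> 1 * (\<epsilon> * R / 2)"
        using \<delta>(3) \<epsilon>(1) R by (intro mult_right_mono) auto
      finally have "C * (2 * \<delta> * \<epsilon> * L\<^sup>2) * norm x \<le> \<epsilon> * R / 2 * norm x"
        by (intro mult_right_mono) auto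
      then show ?thesis using C(2)[OF g(1,2) that] by linarith
    qed
    \<comment> \<open>Bootstrap: \<open>g\<close> of order j makes \<open>v\<close> of order j + 2,
      and then \<open>g = \<zeta> * f(v)\<close> has order j + 1, as long as \<open>f\<close> and
      the cutoff allow it.\<close>
    have reg: "C_loc j \<alpha> g" if "j \<le> Suc k" for j
      using that
    proof (induction j)
      case 0
      have "hoelder_on 1 UNIV (\<lambda>x. \<epsilon> * quad x)"
        using C_loc_cmult[OF C_loc_quad[of 0], of \<epsilon>] by (simp add: C_hoelder_0)
      from hoelder_add[OF this corr_lipschitz[OF g(1)]] have hv: "hoelder_on 1 UNIV v"
        by (simp add: v_def)
      have "hoelder_on \<alpha> UNIV f" "hoelder_on \<alpha> UNIV \<zeta>"
        using C_loc_mono[OF f(1) \<alpha>(1) \<alpha>1, of 0] C_loc_mono[OF \<zeta>(1) \<alpha>(1) \<alpha>1, of 0] by (auto simp: C_hoelder_0)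
      from hoelder_mult[OF this(2) hoelder_compose_lipschitz[OF this(1) hv \<alpha>(1)] \<alpha>(1)] show ?case
        unfolding C_hoelder_0 gv[symmetric] .
    next
      case (Suc j)
      then have "C_loc j \<alpha> g" by simp
      have Cv: "C_loc (Suc (Suc j)) \<alpha> v"
        unfolding v_def
        by (rule C_loc_add[OF C_loc_cmult[OF C_loc_lower_exponent[OF C_loc_quad \<alpha>(1) \<alpha>1] \<alpha>(1) \<alpha>1]
              C_loc_corr[OF g(1) \<open>C_loc j \<alpha> g\<close> \<alpha>]])
      have "C_loc (Suc j) \<alpha> f" "C_loc (Suc j) \<alpha> \<zeta>"
        using C_loc_mono[OF f(1) \<alpha>(1) \<alpha>1 Suc.prems] C_loc_mono[OF \<zeta>(1) \<alpha>(1) \<alpha>1 Suc.prems] by auto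
      from C_loc_mult[OF this(2) C_loc_compose[OF this(1) Cv \<alpha>(1) \<alpha>1] \<alpha>(1) \<alpha>1] show ?case
        unfolding gv[symmetric] .
    qed
    have hg: "hoelder_on \<alpha> UNIV g"
      using reg[of 0] by (simp add: C_hoelder_0)
    note sol = laplace_solution[OF g(1) hg \<alpha>(1) \<alpha>1 v_def]
    have Cv: "C_loc (Suc (Suc (Suc k))) \<alpha> v"
      unfolding v_def
      by (rule C_loc_add[OF C_loc_cmult[OF C_loc_lower_exponent[OF C_loc_quad \<alpha>(1) \<alpha>1] \<alpha>(1) \<alpha>1]
            C_loc_corr[OF g(1) reg[OF order_refl] \<alpha>]])
    \<comment> \<open>The hypothesis of \<open>hess_pot_0_bound\<close>: \<open>v\<close> vanishes
      at least linearly at the origin and \<open>f\<close> has Lipschitz constant \<delta> on its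
      range over the disc of radius L.\<close>
    have "\<bar>g y\<bar> \<le> (2 * \<delta> * \<epsilon> * L) * norm y" for y
    proof (cases "norm y \<le> L")
      case True
      have "\<bar>v y\<bar> \<le> \<epsilon> * (norm y)\<^sup>2 + \<epsilon> * R / 2 * norm y"
      proof -
        have "\<bar>\<epsilon> * quad y\<bar> \<le> \<epsilon> * (norm y)\<^sup>2"
          using quad_le[of y] \<epsilon>(1) by (simp add: abs_mult)
        then show ?thesis
          using corr[OF True] abs_triangle_ineq[of "\<epsilon> * quad y" "corr g y"] unfolding v_def by linarith
      qed
      also have "\<dots> = (\<epsilon> * (norm y + R / 2)) * norm y"
        by (simp add: algebra_simps power2_eq_square)
      also have "\<dots> \<le> (\<epsilon> * (2 * L)) * norm y"
        using True L \<epsilon>(1) by (intro mult_right_mono mult_left_mono) auto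
      finally have vy: "\<bar>v y\<bar> \<le> (\<epsilon> * (2 * L)) * norm y" .
      also have "\<dots> \<le> (\<epsilon> * (2 * L)) * L"
        using True L \<epsilon>(1) by (intro mult_left_mono) auto
      also have "\<dots> \<le> \<eta>"
        using \<epsilon>\<eta> by (simp add: power2_eq_square mult_ac)
      finally have "\<bar>f (v y)\<bar> \<le> \<delta> * \<bar>v y\<bar>"
        using \<eta>(2)[of "v y" 0] \<eta>(1) f(2) by simp
      also have "\<dots> \<le> \<delta> * ((\<epsilon> * (2 * L)) * norm y)"
        using vy \<delta>(1) by (intro mult_left_mono) auto
      finally have "\<bar>\<zeta> y\<bar> * \<bar>f (v y)\<bar> \<le> 1 * (\<delta> * ((\<epsilon> * (2 * L)) * norm y))"
        using \<zeta>(3,4)[of y] by (intro mult_mono) auto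
      then show ?thesis
        by (subst gv) (simp add: abs_mult mult_ac)
    next
      case False
      then show ?thesis
        using g(1) \<delta>(1) \<epsilon>(1) L by (simp add: csupp_def)
    qed
    then have "\<bar>hess_pot 1 1 g 0\<bar> \<le> C' * (2 * \<delta> * \<epsilon> * L)"
      by (rule C'(2)[OF g(1)])
    then have "\<bar>hess_pot 1 1 g 0 / mass\<bar> \<le> C' * (2 * \<delta> * \<epsilon> * L) / mass"
      using mass_pos by (simp add: abs_divide divide_right_mono)
    also have "\<dots> = \<delta> * c * \<epsilon>"
      by (simp add: c_def)
    also have "\<dots> \<le> 1 * \<epsilon>"
      using \<delta>(4) \<epsilon>(1) by (intro mult_right_mono) auto
    finally have hess: "pd 1 (pd 1 v) 0 \<noteq> 0"
      using \<epsilon>(1) unfolding sol(4) by linarith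
    have "\<bar>corr g (complex_of_real R)\<bar> \<le> \<epsilon> * R\<^sup>2 / 2" "\<bar>corr g (\<i> * complex_of_real R)\<bar> \<le> \<epsilon> * R\<^sup>2 / 2"
      using corr[of "complex_of_real R"] corr[of "\<i> * complex_of_real R"] R L
      by (auto simp: norm_mult power2_eq_square)
    moreover have "quad (complex_of_real R) = R\<^sup>2" "quad (\<i> * complex_of_real R) = - R\<^sup>2"
      by (auto simp: quad_def power2_eq_square)
    moreover have "0 < \<epsilon> * R\<^sup>2"
      using \<epsilon>(1) R by simp
    ultimately have vals: "\<epsilon> * R\<^sup>2 / 2 \<le> v (complex_of_real R)" "v (complex_of_real R) \<le> 3 * \<epsilon> * R\<^sup>2 / 2"
      "v (\<i> * complex_of_real R) < 0"
      unfolding v_def by (auto simp: abs_le_iff)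
    have "laplace v x = f (v x)" if "x \<in> cball 0 R" for x
      using sol(1)[of x] fun_cong[OF gv, of x] \<zeta>(5)[of x] that by simp
    then show "\<exists>v. C_loc (Suc (Suc (Suc k))) \<alpha> v \<and>
      (\<forall>x\<in>cball 0 R. laplace v x = f (v x)) \<and> v 0 = 0 \<and> (\<forall>b\<in>Basis. pd b v 0 = 0) \<and> pd 1 (pd 1 v) 0 \<noteq> 0 \<and>
      \<epsilon> * R\<^sup>2 / 2 \<le> v (complex_of_real R) \<and> v (complex_of_real R) \<le> 3 * \<epsilon> * R\<^sup>2 / 2 \<and> v (\<i> * complex_of_real R) < 0"
      using Cv sol(2,3) hess vals by blast
  qed
qed

section \<open>Passage to higher dimensions\<close>

lemma pd_compose_linear:
  fixes v :: "'b::euclidean_space \<Rightarrow> real" and T :: "'a::euclidean_space \<Rightarrow> 'b"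
  assumes v: "C_loc (Suc k) \<alpha> v" and T: "bounded_linear T"
  shows "T b \<in> Basis \<Longrightarrow> pd b (\<lambda>x. v (T x)) x = pd (T b) v (T x)"
    and "T b = 0 \<Longrightarrow> pd b (\<lambda>x. v (T x)) x = 0"
proof -
  have "pd b (\<lambda>x. v (T x)) x = (\<Sum>c\<in>Basis. pd c v (T x) * (T b \<bullet> c))"
    by (rule pd_eqI[OF has_derivative_compose[OF bounded_linear_imp_has_derivative[OF T] C_loc_SucD(1)[OF v]]])
  moreover have "pd (T b) v (T x) = (\<Sum>c\<in>Basis. pd c v (T x) * (T b \<bullet> c))"
    by (rule pd_eqI[OF C_loc_SucD(1)[OF v]])
  ultimately show "T b \<in> Basis \<Longrightarrow> pd b (\<lambda>x. v (T x)) x = pd (T b) v (T x)"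
    "T b = 0 \<Longrightarrow> pd b (\<lambda>x. v (T x)) x = 0"
    by auto
qed

theorem corollary1p4:
  fixes f :: "real \<Rightarrow> real" and k :: nat and \<alpha> R :: real
  assumes "CARD('n::finite) \<ge> 2" and "k \<ge> 1" and "0 < \<alpha>" and "\<alpha> < 1"
    and "C_hoelder k \<alpha> UNIV f" and "f 0 = 0" and "deriv f 0 = 0"
    and "R > 0"
  shows "infinite {u \<in> extensional (cball (0 :: real ^ 'n) R).
           C_hoelder (k + 2) \<alpha> (cball 0 R) u \<and>
           (\<forall>x\<in>cball 0 R. laplacian_on (cball 0 R) u x = f (u x)) \<and>
           vanishing_order_two (cball 0 R) u \<and>
           \<not> radially_symmetric_on (cball 0 R) u \<and>
           \<not> positive_on (cball 0 R) u}"
    (is "infinite ?A")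
proof -
  \<comment> \<open>The planar result is phrased for order m + 1 so that \<open>f\<close> is
    differentiable; its solutions then have order m + 3 = k + 2.\<close>
  obtain m where m: "k = Suc m" using \<open>k \<ge> 1\<close> by (cases k) auto
  obtain i j :: 'n where ij: "i \<noteq> j"
    using assms(1) by (metis (full_types) One_nat_def card_le_Suc0_iff_eq finite UNIV_I not_less_eq_eq numeral_2_eq_2)
  define S where "S = cball (0 :: real ^ 'n) R"
  \<comment> \<open>The projection to two coordinates sends each basis vector to a basis vector of
    the plane or to 0, so that lifting a function along it preserves the Laplacian.\<close>
  define T :: "real ^ 'n \<Rightarrow> complex" where "T x = Complex (x $ i) (x $ j)" for x
  have T: "bounded_linear T"
    by (intro linear_conv_bounded_linear[THEN iffD1] linearI) (auto simp: T_def complex_eq_iff)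
  have Ti: "T (a *\<^sub>R axis i 1) = complex_of_real a" and Tj: "T (a *\<^sub>R axis j 1) = \<i> * complex_of_real a" for a
    using ij by (auto simp: T_def axis_def complex_eq_iff)
  have Ti1: "T (axis i 1) = 1" and Tj1: "T (axis j 1) = \<i>"
    using Ti[of 1] Tj[of 1] by auto
  have T0: "T (axis l 1) = 0" if "l \<noteq> i" "l \<noteq> j" for l
    using that by (auto simp: T_def axis_def complex_eq_iff)
  have Basis_cases: "b = axis i 1 \<or> b = axis j 1 \<or> T b = 0" if "b \<in> Basis" for b
  proof -
    have "\<exists>l. b = axis l 1"
      using that by (auto simp: Basis_vec_def)
    then obtain l where "b = axis l 1" ..
    then show ?thesis using T0[of l] by (cases "l = i"; cases "l = j") auto
  qed
  \<comment> \<open>The ball is mapped into the disc of the same radius, the only place where the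
    planar equation is known to hold.\<close>
  have nT: "norm (T x) \<le> norm x" for x
  proof -
    have "(norm (T x))\<^sup>2 = (x $ i)\<^sup>2 + (x $ j)\<^sup>2"
      by (simp add: T_def cmod_power2)
    also have "\<dots> = (\<Sum>l\<in>{i, j}. (x $ l)\<^sup>2)"
      using ij by simp
    also have "\<dots> \<le> (\<Sum>l\<in>UNIV. (x $ l)\<^sup>2)"
      by (rule sum_mono2) auto
    also have "\<dots> = (norm x)\<^sup>2"
      by (simp add: norm_vec_def L2_set_def sum_nonneg)
    finally show ?thesis by (simp add: power2_le_iff_abs_le)
  qed
  have S: "convex S" "interior S \<noteq> {}" "0 \<in> S"
    using \<open>R > 0\<close> by (auto simp: S_def)
  obtain \<epsilon>\<^sub>0 where \<epsilon>\<^sub>0: "0 < \<epsilon>\<^sub>0" "\<And>\<epsilon>. 0 < \<epsilon> \<Longrightarrow> \<epsilon> \<le> \<epsilon>\<^sub>0 \<Longrightarrow> \<exists>v. C_loc (Suc (Suc (Suc m))) \<alpha> v \<and>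
    (\<forall>x\<in>cball 0 R. laplace v x = f (v x)) \<and> v 0 = 0 \<and> (\<forall>b\<in>Basis. pd b v 0 = 0) \<and> pd 1 (pd 1 v) 0 \<noteq> 0 \<and>
    \<epsilon> * R\<^sup>2 / 2 \<le> v (complex_of_real R) \<and> v (complex_of_real R) \<le> 3 * \<epsilon> * R\<^sup>2 / 2 \<and> v (\<i> * complex_of_real R) < 0"
    using planar_solutions_exist[of m \<alpha> f R] assms unfolding m by metis
  \<comment> \<open>With ratio 4 the ranges [\<epsilon> R^2 / 2, 3 \<epsilon> R^2 / 2] of the value
    at R are disjoint, as the ratio of their end points is only 3.\<close>
  have "\<exists>v. \<forall>q. C_loc (Suc (Suc (Suc m))) \<alpha> (v q) \<and>
    (\<forall>x\<in>cball 0 R. laplace (v q) x = f (v q x)) \<and> v q 0 = 0 \<and> (\<forall>b\<in>Basis. pd b (v q) 0 = 0) \<and> pd 1 (pd 1 (v q)) 0 \<noteq> 0 \<and>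
    (\<epsilon>\<^sub>0 / 4 ^ q) * R\<^sup>2 / 2 \<le> v q (complex_of_real R) \<and> v q (complex_of_real R) \<le> 3 * (\<epsilon>\<^sub>0 / 4 ^ q) * R\<^sup>2 / 2 \<and>
    v q (\<i> * complex_of_real R) < 0"
    by (rule choice, rule allI, rule \<epsilon>\<^sub>0(2)) (use \<epsilon>\<^sub>0(1) in \<open>auto simp: divide_simps\<close>)
  then obtain v where v: "\<And>q. C_loc (Suc (Suc (Suc m))) \<alpha> (v q)"
    "\<And>q x. x \<in> cball 0 R \<Longrightarrow> laplace (v q) x = f (v q x)" "\<And>q. v q 0 = 0"
    "\<And>q b. b \<in> Basis \<Longrightarrow> pd b (v q) 0 = 0" "\<And>q. pd 1 (pd 1 (v q)) 0 \<noteq> 0"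
    "\<And>q. (\<epsilon>\<^sub>0 / 4 ^ q) * R\<^sup>2 / 2 \<le> v q (complex_of_real R)"
    "\<And>q. v q (complex_of_real R) \<le> 3 * (\<epsilon>\<^sub>0 / 4 ^ q) * R\<^sup>2 / 2"
    "\<And>q. v q (\<i> * complex_of_real R) < 0"
    by metis
  define w where "w q = (\<lambda>x. v q (T x))" for q
  \<comment> \<open>Fixing the values outside the ball makes the count one of functions on the ball,
    not of their extensions.\<close>
  define u where "u q = restrict (w q) S" for q
  have u: "u q x = w q x" if "x \<in> S" for q x
    using that by (simp add: u_def)
  have Cw: "C_loc (Suc (Suc (Suc m))) \<alpha> (w q)" for q
    unfolding w_def using C_loc_compose_affine[OF v(1) T, of q 0] assms by simp
  have C1: "C_loc (Suc (Suc m)) \<alpha> (pd b (v q))" if "b \<in> Basis" for b q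
    by (rule C_loc_SucD(2)[OF v(1) that])
  have one: "(1::complex) \<in> Basis" "\<i> \<in> Basis" by (auto simp: Basis_complex_def)
  have pdw: "pd b (w q) = (\<lambda>x. pd (T b) (v q) (T x))" if "T b \<in> Basis" for b q
    unfolding w_def using pd_compose_linear(1)[OF v(1) T that] by auto
  have pdw0: "pd b (w q) = (\<lambda>x. 0)" if "T b = 0" for b q
    unfolding w_def using pd_compose_linear(2)[OF v(1) T that] by auto
  have pd2w: "pd b (pd b (w q)) x = pd (T b) (pd (T b) (v q)) (T x)" if "T b \<in> Basis" for b q x
    unfolding pdw[OF that] by (rule pd_compose_linear(1)[OF C1[OF that] T that])
  have pd2w0: "pd b (pd b (w q)) x = 0" if "T b = 0" for b q x
    unfolding pdw0[OF that] by (rule pd_const)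
  have partials: "partials_on S bs (u q) x = partials_on UNIV bs (w q) x"
    if "bs \<in> lists Basis" "length bs \<le> 2" "x \<in> S" for bs q x
    using partials_on_eq[OF S(1,2) Cw u that(1) _ that(3)] that(2) by simp
  have lap: "laplacian_on S (u q) x = f (u q x)" if x: "x \<in> S" for q x
  proof -
    have "partials_on S [b, b] (u q) x = pd b (pd b (w q)) x" if "b \<in> Basis" for b
      using partials[of "[b, b]" x q] that x by simp
    then have "laplacian_on S (u q) x = (\<Sum>b\<in>Basis. pd b (pd b (w q)) x)"
      unfolding laplacian_on_def by (rule sum.cong[OF refl])
    also have "\<dots> = (\<Sum>b\<in>{axis i 1, axis j 1}. pd b (pd b (w q)) x)"
      by (rule sum.mono_neutral_right) (use Basis_cases pd2w0 in auto)
    also have "\<dots> = pd 1 (pd 1 (v q)) (T x) + pd \<i> (pd \<i> (v q)) (T x)"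
      using ij pd2w[of "axis i 1"] pd2w[of "axis j 1"] one by (simp add: axis_eq_axis Ti1 Tj1)
    also have "\<dots> = laplace (v q) (T x)"
      by (simp add: laplace_def Basis_complex_def)
    also have "\<dots> = f (v q (T x))"
      using nT[of x] x by (intro v(2)) (simp add: S_def)
    finally show ?thesis
      using u[OF x] by (simp add: w_def)
  qed
  have van: "vanishing_order_two S (u q)" for q
    unfolding vanishing_order_two_def
  proof (intro conjI ballI)
    show "u q 0 = 0"
      using u[OF S(3)] v(3)[of q] linear_0[OF bounded_linear.linear[OF T]] by (simp add: w_def)
    show "partial_on S b (u q) 0 = 0" if "b \<in> Basis" for b
    proof -
      have "partial_on S b (u q) 0 = pd b (w q) 0"
        using partials[of "[b]" 0 q] that S(3) by simp
      then show ?thesis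
        using Basis_cases[OF that] pdw[of b q] pdw0[of b q] v(4) one Ti1 Tj1 linear_0[OF bounded_linear.linear[OF T]] by auto
    qed
    have "partials_on S [axis i 1, axis i 1] (u q) 0 = pd 1 (pd 1 (v q)) 0"
      using partials[of "[axis i 1, axis i 1]" 0 q] S(3) pd2w[of "axis i 1" q 0] one Ti1 linear_0[OF bounded_linear.linear[OF T]]
      by (simp add: axis_in_Basis_iff)
    then show "\<exists>b\<in>Basis. \<exists>c\<in>Basis. partials_on S [b, c] (u q) 0 \<noteq> 0"
      using v(5)[of q] by (metis axis_in_Basis_iff Basis_real_def singletonI)
  qed
  \<comment> \<open>Two boundary points of equal norm at which the solution has opposite signs
    refute radial symmetry and positivity at once; the first one also separates the
    solutions.\<close>
  let ?p = "R *\<^sub>R axis i 1 :: real ^ 'n" and ?p' = "R *\<^sub>R axis j 1 :: real ^ 'n"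
  have p: "?p \<in> S" "?p' \<in> S" "norm ?p = norm ?p'"
    using \<open>R > 0\<close> by (auto simp: S_def)
  have up: "u q ?p = v q (complex_of_real R)" "u q ?p' = v q (\<i> * complex_of_real R)" for q
    using u p Ti Tj by (auto simp: w_def)
  have pos: "0 < u q ?p" "u q ?p' < 0" for q
  proof -
    have "0 < (\<epsilon>\<^sub>0 / 4 ^ q) * R\<^sup>2 / 2"
      using \<epsilon>\<^sub>0(1) \<open>R > 0\<close> by simp
    then show "0 < u q ?p" "u q ?p' < 0"
      using v(6)[of q] v(8)[of q] up by auto
  qed
  have "\<not> radially_symmetric_on S (u q)" for q
  proof
    assume "radially_symmetric_on S (u q)"
    then have "u q ?p = u q ?p'"
      using p unfolding radially_symmetric_on_def by blast
    then show False using pos[of q] by simp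
  qed
  moreover have "\<not> positive_on S (u q)" for q
    using p(2) pos(2)[of q] unfolding positive_on_def by (meson not_less)
  moreover have "C_hoelder (k + 2) \<alpha> S (u q)" for q
    using C_hoelder_restrict[OF S(1,2) Cw u, of q] by (simp add: m)
  moreover have "u q \<in> extensional S" for q
    by (simp add: u_def)
  ultimately have sub: "range u \<subseteq> ?A"
    unfolding S_def[symmetric] using lap van by (intro image_subsetI CollectI conjI ballI)
  have "inj u"
  proof (rule linorder_injI)
    fix q r :: nat assume "q < r"
    then have "(4::real) ^ Suc q \<le> 4 ^ r"
      by (intro power_increasing) auto
    then have "\<epsilon>\<^sub>0 / 4 ^ r \<le> \<epsilon>\<^sub>0 / 4 ^ Suc q"
      using \<epsilon>\<^sub>0(1) by (intro divide_left_mono) auto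
    then have "(\<epsilon>\<^sub>0 / 4 ^ r) * R\<^sup>2 \<le> (\<epsilon>\<^sub>0 / 4 ^ Suc q) * R\<^sup>2"
      by (rule mult_right_mono) simp
    moreover have "0 < (\<epsilon>\<^sub>0 / 4 ^ q) * R\<^sup>2"
      using \<epsilon>\<^sub>0(1) \<open>R > 0\<close> by simp
    \<comment> \<open>From r > q the upper bound for \<open>u r\<close> is at most 3/8 of \<epsilon>
      R^2, with \<epsilon> the parameter of \<open>u q\<close>, while the lower bound for
      \<open>u q\<close> is 1/2 of it.\<close>
    ultimately have "u r ?p < u q ?p"
      using v(6)[of q] v(7)[of r] up(1)[of q] up(1)[of r] by simp
    then show "u q \<noteq> u r" by auto
  qed
  then show ?thesis
    by (rule infinite_super[OF sub range_inj_infinite])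
qed

end
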